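(* Let $a>0$ and let $$(u_\infty,\tau_\infty,f_\infty)(y)=\left(ay,\ \frac{\sqrt{1+4\nu\xi Ga}+1}{2\xi},\ \frac{\sqrt{1+4\nu\xi Ga}-1}{2\nu}\right).$$ There exist a constant $C>0$ and an $\epsilon\in(0,C)$ (with $\epsilon$ sufficiently small so that at least $\tau_0$ and $f_0$ below are positive), where $C$ is independent of $\epsilon$, of time and of the initial data, such that the following holds. Let $(u_0,\tau_0,f_0)\in H^1(\Omega)^3$ with $f_0\ge0$, $u_0(0)=0$, $u_0(1)=a$, satisfy $$\|u_0-u_\infty\|_{H^1}^2+\|\tau_0-\tau_\infty\|_{L^\infty}^2+\|f_0-f_\infty\|_{L^\infty}^2\le\epsilon^2,$$ and let $(u,\tau,f)$ be the unique global solution of $$\rho\,\partial_t u=\eta\,\partial_{yy}u+\partial_y\tau,\qquad \lambda\,\partial_t\tau=G\,\partial_y u-f\tau,\qquad \partial_t f=(-1+\xi|\tau|)f^2-\nu f^3,$$ with initial conditions $(u_0,\tau_0,f_0)$ and boundary conditions $u(t,0)=0$, $u(t,1)=a$ for all $t\ge0$. Then $(u,\tau,f)$ converges, as $t\to\infty$, to $(u_\infty,\tau_\infty,f_\infty)$ in $H^1(\Omega)\times L^\infty(\Omega)\times L^\infty(\Omega)$. More precisely, there exists a constant $\kappa_\epsilon$ independent of time such that, for $t$ sufficiently large, $$\|u(t,\cdot)-u_\infty\|_{H^1}+\|\tau(t,\cdot)-\tau_\infty\|_{L^\infty}+\|f(t,\cdot)-f_\infty\|_{L^\infty}\le\kappa_\epsilon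 e^{-(C-\epsilon)t}.$$
   Context: $\Omega=[0,1]$ with space variable $y$; $t\ge0$ is time; $\rho,\eta,\lambda,G,\xi,\nu$ are positive constants; $u,\tau,f$ are real-valued functions of $(t,y)$. The triple $(u_\infty,\tau_\infty,f_\infty)$ is a stationary solution of the system with the given boundary conditions. For initial data as in the statement there is a unique global solution $(u,\tau,f)$ with, for every $T>0$, $(u,\tau,f)\in (C([0,T];H^1)\cap L^2([0,T];H^2))\times C([0,T];H^1)\times C([0,T];H^1)$ and $(\partial_t u,\partial_t\tau,\partial_t f)\in L^2([0,T];L^2)\times C([0,T];L^2)\times C([0,T];L^2)$; moreover $f\ge 0$. This is the solution meant in the statement. All function spaces in $y$ are over $\Omega$. *)

theory Defs
  imports "HOL-Analysis.Analysis" "HOL-Probability.Essential_Supremum"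
begin

abbreviation Omega :: "real set" where
  "Omega \<equiv> {0..1}"

definition test_fun :: "real \<Rightarrow> real \<Rightarrow> (real \<Rightarrow> real) \<Rightarrow> bool" where
  "test_fun a b \<phi> \<longleftrightarrow>
     (\<forall>n x. (deriv ^^ n) \<phi> differentiable (at x)) \<and>
     (\<exists>c d. a < c \<and> d < b \<and> (\<forall>x. x \<notin> {c..d} \<longrightarrow> \<phi> x = 0))"

definition L2 :: "(real \<Rightarrow> real) set" where
  "L2 = {f. f \<in> borel_measurable (lebesgue_on Omega) \<and>
            integrable (lebesgue_on Omega) (\<lambda>y. (f y)\<^sup>2)}"

definition L2_norm :: "(real \<Rightarrow> real) \<Rightarrow> real" where
  "L2_norm f = sqrt (LINT y|lebesgue_on Omega. (f y)\<^sup>2)"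

text \<open>
  \<^const>\<open>real_of_ereal\<close> sends infinity to 0, so this is the essential supremum norm only for
  essentially bounded functions. It is applied below only to differences of functions that are
  continuous on the compact set \<^const>\<open>Omega\<close>.
\<close>
definition Linf_norm :: "(real \<Rightarrow> real) \<Rightarrow> real" where
  "Linf_norm f = real_of_ereal (esssup (lebesgue_on Omega) (\<lambda>y. ereal \<bar>f y\<bar>))"

definition has_weak_deriv :: "(real \<Rightarrow> real) \<Rightarrow> (real \<Rightarrow> real) \<Rightarrow> bool" where
  "has_weak_deriv f g \<longleftrightarrow> f \<in> L2 \<and> g \<in> L2 \<and>
     (\<forall>\<phi>. test_fun 0 1 \<phi> \<longrightarrow>
        (LINT y|lebesgue_on Omega. f y * deriv \<phi> y) = - (LINT y|lebesgue_on Omega. g y * \<phi> y))"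

text \<open>A representative of the weak derivative, which is unique up to null sets.\<close>
definition wderiv :: "(real \<Rightarrow> real) \<Rightarrow> real \<Rightarrow> real" where
  "wderiv f = (SOME g. has_weak_deriv f g)"

text \<open>
  In one space dimension every element of the Sobolev space \<open>H\<^sup>1\<close> has a unique continuous
  representative on \<^const>\<open>Omega\<close>. We work with that representative, so that point values
  (boundary values in particular) are meaningful. The derivatives are merely elements of
  \<^const>\<open>L2\<close>, determined up to null sets.
\<close>
definition H1 :: "(real \<Rightarrow> real) set" where
  "H1 = {f. continuous_on Omega f \<and> (\<exists>g. has_weak_deriv f g)}"

definition H1_norm :: "(real \<Rightarrow> real) \<Rightarrow> real" where
  "H1_norm f = sqrt ((L2_norm f)\<^sup>2 + (L2_norm (wderiv f))\<^sup>2)"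

definition H2 :: "(real \<Rightarrow> real) set" where
  "H2 = {f \<in> H1. \<exists>g. has_weak_deriv (wderiv f) g}"

definition H2_norm :: "(real \<Rightarrow> real) \<Rightarrow> real" where
  "H2_norm f = sqrt ((L2_norm f)\<^sup>2 + (L2_norm (wderiv f))\<^sup>2 + (L2_norm (wderiv (wderiv f)))\<^sup>2)"

text \<open>
  Functions of \<open>(t, y)\<close> are curried, time first; a space of functions of \<open>y\<close> is given by its
  set \<open>X\<close> of elements and its norm \<open>N\<close>.
\<close>

definition in_C_time ::
  "(real \<Rightarrow> real) set \<Rightarrow> ((real \<Rightarrow> real) \<Rightarrow> real) \<Rightarrow> real \<Rightarrow> (real \<Rightarrow> real \<Rightarrow> real) \<Rightarrow> bool" where
  "in_C_time X N T u \<longleftrightarrow>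
     (\<forall>t\<in>{0..T}. u t \<in> X) \<and>
     (\<forall>s\<in>{0..T}. ((\<lambda>t. N (\<lambda>y. u t y - u s y)) \<longlongrightarrow> 0) (at s within {0..T}))"

text \<open>
  The Bochner space \<open>L\<^sup>2([0,T]; X)\<close>: strongly measurable, i.e. an almost everywhere limit of
  \<open>X\<close>-valued simple functions, with square integrable norm.
\<close>
definition in_L2_time ::
  "(real \<Rightarrow> real) set \<Rightarrow> ((real \<Rightarrow> real) \<Rightarrow> real) \<Rightarrow> real \<Rightarrow> (real \<Rightarrow> real \<Rightarrow> real) \<Rightarrow> bool" where
  "in_L2_time X N T u \<longleftrightarrow>
     (AE t in lebesgue_on {0..T}. u t \<in> X) \<and>
     (\<exists>s :: nat \<Rightarrow> real \<Rightarrow> real \<Rightarrow> real.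
        (\<forall>n. simple_function (lebesgue_on {0..T}) (s n) \<and> s n ` {0..T} \<subseteq> X) \<and>
        (AE t in lebesgue_on {0..T}. (\<lambda>n. N (\<lambda>y. s n t y - u t y)) \<longlonglongrightarrow> 0)) \<and>
     integrable (lebesgue_on {0..T}) (\<lambda>t. (N (u t))\<^sup>2)"

text \<open>
  \<open>v\<close> is the derivative of \<open>u\<close> in the sense of \<^const>\<open>L2\<close>-valued distributions on \<open>(0,T)\<close>; the
  identity between \<^const>\<open>L2\<close>-valued integrals is expressed by pairing with all \<open>h\<close> in \<^const>\<open>L2\<close>.
\<close>
definition has_weak_time_deriv ::
  "real \<Rightarrow> (real \<Rightarrow> real \<Rightarrow> real) \<Rightarrow> (real \<Rightarrow> real \<Rightarrow> real) \<Rightarrow> bool" where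
  "has_weak_time_deriv T u v \<longleftrightarrow>
     (\<forall>\<phi> h. test_fun 0 T \<phi> \<longrightarrow> h \<in> L2 \<longrightarrow>
        (LINT t|lebesgue_on {0..T}. (LINT y|lebesgue_on Omega. u t y * h y) * deriv \<phi> t) =
        - (LINT t|lebesgue_on {0..T}. (LINT y|lebesgue_on Omega. v t y * h y) * \<phi> t))"

text \<open>
  The partial differential equations hold as identities in \<^const>\<open>L2\<close> for almost every time.
  Nonnegativity of \<open>f\<close> is not part of the definition, since it follows from that of \<open>f0\<close>.
\<close>
definition global_solution ::
  "real \<Rightarrow> real \<Rightarrow> real \<Rightarrow> real \<Rightarrow> real \<Rightarrow> real \<Rightarrow> real \<Rightarrow>
   (real \<Rightarrow> real) \<Rightarrow> (real \<Rightarrow> real) \<Rightarrow> (real \<Rightarrow> real) \<Rightarrow>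
   (real \<Rightarrow> real \<Rightarrow> real) \<Rightarrow> (real \<Rightarrow> real \<Rightarrow> real) \<Rightarrow> (real \<Rightarrow> real \<Rightarrow> real) \<Rightarrow> bool" where
  "global_solution \<rho> \<eta> lam G \<xi> \<nu> a u0 \<tau>0 f0 u \<tau> f \<longleftrightarrow>
     (\<forall>y\<in>Omega. u 0 y = u0 y \<and> \<tau> 0 y = \<tau>0 y \<and> f 0 y = f0 y) \<and>
     (\<forall>t\<ge>0. u t 0 = 0 \<and> u t 1 = a) \<and>
     (\<exists>ut \<tau>t ft. \<forall>T>0.
        in_C_time H1 H1_norm T u \<and> in_L2_time H2 H2_norm T u \<and>
        in_C_time H1 H1_norm T \<tau> \<and> in_C_time H1 H1_norm T f \<and>
        has_weak_time_deriv T u ut \<and> in_L2_time L2 L2_norm T ut \<and>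
        has_weak_time_deriv T \<tau> \<tau>t \<and> in_C_time L2 L2_norm T \<tau>t \<and>
        has_weak_time_deriv T f ft \<and> in_C_time L2 L2_norm T ft \<and>
        (AE t in lebesgue_on {0..T}. AE y in lebesgue_on Omega.
           \<rho> * ut t y = \<eta> * wderiv (wderiv (u t)) y + wderiv (\<tau> t) y \<and>
           lam * \<tau>t t y = G * wderiv (u t) y - f t y * \<tau> t y \<and>
           ft t y = (- 1 + \<xi> * \<bar>\<tau> t y\<bar>) * (f t y)\<^sup>2 - \<nu> * (f t y) ^ 3))"

definition u_inf :: "real \<Rightarrow> real \<Rightarrow> real" where
  "u_inf a y = a * y"

definition tau_inf :: "real \<Rightarrow> real \<Rightarrow> real \<Rightarrow> real \<Rightarrow> real \<Rightarrow> real" where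
  "tau_inf G \<xi> \<nu> a y = (sqrt (1 + 4 * \<nu> * \<xi> * G * a) + 1) / (2 * \<xi>)"

definition f_inf :: "real \<Rightarrow> real \<Rightarrow> real \<Rightarrow> real \<Rightarrow> real \<Rightarrow> real" where
  "f_inf G \<xi> \<nu> a y = (sqrt (1 + 4 * \<nu> * \<xi> * G * a) - 1) / (2 * \<nu>)"

end

theory Submission
  imports Defs "HOL-Computational_Algebra.Polynomial"
begin

text \<open>
  Write \<open>v = u - a y\<close>, \<open>\<sigma> = \<tau> - \<tau>_inf\<close>, \<open>\<phi> = f - f_inf\<close> and \<open>p\<close> for the space derivative of \<open>v\<close>. Linearly, the system is
  damped in every component: multiplying the three equations by \<open>v\<close>, \<open>\<sigma>\<close> and \<open>\<phi>\<close> with suitable weights makes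
  the coupling terms cancel, so an energy of \<open>(v, \<sigma>, \<phi>)\<close> in \<open>L\<^sup>2\<close> decreases at a rate that controls
  \<open>D = \<parallel>p\<parallel>\<^sup>2 + \<parallel>\<sigma>\<parallel>\<^sup>2 + \<parallel>\<phi>\<parallel>\<^sup>2\<close>. The nonlinear terms are harmless as long as \<open>\<sigma>\<close> and \<open>\<phi>\<close> are uniformly small in
  \<open>y\<close>; the point is to propagate that smallness, and to control \<open>p\<close> at each time and not only on average.

  For \<open>p\<close>, let \<open>w = \<eta> p + \<sigma>\<close> be the total stress perturbation. Since \<open>\<rho> \<partial>\<^sub>t v = \<partial>\<^sub>y w\<close>, the quantity \<open>\<parallel>w\<parallel>\<^sup>2/2\<close> grows at
  most at the rate \<open>\<parallel>w\<parallel> \<parallel>\<partial>\<^sub>t \<sigma>\<parallel>\<close>, which is bounded by \<open>D\<close>. The solution is too rough to differentiate \<open>\<parallel>w\<parallel>\<^sup>2\<close>, but the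
  inequality follows from the sign of \<open>\<parallel>v(t) - v(s)\<parallel>\<^sup>2\<close> alone (\<open>flux_energy_inequality\<close>, through
  \<open>mean_increment_bound\<close>). A large multiple of the \<open>L\<^sup>2\<close> energy plus \<open>\<parallel>w\<parallel>\<^sup>2/2\<close> is therefore dissipated
  (\<open>E_dissipation\<close>), and it is comparable with \<open>D\<close>.

  For the uniform norm, the equation for \<open>\<sigma>\<close> contains \<open>p\<close>, which is not bounded pointwise by the energy. With \<open>P\<close> the
  primitive of \<open>v\<close> in \<open>y\<close> of mean zero, \<open>\<rho> \<partial>\<^sub>t P = w - mean w\<close>, so in the time derivative of
  \<open>Z = lam \<sigma> - (G \<rho> / \<eta>) P\<close> the term \<open>p\<close> disappears. Hence \<open>(Z, \<phi>)\<close> solves, at each point \<open>y\<close>, a damped system of two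
  ordinary differential equations whose forcing is bounded by \<open>\<surd>D\<close> (\<open>Z_pointwise\<close>, \<open>q_derivative_bound\<close>).

  Adding a multiple of the global energy to a pointwise quadratic form in \<open>(Z, \<phi>)\<close> gives, for each \<open>y\<close>, a Lyapunov
  functional that decays exponentially and bounds \<open>\<sigma>\<^sup>2 + \<phi>\<^sup>2 + D\<close> (\<open>L_decay\<close>, \<open>L_controls\<close>). It starts at size
  \<open>\<epsilon>\<^sup>2\<close>, so \<open>\<sigma>\<close> and \<open>\<phi>\<close> can never leave the region where the estimates hold (\<open>continuation_principle\<close>,
  \<open>global_decay\<close>). With \<open>C\<close> equal to half the decay rate of the functional, all three norms are at most a constant times
  \<open>\<epsilon> exp (- C t)\<close>, which is stronger than the rate \<open>C - \<epsilon>\<close> of the statement.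

  The weak formulation enters through three facts: a function with a weak derivative is, up to a null set, a primitive of
  it (\<open>du_Bois_Reymond\<close>, whose test functions are made from \<open>exp (- 1 / x)\<close>); primitives of integrable functions may be
  integrated by parts; and quadratic quantities along a weak evolution are differentiated by a symmetric difference
  argument (\<open>integral_diagonal_of_increments\<close>).
\<close>

section \<open>Smooth test functions\<close>

text \<open>
  The regularity that \<^const>\<open>test_fun\<close> demands. Iterated derivatives are awkward to handle directly; every instance below
  comes from exhibiting a family of functions that is closed under \<^const>\<open>deriv\<close>.
\<close>
definition smooth :: "(real \<Rightarrow> real) \<Rightarrow> bool" where
  "smooth f \<longleftrightarrow> (\<forall>n x. (deriv ^^ n) f differentiable (at x))"

lemma has_deriv_eventually_cong:
  fixes f g :: "real \<Rightarrow> real"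
  assumes "(f has_real_derivative D) (at x)" "\<forall>\<^sub>F y in nhds x. g y = f y"
  shows "(g has_real_derivative D) (at x)"
  using assms DERIV_cong_ev[of x x g f D D] by auto

lemma smooth_coinduct:
  assumes "f \<in> A" and closed: "\<And>g. g \<in> A \<Longrightarrow> (\<forall>x. g differentiable (at x)) \<and> deriv g \<in> A"
  shows "smooth f"
proof -
  have "(deriv ^^ n) f \<in> A" for n
    by (induction n) (auto simp: assms(1) closed)
  then show ?thesis
    unfolding smooth_def using closed by blast
qed

lemma smooth_differentiable: "smooth f \<Longrightarrow> f differentiable (at x)"
  unfolding smooth_def by (metis funpow_0)

lemma smooth_has_deriv: "smooth f \<Longrightarrow> (f has_real_derivative deriv f x) (at x)"
  using smooth_differentiable DERIV_deriv_iff_real_differentiable by blast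

lemma smooth_deriv: "smooth f \<Longrightarrow> smooth (deriv f)"
  unfolding smooth_def by (metis comp_apply funpow_Suc_right)

lemma smooth_continuous: "smooth f \<Longrightarrow> continuous_on S f"
  by (meson continuous_at_imp_continuous_on differentiable_imp_continuous_within smooth_differentiable)

lemma smooth_antiderivative:
  assumes g: "smooth g" and F: "\<And>x. (F has_real_derivative g x) (at x)"
  shows "smooth F"
proof (rule smooth_coinduct[where A = "insert F {g. smooth g}"])
  have "deriv F = g" using F by (auto intro: DERIV_imp_deriv)
  then show "(\<forall>x. h differentiable (at x)) \<and> deriv h \<in> insert F {g. smooth g}"
    if "h \<in> insert F {g. smooth g}" for h
    using that F g smooth_differentiable smooth_deriv real_differentiable_def by auto
qed auto

text \<open>
  Products are the reason for this set: the derivative of a product is a sum of products, so the polynomial expressions in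
  smooth functions are closed under differentiation, although the smooth functions themselves give no induction on the
  number of derivatives.
\<close>
inductive_set smooth_algebra :: "(real \<Rightarrow> real) set" where
  base: "smooth f \<Longrightarrow> f \<in> smooth_algebra"
| add: "f \<in> smooth_algebra \<Longrightarrow> g \<in> smooth_algebra \<Longrightarrow> (\<lambda>x. f x + g x) \<in> smooth_algebra"
| mult: "f \<in> smooth_algebra \<Longrightarrow> g \<in> smooth_algebra \<Longrightarrow> (\<lambda>x. f x * g x) \<in> smooth_algebra"

lemma smooth_algebra_closed:
  "f \<in> smooth_algebra \<Longrightarrow> (\<forall>x. f differentiable (at x)) \<and> deriv f \<in> smooth_algebra"
proof (induction rule: smooth_algebra.induct)
  case (base f)
  then show ?case using smooth_differentiable smooth_deriv smooth_algebra.base by blast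
next
  case (add f g)
  then have f: "\<And>x. (f has_real_derivative deriv f x) (at x)" and g: "\<And>x. (g has_real_derivative deriv g x) (at x)"
    using DERIV_deriv_iff_real_differentiable by blast+
  have d: "((\<lambda>x. f x + g x) has_real_derivative deriv f x + deriv g x) (at x)" for x
    by (intro DERIV_add f g)
  then have "deriv (\<lambda>x. f x + g x) = (\<lambda>x. deriv f x + deriv g x)" by (auto intro: DERIV_imp_deriv)
  moreover have "(\<lambda>x. deriv f x + deriv g x) \<in> smooth_algebra"
    using add by (intro smooth_algebra.add) auto
  ultimately show ?case using d real_differentiable_def by auto
next
  case (mult f g)
  then have f: "\<And>x. (f has_real_derivative deriv f x) (at x)" and g: "\<And>x. (g has_real_derivative deriv g x) (at x)"
    using DERIV_deriv_iff_real_differentiable by blast+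
  have d: "((\<lambda>x. f x * g x) has_real_derivative deriv f x * g x + deriv g x * f x) (at x)" for x
    by (intro DERIV_mult f g)
  then have "deriv (\<lambda>x. f x * g x) = (\<lambda>x. deriv f x * g x + deriv g x * f x)" by (auto intro: DERIV_imp_deriv)
  moreover have "(\<lambda>x. deriv f x * g x + deriv g x * f x) \<in> smooth_algebra"
    using mult by (intro smooth_algebra.add smooth_algebra.mult) auto
  ultimately show ?case using d real_differentiable_def by auto
qed

lemma smooth_algebra_smooth: "f \<in> smooth_algebra \<Longrightarrow> smooth f"
  by (rule smooth_coinduct[of f smooth_algebra]) (auto dest: smooth_algebra_closed)

lemma smooth_add: "smooth f \<Longrightarrow> smooth g \<Longrightarrow> smooth (\<lambda>x. f x + g x)"
  and smooth_mult: "smooth f \<Longrightarrow> smooth g \<Longrightarrow> smooth (\<lambda>x. f x * g x)"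
  by (rule smooth_algebra_smooth, intro smooth_algebra.intros, assumption+)+

lemma smooth_const: "smooth (\<lambda>x. c)"
proof -
  have "(deriv ^^ n) (\<lambda>x. c) = (\<lambda>x. if n = 0 then c else 0)" for n
    by (induction n) auto
  then show ?thesis by (simp add: smooth_def)
qed

lemma smooth_diff: "smooth f \<Longrightarrow> smooth g \<Longrightarrow> smooth (\<lambda>x. f x - g x)"
proof -
  assume "smooth f" "smooth g"
  then have "smooth (\<lambda>x. f x + (-1) * g x)"
    by (intro smooth_add smooth_mult smooth_const)
  then show ?thesis by simp
qed

lemma smooth_affine:
  assumes "smooth f" shows "smooth (\<lambda>x. f (c * x + d))"
proof -
  have *: "smooth (\<lambda>x. k * g (c * x + d))" if "smooth g" for g k
  proof (rule smooth_coinduct[where A = "{\<lambda>x. k * g (c * x + d) | g k. smooth g}"])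
    show "(\<forall>x. h differentiable (at x)) \<and> deriv h \<in> {\<lambda>x. k * g (c * x + d) | g k. smooth g}"
      if h: "h \<in> {\<lambda>x. k * g (c * x + d) | g k. smooth g}" for h
    proof -
      from h obtain g k where h: "h = (\<lambda>x. k * g (c * x + d))" and g: "smooth g" by auto
      have "(h has_real_derivative (k * c) * deriv g (c * x + d)) (at x)" for x
      proof -
        have "((\<lambda>x. c * x + d) has_real_derivative c) (at x)"
          using DERIV_add[OF DERIV_cmult[OF DERIV_ident, of c] DERIV_const[of d], of x UNIV] by simp
        from DERIV_cmult[OF DERIV_chain2[OF smooth_has_deriv[OF g] this], of k]
        show ?thesis unfolding h by (simp add: mult_ac)
      qed
      then have d: "deriv h = (\<lambda>x. (k * c) * deriv g (c * x + d))" and "\<forall>x. h differentiable (at x)"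
        by (blast intro: DERIV_imp_deriv, auto simp: real_differentiable_def)
      moreover have "deriv h \<in> {\<lambda>x. k * g (c * x + d) | g k. smooth g}"
        unfolding d using smooth_deriv[OF g] by (intro CollectI exI[of _ "deriv g"] exI[of _ "k * c"] conjI refl)
      ultimately show ?thesis by blast
    qed
  qed (use that in blast)
  from *[OF assms, of 1] show ?thesis by simp
qed

text \<open>
  The family of functions \<open>p (1 / x) exp (- 1 / x)\<close>, extended by zero, is closed under differentiation; its member with
  \<open>p = 1\<close> is the classical smooth function that vanishes on a half line.
\<close>
definition flat_fun :: "real poly \<Rightarrow> real \<Rightarrow> real" where
  "flat_fun p x = (if x > 0 then poly p (1 / x) * exp (- (1 / x)) else 0)"

lemma flat_fun_1: "flat_fun 1 x = (if x > 0 then exp (- (1 / x)) else 0)"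
  by (simp add: flat_fun_def)

text \<open>
  Substituting \<open>t = 1 / x\<close> turns this into the fact that the exponential outgrows every polynomial.
\<close>
lemma flat_fun_at_right: "(flat_fun p \<longlongrightarrow> 0) (at_right 0)"
proof -
  have "((\<lambda>t. \<Sum>i\<le>degree p. coeff p i * (t ^ i / exp t)) \<longlongrightarrow> (\<Sum>i\<le>degree p. coeff p i * 0)) at_top"
    by (intro tendsto_intros tendsto_power_div_exp_0)
  then have "((\<lambda>t. poly p t * exp (- t)) \<longlongrightarrow> 0) at_top"
    by (simp add: poly_altdef sum_distrib_right exp_minus divide_inverse mult.assoc)
  then have "((\<lambda>x. poly p (inverse x) * exp (- inverse x)) \<longlongrightarrow> 0) (at_right 0)"
    by (rule filterlim_compose[OF _ filterlim_inverse_at_top_right])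
  moreover have "\<forall>\<^sub>F x in at_right 0. flat_fun p x = poly p (inverse x) * exp (- inverse x)"
    by (auto simp: eventually_at_right_field flat_fun_def divide_inverse intro: exI[of _ 1])
  ultimately show ?thesis using filterlim_cong by fastforce
qed

lemma flat_fun_at_0: "(flat_fun p \<longlongrightarrow> 0) (at 0)"
proof -
  have "(flat_fun p \<longlongrightarrow> 0) (at_left 0)"
    by (rule tendsto_eventually) (auto simp: eventually_at_left_field flat_fun_def intro: exI[of _ "-1"])
  then show ?thesis using flat_fun_at_right filterlim_split_at by blast
qed

text \<open>
  At the origin the difference quotient is again a member of the family, with polynomial \<open>X p\<close>, and so tends to zero.
\<close>
lemma flat_fun_has_deriv:
  "(flat_fun p has_real_derivative flat_fun ([:0, 0, 1:] * (p - pderiv p)) x) (at x)"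
proof -
  consider "x > 0" | "x < 0" | "x = 0" by linarith
  then show ?thesis
  proof cases
    case 1
    have "((\<lambda>x. poly p (1 / x) * exp (- (1 / x))) has_real_derivative
            flat_fun ([:0, 0, 1:] * (p - pderiv p)) x) (at x)"
      using 1 by (auto intro!: derivative_eq_intros DERIV_chain2[OF poly_DERIV] simp: flat_fun_def field_simps)
    moreover have "\<forall>\<^sub>F y in nhds x. flat_fun p y = poly p (1 / y) * exp (- (1 / y))"
      using eventually_nhds_in_open[of "{0<..}" x] 1 by (auto simp: flat_fun_def elim: eventually_mono)
    ultimately show ?thesis by (rule has_deriv_eventually_cong)
  next
    case 2
    have "\<forall>\<^sub>F y in nhds x. flat_fun p y = 0"
      using eventually_nhds_in_open[of "{..<0}" x] 2 by (auto simp: flat_fun_def elim: eventually_mono)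
    moreover have "((\<lambda>x. 0) has_real_derivative flat_fun ([:0, 0, 1:] * (p - pderiv p)) x) (at x)"
      using 2 by (simp add: flat_fun_def)
    ultimately show ?thesis by (rule has_deriv_eventually_cong[rotated])
  next
    case 3
    have "(\<lambda>h. (flat_fun p (0 + h) - flat_fun p 0) / h) = flat_fun ([:0, 1:] * p)"
      by (auto simp: flat_fun_def)
    then show ?thesis using flat_fun_at_0 3 unfolding DERIV_def by (simp add: flat_fun_def)
  qed
qed

lemma smooth_flat_fun: "smooth (flat_fun p)"
proof (rule smooth_coinduct[where A = "range flat_fun"])
  show "(\<forall>x. h differentiable (at x)) \<and> deriv h \<in> range flat_fun" if h: "h \<in> range flat_fun" for h
  proof -
    from h obtain p where p: "h = flat_fun p" by blast
    then have "deriv h = flat_fun ([:0, 0, 1:] * (p - pderiv p))"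
      using flat_fun_has_deriv by (auto intro!: DERIV_imp_deriv)
    then show ?thesis using flat_fun_has_deriv unfolding p real_differentiable_def by blast
  qed
qed auto

text \<open>
  Because the integrand vanishes to the left of \<open>c\<close>, the primitive based at \<open>c\<close> agrees with the one based at \<open>c - 1\<close>, so \<open>c\<close>
  is an interior point of the domain of integration as well.
\<close>
lemma has_deriv_indefinite_integral:
  fixes g :: "real \<Rightarrow> real"
  assumes g: "continuous_on UNIV g" and z: "\<And>x. x \<le> c \<Longrightarrow> g x = 0"
  shows "((\<lambda>x. integral {c..x} g) has_real_derivative g x) (at x)"
proof -
  have int: "g integrable_on {s..t}" for s t
    using g continuous_on_subset integrable_continuous_real by blast
  show ?thesis
  proof (cases "x < c")
    case True
    have "\<forall>\<^sub>F y in nhds x. integral {c..y} g = 0"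
      using eventually_nhds_in_open[of "{..<c}" x] True by (auto elim: eventually_mono)
    moreover have "((\<lambda>x. 0) has_real_derivative g x) (at x)" using True z by simp
    ultimately show ?thesis by (rule has_deriv_eventually_cong[rotated])
  next
    case False
    have "((\<lambda>y. integral {c-1..y} g) has_real_derivative g x) (at x within {c-1..x+1})"
      using False by (intro integral_has_real_derivative continuous_on_subset[OF g]) auto
    then have "((\<lambda>y. integral {c-1..y} g) has_real_derivative g x) (at x)"
      using False by (subst (asm) at_within_interior) auto
    moreover have "\<forall>\<^sub>F y in nhds x. integral {c..y} g = integral {c-1..y} g"
    proof -
      have "integral {c..y} g = integral {c-1..y} g" if "y > c - 1" for y
      proof (cases "y \<le> c")
        case True
        have "integral {c-1..y} g = integral {c-1..y} (\<lambda>x. 0)"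
          using True z by (intro integral_cong) auto
        then show ?thesis using True by (cases "y = c") auto
      next
        case False
        have "integral {c-1..c} g = integral {c-1..c} (\<lambda>x. 0)"
          using z by (intro integral_cong) auto
        then show ?thesis using Henstock_Kurzweil_Integration.integral_combine[of "c-1" c y g] int False by auto
      qed
      then show ?thesis
        using eventually_nhds_in_open[of "{c-1<..}" x] False by (auto elim: eventually_mono)
    qed
    ultimately show ?thesis by (rule has_deriv_eventually_cong)
  qed
qed

definition bump :: "real \<Rightarrow> real" where
  "bump x = flat_fun 1 x * flat_fun 1 (1 - x)"

lemma smooth_bump: "smooth bump"
proof -
  have "smooth (\<lambda>x. flat_fun 1 x * flat_fun 1 ((- 1) * x + 1))"
    by (intro smooth_mult smooth_affine smooth_flat_fun)
  moreover have "bump = (\<lambda>x. flat_fun 1 x * flat_fun 1 ((- 1) * x + 1))"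
    by (simp add: bump_def fun_eq_iff)
  ultimately show ?thesis by simp
qed

lemma bump_nonneg: "bump x \<ge> 0"
  unfolding bump_def flat_fun_1 by simp

lemma bump_outside: "x \<le> 0 \<or> 1 \<le> x \<Longrightarrow> bump x = 0"
  unfolding bump_def flat_fun_1 by auto

lemma bump_integral_pos: "integral {0..1} bump > 0"
proof -
  have "integral {0..1} bump \<noteq> 0"
  proof
    assume "integral {0..1} bump = 0"
    then have "\<forall>x\<in>{0..1}. bump x = 0"
      using integral_eq_0_iff[of 0 1 bump] smooth_continuous[OF smooth_bump] bump_nonneg by auto
    then have "bump (1/2) = 0" by simp
    then show False by (simp add: bump_def flat_fun_1)
  qed
  moreover have "integral {0..1} bump \<ge> 0"
    using bump_nonneg smooth_continuous[OF smooth_bump] by (intro integral_nonneg integrable_continuous_real) auto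
  ultimately show ?thesis by simp
qed

text \<open>
  The normalised primitive of a bump: a smooth transition from 0 on the negative axis to 1 beyond 1.
\<close>
definition step :: "real \<Rightarrow> real" where
  "step x = integral {0..x} bump / integral {0..1} bump"

lemma smooth_step: "smooth step"
proof -
  have "smooth (\<lambda>x. integral {0..x} bump)"
    using smooth_antiderivative[OF smooth_bump] has_deriv_indefinite_integral smooth_continuous[OF smooth_bump] bump_outside
    by metis
  then show ?thesis using smooth_mult[OF _ smooth_const[of "1 / integral {0..1} bump"]]
    by (simp add: step_def[abs_def])
qed

lemma step_left: "x \<le> 0 \<Longrightarrow> step x = 0"
  by (cases "x = 0") (auto simp: step_def)

lemma bump_integral_ge_1: "x \<ge> 1 \<Longrightarrow> integral {0..x} bump = integral {0..1} bump"
proof -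
  assume x: "x \<ge> 1"
  have "integral {1..x} bump = integral {1..x} (\<lambda>x. 0)"
    using bump_outside by (intro integral_cong) auto
  then show ?thesis
    using Henstock_Kurzweil_Integration.integral_combine[of 0 1 x bump, OF _ x
      integrable_continuous_real[OF smooth_continuous[OF smooth_bump]]] by simp
qed

lemma step_right: "x \<ge> 1 \<Longrightarrow> step x = 1"
  using bump_integral_pos by (simp add: step_def bump_integral_ge_1[of x])

lemma step_bounds: "0 \<le> step x" "step x \<le> 1"
proof -
  note int = integrable_continuous_real[OF smooth_continuous[OF smooth_bump]]
  have 0: "0 \<le> integral {0..x} bump" by (intro integral_nonneg int bump_nonneg)
  then show "0 \<le> step x" using bump_integral_pos by (simp add: step_def)
  show "step x \<le> 1"
  proof (cases "x \<ge> 1")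
    case False
    then have "integral {0..x} bump \<le> integral {0..1} bump"
      by (intro integral_subset_le int ballI bump_nonneg) auto
    then show ?thesis using bump_integral_pos by (simp add: step_def)
  qed (simp add: step_right)
qed

lemma test_fun_smooth: "test_fun a b \<phi> \<Longrightarrow> smooth \<phi>"
  unfolding test_fun_def smooth_def by (rule conjunct1)

text \<open>
  Two rescaled steps, shifted inwards so that the support is compact in the open interval even if \<open>s = a\<close> or \<open>t = b\<close>; the
  condition on \<open>n\<close> makes room for both transitions.
\<close>
lemma test_fun_interval_approx:
  assumes "a \<le> s" "s < t" "t \<le> b" "n * (t - s) \<ge> 3" "n > 0"
  shows "test_fun a b (\<lambda>x. step (n * (x - s) - 1) - step (n * (x - t) + 2))"
proof -
  have sm: "smooth (\<lambda>x. step (n * (x - s) - 1) - step (n * (x - t) + 2))"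
    using smooth_diff[OF smooth_affine[OF smooth_step, of n "- n * s - 1"] smooth_affine[OF smooth_step, of n "- n * t + 2"]]
    by (simp add: algebra_simps)
  have "step (n * (x - s) - 1) - step (n * (x - t) + 2) = 0" if "x \<notin> {s + 1/n..t - 1/n}" for x
  proof (cases "x < s + 1/n")
    case True
    then have *: "n * (x - s) < 1" using \<open>n > 0\<close> by (simp add: field_simps)
    moreover have "n * (x - t) = n * (x - s) - n * (t - s)" by (simp add: algebra_simps)
    ultimately have "n * (x - t) + 2 \<le> 0" using assms(4) by linarith
    then show ?thesis using * by (simp add: step_left)
  next
    case False
    then have *: "n * (x - t) > -1" using that \<open>n > 0\<close> by (simp add: field_simps)
    moreover have "n * (x - t) = n * (x - s) - n * (t - s)" by (simp add: algebra_simps)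
    ultimately have "n * (x - s) - 1 \<ge> 1" using assms(4) by linarith
    then show ?thesis using * by (simp add: step_right)
  qed
  moreover have "1 / n > 0" using \<open>n > 0\<close> by simp
  then have "a < s + 1/n" "t - 1/n < b" using assms(1,3) by linarith+
  ultimately show ?thesis using sm unfolding test_fun_def smooth_def
    by (intro conjI exI[of _ "s + 1/n"] exI[of _ "t - 1/n"] allI impI) auto
qed

lemma interval_approx_tendsto:
  assumes "s < t"
  shows "(\<lambda>n. step (real n * (x - s) - 1) - step (real n * (x - t) + 2)) \<longlonglongrightarrow> indicator {s<..<t} x"
proof -
  have big: "\<forall>\<^sub>F n in sequentially. real n * c \<ge> C" if "c > 0" for c C
  proof -
    have "\<forall>\<^sub>F n in sequentially. real n \<ge> C / c"
      using filterlim_real_sequentially by (simp add: filterlim_at_top)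
    then show ?thesis by eventually_elim (use that in \<open>simp add: field_simps\<close>)
  qed
  consider "x \<le> s" | "s < x" "x < t" | "x \<ge> t" by linarith
  then have "\<forall>\<^sub>F n in sequentially. step (real n * (x - s) - 1) - step (real n * (x - t) + 2) = indicator {s<..<t} x"
  proof cases
    case 1
    have "\<forall>\<^sub>F n in sequentially. real n * (t - x) \<ge> 2" by (rule big) (use 1 assms in simp)
    then show ?thesis
    proof eventually_elim
      case (elim n)
      have "real n * (x - s) \<le> 0" using 1 by (simp add: mult_nonneg_nonpos)
      moreover have "real n * (x - t) = - (real n * (t - x))" by (simp add: algebra_simps)
      ultimately have "step (real n * (x - s) - 1) = 0" "step (real n * (x - t) + 2) = 0"
        using elim by (simp_all add: step_left)
      then show ?case using 1 by simp
    qed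
  next
    case 2
    have "\<forall>\<^sub>F n in sequentially. real n * (t - x) \<ge> 2" "\<forall>\<^sub>F n in sequentially. real n * (x - s) \<ge> 2"
      by (rule big, use 2 in simp)+
    then show ?thesis
    proof eventually_elim
      case (elim n)
      moreover have "real n * (x - t) = - (real n * (t - x))" by (simp add: algebra_simps)
      ultimately have "step (real n * (x - s) - 1) = 1" "step (real n * (x - t) + 2) = 0"
        by (simp_all add: step_left step_right)
      then show ?case using 2 by simp
    qed
  next
    case 3
    have "\<forall>\<^sub>F n in sequentially. real n * (x - s) \<ge> 2" by (rule big) (use 3 assms in simp)
    then show ?thesis
    proof eventually_elim
      case (elim n)
      moreover have "real n * (x - t) \<ge> 0" using 3 by simp
      ultimately have "step (real n * (x - s) - 1) = 1" "step (real n * (x - t) + 2) = 1"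
        by (simp_all add: step_right)
      then show ?case using 3 by simp
    qed
  qed
  then show ?thesis by (rule tendsto_eventually)
qed

section \<open>The fundamental lemma of the calculus of variations\<close>

lemma absolutely_integrable_on_iff_lebesgue_on:
  fixes f :: "real \<Rightarrow> real"
  assumes "S \<in> sets lebesgue"
  shows "f absolutely_integrable_on S \<longleftrightarrow> integrable (lebesgue_on S) f"
  using assms by (simp add: set_integrable_def integrable_restrict_space)

lemma integrable_mult_continuous:
  fixes f k :: "real \<Rightarrow> real"
  assumes "integrable (lebesgue_on {a..b}) f" "continuous_on {a..b} k"
  shows "integrable (lebesgue_on {a..b}) (\<lambda>x. f x * k x)"
proof -
  have "(\<lambda>x. k x * f x) absolutely_integrable_on {a..b}"
    using assms by (intro absolutely_integrable_bounded_measurable_product_real)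
      (auto simp: absolutely_integrable_on_iff_lebesgue_on continuous_imp_measurable_on_sets_lebesgue
         intro!: compact_imp_bounded compact_continuous_image)
  then show ?thesis by (simp add: absolutely_integrable_on_iff_lebesgue_on mult.commute)
qed

text \<open>
  A mean value theorem without derivatives: increments that are \<open>o(1)\<close> relative to those of some \<open>M\<close>, uniformly on short
  intervals, add up to at most \<open>\<epsilon> (M b - M a)\<close> for every \<open>\<epsilon>\<close>. This replaces almost everywhere differentiation of
  absolutely continuous functions.
\<close>
lemma le_by_local_increments:
  fixes \<Psi> M :: "real \<Rightarrow> real"
  assumes "a \<le> b"
    and inc: "\<And>e. e > 0 \<Longrightarrow> \<exists>d>0. \<forall>s t. a \<le> s \<and> s \<le> t \<and> t \<le> b \<and> t - s < d \<longrightarrow>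
                 \<Psi> t - \<Psi> s \<le> e * (M t - M s)"
  shows "\<Psi> b \<le> \<Psi> a"
proof -
  have le: "\<Psi> b - \<Psi> a \<le> e * (M b - M a)" if e: "e > 0" for e
  proof -
    define P where "P s t \<longleftrightarrow> (a \<le> s \<and> s \<le> t \<and> t \<le> b \<longrightarrow> \<Psi> t - \<Psi> s \<le> e * (M t - M s))" for s t
    obtain d where "d > 0" and d: "\<forall>s t. a \<le> s \<and> s \<le> t \<and> t \<le> b \<and> t - s < d \<longrightarrow>
                 \<Psi> t - \<Psi> s \<le> e * (M t - M s)"
      using inc[OF e] by blast
    have "P a b"
    proof (rule Bolzano[OF \<open>a \<le> b\<close>, where P = P])
      fix s r t
      assume *: "P s r" "P r t" "s \<le> r" "r \<le> t"
      show "P s t"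
        unfolding P_def
      proof
        assume "a \<le> s \<and> s \<le> t \<and> t \<le> b"
        then have "\<Psi> r - \<Psi> s \<le> e * (M r - M s)" "\<Psi> t - \<Psi> r \<le> e * (M t - M r)"
          using * unfolding P_def by auto
        then show "\<Psi> t - \<Psi> s \<le> e * (M t - M s)" by (simp add: algebra_simps)
      qed
    next
      fix x
      show "\<exists>d>0. \<forall>s t. s \<le> x \<and> x \<le> t \<and> t - s < d \<longrightarrow> P s t"
        unfolding P_def using \<open>d > 0\<close> d by blast
    qed
    then show ?thesis unfolding P_def using \<open>a \<le> b\<close> by simp
  qed
  have "\<Psi> b - \<Psi> a \<le> 0"
  proof (rule field_le_epsilon)
    fix e :: real assume "e > 0"
    have "\<Psi> b - \<Psi> a \<le> e / (\<bar>M b - M a\<bar> + 1) * (M b - M a)"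
      using \<open>e > 0\<close> by (intro le) auto
    also have "\<dots> \<le> e / (\<bar>M b - M a\<bar> + 1) * (\<bar>M b - M a\<bar> + 1)"
      using \<open>e > 0\<close> by (intro mult_left_mono) auto
    also have "\<dots> = e" by (simp add: add_nonneg_eq_0_iff)
    finally show "\<Psi> b - \<Psi> a \<le> 0 + e" by simp
  qed
  then show ?thesis by simp
qed

lemma eq_by_local_increments:
  fixes \<Psi> M :: "real \<Rightarrow> real"
  assumes "a \<le> b"
    and inc: "\<And>e. e > 0 \<Longrightarrow> \<exists>d>0. \<forall>s t. a \<le> s \<and> s \<le> t \<and> t \<le> b \<and> t - s < d \<longrightarrow>
                 \<bar>\<Psi> t - \<Psi> s\<bar> \<le> e * (M t - M s)"
  shows "\<Psi> b = \<Psi> a"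
proof (rule antisym)
  show "\<Psi> b \<le> \<Psi> a"
    using inc by (intro le_by_local_increments[OF \<open>a \<le> b\<close>, of \<Psi> M]) (meson abs_le_D1)
  have "- \<Psi> b \<le> - \<Psi> a"
  proof (rule le_by_local_increments[OF \<open>a \<le> b\<close>, of "\<lambda>x. - \<Psi> x" M])
    fix e :: real assume "e > 0"
    from inc[OF this] obtain d where "d > 0" "\<forall>s t. a \<le> s \<and> s \<le> t \<and> t \<le> b \<and> t - s < d \<longrightarrow>
                 \<bar>\<Psi> t - \<Psi> s\<bar> \<le> e * (M t - M s)" by blast
    then show "\<exists>d>0. \<forall>s t. a \<le> s \<and> s \<le> t \<and> t \<le> b \<and> t - s < d \<longrightarrow> - \<Psi> t - - \<Psi> s \<le> e * (M t - M s)"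
      by (intro exI[of _ d]) (force simp: abs_le_iff)
  qed
  then show "\<Psi> a \<le> \<Psi> b" by simp
qed

lemma continuous_on_if_integral:
  fixes f F :: "real \<Rightarrow> real"
  assumes "f integrable_on {a..b}" "\<And>x. x \<in> {a..b} \<Longrightarrow> F x = c + integral {a..x} f"
  shows "continuous_on {a..b} F"
proof -
  have "continuous_on {a..b} (\<lambda>x. c + integral {a..x} f)"
    by (intro continuous_intros indefinite_integral_continuous_1 assms(1))
  then show ?thesis
    by (rule continuous_on_eq) (simp add: assms(2))
qed

text \<open>
  On a short interval the increment of \<open>F K\<close> is the integral of \<open>f(r) K(t) + F(s) k(r)\<close>, which differs from that of
  \<open>f K + F k\<close> by the moduli of continuity of \<open>F\<close> and \<open>K\<close> times the integral of \<open>\<bar>f\<bar> + \<bar>k\<bar>\<close>.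
\<close>
lemma integral_by_parts_absolutely_continuous:
  fixes f k F K :: "real \<Rightarrow> real"
  assumes ab: "a \<le> b"
    and f: "integrable (lebesgue_on {a..b}) f" and k: "integrable (lebesgue_on {a..b}) k"
    and F: "\<And>x. x \<in> {a..b} \<Longrightarrow> F x = F a + integral {a..x} f"
    and K: "\<And>x. x \<in> {a..b} \<Longrightarrow> K x = K a + integral {a..x} k"
  shows "(LINT x|lebesgue_on {a..b}. F x * k x) = F b * K b - F a * K a - (LINT x|lebesgue_on {a..b}. f x * K x)"
proof -
  have fi: "f integrable_on {a..b}" and ki: "k integrable_on {a..b}"
    using f k by (auto intro: integrable_on_lebesgue_on)
  have cF: "continuous_on {a..b} F" and cK: "continuous_on {a..b} K"
    using continuous_on_if_integral F K fi ki by metis+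
  define h where "h x = f x * K x + k x * F x" for x
  define m where "m x = \<bar>f x\<bar> + \<bar>k x\<bar>" for x
  have fK: "integrable (lebesgue_on {a..b}) (\<lambda>x. f x * K x)" and kF: "integrable (lebesgue_on {a..b}) (\<lambda>x. k x * F x)"
    using integrable_mult_continuous f k cF cK by auto
  have h: "h integrable_on {a..b}" unfolding h_def
    by (intro integrable_on_lebesgue_on Bochner_Integration.integrable_add fK kF) auto
  have m: "m integrable_on {a..b}" unfolding m_def
    by (intro integrable_on_lebesgue_on Bochner_Integration.integrable_add integrable_abs f k) auto
  have sub: "p integrable_on {s..t}" if "p integrable_on {a..b}" "a \<le> s" "t \<le> b" for p :: "real \<Rightarrow> real" and s t
    using integrable_on_subinterval[OF that(1)] that by auto
  have inc: "integral {a..t} p - integral {a..s} p = integral {s..t} p"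
    if "p integrable_on {a..b}" "a \<le> s" "s \<le> t" "t \<le> b" for p :: "real \<Rightarrow> real" and s t
    using Henstock_Kurzweil_Integration.integral_combine[of a s t p] that sub by auto
  define \<Psi> where "\<Psi> x = F x * K x - integral {a..x} h" for x
  have "\<Psi> b = \<Psi> a"
  proof (rule eq_by_local_increments[OF ab])
    fix e :: real assume e: "e > 0"
    have "uniformly_continuous_on {a..b} F" "uniformly_continuous_on {a..b} K"
      using cF cK by (auto intro: compact_uniformly_continuous)
    then obtain d1 d2 where d: "d1 > 0" "d2 > 0"
       and d1: "\<And>x y. x \<in> {a..b} \<Longrightarrow> y \<in> {a..b} \<Longrightarrow> dist y x < d1 \<Longrightarrow> dist (F y) (F x) < e"
       and d2: "\<And>x y. x \<in> {a..b} \<Longrightarrow> y \<in> {a..b} \<Longrightarrow> dist y x < d2 \<Longrightarrow> dist (K y) (K x) < e"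
      unfolding uniformly_continuous_on_def using e by metis
    show "\<exists>d>0. \<forall>s t. a \<le> s \<and> s \<le> t \<and> t \<le> b \<and> t - s < d \<longrightarrow>
           \<bar>\<Psi> t - \<Psi> s\<bar> \<le> e * (integral {a..t} m - integral {a..s} m)"
    proof (intro exI[of _ "min d1 d2"] conjI allI impI)
      fix s t assume st: "a \<le> s \<and> s \<le> t \<and> t \<le> b \<and> t - s < min d1 d2"
      have Fd: "F t - F s = integral {s..t} f" and Kd: "K t - K s = integral {s..t} k"
        using F[of t] F[of s] K[of t] K[of s] inc[OF fi, of s t] inc[OF ki, of s t] st by auto
      have fs: "f integrable_on {s..t}" and ks: "k integrable_on {s..t}" and hs: "h integrable_on {s..t}"
        and ms: "m integrable_on {s..t}"
        using sub fi ki h m st by auto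
      have "F t * K t - F s * K s = integral {s..t} f * K t + F s * integral {s..t} k"
        unfolding Fd[symmetric] Kd[symmetric] by (simp add: algebra_simps)
      also have "\<dots> = integral {s..t} (\<lambda>r. f r * K t) + integral {s..t} (\<lambda>r. F s * k r)"
        by simp
      also have "\<dots> = integral {s..t} (\<lambda>r. f r * K t + F s * k r)"
        by (subst Henstock_Kurzweil_Integration.integral_add)
           (auto intro!: integrable_on_mult_left integrable_on_mult_right fs ks)
      finally have "\<Psi> t - \<Psi> s = integral {s..t} (\<lambda>r. f r * K t + F s * k r) - integral {s..t} h"
        using inc[OF h, of s t] st by (simp add: \<Psi>_def)
      also have "\<dots> = integral {s..t} (\<lambda>r. (f r * K t + F s * k r) - h r)"
        by (rule Henstock_Kurzweil_Integration.integral_diff[symmetric])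
           (intro integrable_add integrable_on_mult_left integrable_on_mult_right fs ks hs)+
      finally have eq: "\<Psi> t - \<Psi> s = integral {s..t} (\<lambda>r. (f r * K t + F s * k r) - h r)" .
      have "norm (\<Psi> t - \<Psi> s) \<le> integral {s..t} (\<lambda>r. e * m r)"
        unfolding eq
      proof (rule Henstock_Kurzweil_Integration.integral_norm_bound_integral)
        show "(\<lambda>r. (f r * K t + F s * k r) - h r) integrable_on {s..t}"
          by (intro integrable_add integrable_diff integrable_on_mult_left integrable_on_mult_right fs ks hs)
        show "(\<lambda>r. e * m r) integrable_on {s..t}"
          by (intro integrable_on_mult_right ms)
        fix r assume r: "r \<in> {s..t}"
        have "\<bar>K t - K r\<bar> \<le> e" using d2[of r t] r st by (auto simp: dist_real_def)
        then have 1: "\<bar>f r * (K t - K r)\<bar> \<le> \<bar>f r\<bar> * e" by (simp add: abs_mult mult_left_mono)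
        have "\<bar>F s - F r\<bar> \<le> e" using d1[of r s] r st by (auto simp: dist_real_def)
        then have 2: "\<bar>k r * (F s - F r)\<bar> \<le> \<bar>k r\<bar> * e" by (simp add: abs_mult mult_left_mono)
        have "(f r * K t + F s * k r) - h r = f r * (K t - K r) + k r * (F s - F r)"
          by (simp add: h_def algebra_simps)
        then show "norm ((f r * K t + F s * k r) - h r) \<le> e * m r"
          using 1 2 by (simp add: m_def algebra_simps abs_triangle_ineq[THEN order_trans])
      qed
      then show "\<bar>\<Psi> t - \<Psi> s\<bar> \<le> e * (integral {a..t} m - integral {a..s} m)"
        using inc[OF m, of s t] st by simp
    qed (use d in simp)
  qed
  then have "F b * K b - F a * K a = integral {a..b} h"
    by (simp add: \<Psi>_def)
  also have "\<dots> = (LINT x|lebesgue_on {a..b}. h x)"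
    unfolding h_def
    by (intro lebesgue_integral_eq_integral[symmetric] Bochner_Integration.integrable_add fK kF) auto
  also have "\<dots> = (LINT x|lebesgue_on {a..b}. f x * K x) + (LINT x|lebesgue_on {a..b}. k x * F x)"
    unfolding h_def using fK kF by simp
  finally show ?thesis by (simp add: mult.commute)
qed

text \<open>
  Open intervals form an intersection stable generator of the Borel sets, so the signed measure with density \<open>D\<close> vanishes on
  every Borel set. The density is first replaced by a Borel measurable one.
\<close>
lemma AE_zero_if_interval_integrals_zero:
  fixes D :: "real \<Rightarrow> real"
  assumes D: "integrable lebesgue D"
    and zero: "\<And>s t. s < t \<Longrightarrow> (LINT x|lebesgue. indicator {s<..<t} x * D x) = 0"
    and supp: "\<And>x. x \<notin> {a<..<b} \<Longrightarrow> D x = 0"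
  shows "AE x in lebesgue. D x = 0"
proof -
  obtain D' where D': "D' \<in> borel_measurable lborel" and eq: "AE x in lborel. D x = D' x"
    using completion_ex_borel_measurable_real[of D lborel] D by auto
  have eqc: "AE x in lebesgue. D x = D' x" by (rule AE_completion[OF eq])
  have "integrable lebesgue D'"
  proof (subst integrable_cong_AE[of D', where g = D])
    show "AE x in lebesgue. D' x = D x" using eqc by eventually_elim simp
  qed (use D D' in \<open>auto intro: measurable_completion\<close>)
  then have iD': "integrable lborel D'" using D' by (simp add: integrable_completion)
  have si: "set_integrable lborel A D'" if "A \<in> sets lborel" for A
    unfolding set_integrable_def using that iD' by (rule integrable_mult_indicator)
  have int: "(LINT x:{s<..<t}|lborel. D' x) = 0" for s t :: real
  proof (cases "s < t")
    case True
    have "(LINT x:{s<..<t}|lborel. D' x) = (LINT x|lebesgue. indicator {s<..<t} x * D' x)"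
      unfolding set_lebesgue_integral_def using D' by (subst integral_completion) auto
    also have "\<dots> = (LINT x|lebesgue. indicator {s<..<t} x * D x)"
    proof (rule integral_cong_AE)
      show "AE x in lebesgue. indicat_real {s<..<t} x * D' x = indicator {s<..<t} x * D x"
        using eqc by eventually_elim simp
      show "(\<lambda>x. indicat_real {s<..<t} x * D x) \<in> borel_measurable lebesgue"
        using D by (intro borel_measurable_times) (auto intro: measurable_completion)
      show "(\<lambda>x. indicat_real {s<..<t} x * D' x) \<in> borel_measurable lebesgue"
        using D' by (intro measurable_completion) auto
    qed
    finally show ?thesis using zero[OF True] by simp
  qed (simp add: set_lebesgue_integral_def)
  have all0: "(LINT x|lborel. D' x) = 0"
  proof -
    have "(LINT x|lborel. D' x) = (LINT x:{a<..<b}|lborel. D' x)"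
      unfolding set_lebesgue_integral_def
    proof (rule integral_cong_AE)
      show "AE x in lborel. D' x = indicat_real {a<..<b} x *\<^sub>R D' x"
        using eq
      proof eventually_elim
        case (elim x)
        then show ?case using supp[of x] by (cases "x \<in> {a<..<b}") auto
      qed
    qed (use D' in auto)
    then show ?thesis using int by simp
  qed
  have gen: "sigma_sets UNIV (range (\<lambda>(s, t). {s<..<t :: real})) = sets borel"
  proof -
    have "(\<lambda>(s, t). {s<..<t :: real}) = (\<lambda>(s, t). box s t)" by (auto simp: fun_eq_iff box_real)
    moreover have "sets (borel :: real measure) = sigma_sets UNIV (range (\<lambda>(s, t). box s t))"
      by (subst borel_eq_box) simp
    ultimately show ?thesis by (simp only:)
  qed
  have "(LINT x:A|lborel. D' x) = 0" if A: "A \<in> sets borel" for A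
  proof -
    have "Int_stable (range (\<lambda>(s, t). {s<..<t :: real}))"
    proof (rule Int_stableI, clarify)
      fix s t s' t' :: real
      have "{s<..<t} \<inter> {s'<..<t'} = {max s s'<..<min t t'}" by auto
      then show "{s<..<t} \<inter> {s'<..<t'} \<in> range (\<lambda>(s, t). {s<..<t})"
        by (intro image_eqI[of _ _ "(max s s', min t t')"]) auto
    qed
    moreover have "range (\<lambda>(s, t). {s<..<t :: real}) \<subseteq> Pow UNIV" by simp
    moreover have "A \<in> sigma_sets UNIV (range (\<lambda>(s, t). {s<..<t :: real}))"
      using A gen by simp
    ultimately show ?thesis
    proof (induction rule: sigma_sets_induct_disjoint)
      case (basic A)
      then show ?case using int by auto
    next
      case empty
      then show ?case by (simp add: set_lebesgue_integral_def)
    next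
      case (compl A)
      then have A: "A \<in> sets lborel" by (simp add: gen)
      have "(LINT x:(UNIV - A)|lborel. D' x) = (LINT x|lborel. D' x - indicator A x * D' x)"
        unfolding set_lebesgue_integral_def by (intro Bochner_Integration.integral_cong) (auto simp: indicator_def)
      also have "\<dots> = (LINT x|lborel. D' x) - (LINT x:A|lborel. D' x)"
        using iD' si[OF A] unfolding set_lebesgue_integral_def set_integrable_def by simp
      finally show ?case using compl all0 by simp
    next
      case (union A)
      then have "A i \<in> sets lborel" for i by (auto simp: gen)
      then have "(LINT x:(\<Union>i. A i)|lborel. D' x) = (\<Sum>i. (LINT x:(A i)|lborel. D' x))"
        using union by (intro lebesgue_integral_countable_add si) (auto simp: disjoint_family_on_def)
      then show ?case using union by simp
    qed
  qed
  then have *: "AE x in lborel. D' x = 0"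
    using iD' by (intro density_unique_real) (auto simp: set_lebesgue_integral_def)
  show ?thesis
    using AE_completion[OF *] eqc by eventually_elim simp
qed


text \<open>
  The test functions of \<open>test_fun_interval_approx\<close> converge boundedly to indicators of intervals.
\<close>
lemma fundamental_lemma_calculus_of_variations:
  fixes d :: "real \<Rightarrow> real"
  assumes d: "integrable (lebesgue_on {a..b}) d"
    and orth: "\<And>\<theta>. test_fun a b \<theta> \<Longrightarrow> (LINT x|lebesgue_on {a..b}. d x * \<theta> x) = 0"
  shows "AE x in lebesgue_on {a..b}. d x = 0"
proof -
  have interval: "(LINT x|lebesgue_on {a..b}. d x * indicator {s<..<t} x) = 0"
    if st: "a \<le> s" "s < t" "t \<le> b" for s t
  proof -
    define \<theta> where "\<theta> n x = step (real n * (x - s) - 1) - step (real n * (x - t) + 2)" for n x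
    have cont: "continuous_on UNIV (\<theta> n)" for n
      unfolding \<theta>_def
      by (intro continuous_intros continuous_on_compose2[OF smooth_continuous[OF smooth_step, of UNIV]]) auto
    have "(\<lambda>n. LINT x|lebesgue_on {a..b}. d x * \<theta> n x) \<longlonglongrightarrow>
          (LINT x|lebesgue_on {a..b}. d x * indicator {s<..<t} x)"
    proof (rule integral_dominated_convergence[where w = "\<lambda>x. \<bar>d x\<bar>"])
      show "(\<lambda>x. d x * indicator {s<..<t} x) \<in> borel_measurable (lebesgue_on {a..b})"
        by (rule borel_measurable_times[OF borel_measurable_integrable[OF d]])
           (auto intro!: measurable_restrict_space1 measurable_completion)
      show "(\<lambda>x. d x * \<theta> n x) \<in> borel_measurable (lebesgue_on {a..b})" for n
        by (rule borel_measurable_times[OF borel_measurable_integrable[OF d]])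
           (intro continuous_imp_measurable_on_sets_lebesgue continuous_on_subset[OF cont], auto)
      show "AE x in lebesgue_on {a..b}. (\<lambda>n. d x * \<theta> n x) \<longlonglongrightarrow> d x * indicator {s<..<t} x"
        unfolding \<theta>_def by (intro AE_I2 tendsto_intros interval_approx_tendsto st)
      show "AE x in lebesgue_on {a..b}. norm (d x * \<theta> n x) \<le> \<bar>d x\<bar>" for n
      proof (intro AE_I2)
        fix x
        have "\<bar>\<theta> n x\<bar> \<le> 1"
          using step_bounds[of "real n * (x - s) - 1"] step_bounds[of "real n * (x - t) + 2"]
          unfolding \<theta>_def by linarith
        then show "norm (d x * \<theta> n x) \<le> \<bar>d x\<bar>" by (simp add: abs_mult mult_left_le)
      qed
    qed (use d in simp)
    moreover have "\<forall>\<^sub>F n in sequentially. (LINT x|lebesgue_on {a..b}. d x * \<theta> n x) = 0"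
    proof -
      have "\<forall>\<^sub>F n in sequentially. real n \<ge> max 1 (3 / (t - s))"
        using filterlim_real_sequentially unfolding filterlim_at_top by blast
      then show ?thesis
      proof eventually_elim
        case (elim n)
        then have "real n * (t - s) \<ge> 3" "real n > 0" using st by (auto simp: field_simps)
        then show ?case unfolding \<theta>_def by (intro orth test_fun_interval_approx st)
      qed
    qed
    ultimately show ?thesis
      by (rule LIMSEQ_unique[OF _ tendsto_eventually])
  qed
  define D where "D x = (if x \<in> {a<..<b} then d x else 0)" for x
  have D_eq: "(if x \<in> {a..b} then d x * indicator {a<..<b} x else 0) = D x" for x
    by (auto simp: D_def indicator_def)
  have "AE x in lebesgue. D x = 0"
  proof (rule AE_zero_if_interval_integrals_zero[where a = a and b = b])
    have "integrable (lebesgue_on {a..b}) (\<lambda>x. d x * indicator {a<..<b} x)"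
      using d by (intro integrable_real_mult_indicator) (auto simp: sets_restrict_space image_iff intro!: exI[of _ "{a<..<b}"])
    then have "integrable lebesgue (\<lambda>x. if x \<in> {a..b} then d x * indicator {a<..<b} x else 0)"
      using Lebesgue_Measure.integrable_restrict_UNIV[of "{a..b}" "\<lambda>x. d x * indicator {a<..<b} x :: real"] by simp
    then show "integrable lebesgue D" unfolding D_eq .
    fix s t :: real assume "s < t"
    have "(LINT x|lebesgue. indicator {s<..<t} x * D x)
        = (LINT x|lebesgue. (if x \<in> {a..b} then d x * indicator {max a s<..<min b t} x else 0))"
      by (intro Bochner_Integration.integral_cong) (auto simp: D_def indicator_def)
    also have "\<dots> = (LINT x|lebesgue_on {a..b}. d x * indicator {max a s<..<min b t} x)"
      by (rule Lebesgue_Measure.integral_restrict_UNIV) auto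
    also have "\<dots> = 0"
    proof (cases "max a s < min b t")
      case True
      then show ?thesis by (intro interval) auto
    next
      case False
      then have "d x * indicator {max a s<..<min b t} x = 0" for x by (auto simp: indicator_def)
      then show ?thesis by (simp only: Bochner_Integration.integral_zero)
    qed
    finally show "(LINT x|lebesgue. indicator {s<..<t} x * D x) = 0" .
  qed (auto simp: D_def)
  moreover have "AE x in lebesgue. x \<noteq> a" "AE x in lebesgue. x \<noteq> b"
    by (auto intro!: AE_not_in[of "{_}", simplified] simp: negligible_iff_null_sets[symmetric])
  ultimately have "AE x in lebesgue. x \<in> {a..b} \<longrightarrow> d x = 0"
  proof eventually_elim
    case (elim x)
    then show ?case by (auto simp: D_def split: if_splits)
  qed
  then show ?thesis by (simp add: AE_restrict_space_iff)
qed

text \<open>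
  The vanishing of the integral is exactly what makes the primitive vanish beyond the support as well.
\<close>
lemma test_fun_antiderivative:
  assumes ab: "a < c" "d < b" and \<psi>: "smooth \<psi>" "\<And>x. x \<notin> {c..d} \<Longrightarrow> \<psi> x = 0" and zero: "integral {a..b} \<psi> = 0"
    and "a \<le> b"
  shows "test_fun a b (\<lambda>x. integral {a..x} \<psi>)" and "deriv (\<lambda>x. integral {a..x} \<psi>) = \<psi>"
proof -
  have der: "((\<lambda>x. integral {a..x} \<psi>) has_real_derivative \<psi> x) (at x)" for x
    using \<psi> ab by (intro has_deriv_indefinite_integral smooth_continuous) auto
  then show "deriv (\<lambda>x. integral {a..x} \<psi>) = \<psi>" by (auto intro: DERIV_imp_deriv)
  have int: "\<psi> integrable_on {s..t}" for s t
    by (intro integrable_continuous_real smooth_continuous \<psi>)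
  have "integral {a..x} \<psi> = 0" if x: "x \<notin> {c..d}" for x
  proof (cases "x < c")
    case True
    then have "integral {a..x} \<psi> = integral {a..x} (\<lambda>x. 0)"
      using \<psi>(2) by (intro integral_cong) auto
    then show ?thesis by simp
  next
    case False
    then have xd: "x > d" "x > a" using x ab by auto
    show ?thesis
    proof (cases "x \<le> b")
      case True
      have "integral {x..b} \<psi> = integral {x..b} (\<lambda>x. 0)"
        using \<psi>(2) xd by (intro integral_cong) auto
      then show ?thesis
        using Henstock_Kurzweil_Integration.integral_combine[of a x b \<psi>] True xd int zero by simp
    next
      case F: False
      have "integral {b..x} \<psi> = integral {b..x} (\<lambda>x. 0)"
        using \<psi>(2) ab by (intro integral_cong) auto
      then show ?thesis
        using Henstock_Kurzweil_Integration.integral_combine[of a b x \<psi>] F \<open>a \<le> b\<close> int zero by simp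
    qed
  qed
  then show "test_fun a b (\<lambda>x. integral {a..x} \<psi>)"
    unfolding test_fun_def using smooth_antiderivative[OF \<psi>(1) der] ab unfolding smooth_def by blast
qed

lemma exists_test_fun_integral_1:
  assumes "a < b"
  obtains \<beta> where "test_fun a b \<beta>" "integral {a..b} \<beta> = 1"
proof -
  define s where "s = a + (b - a) / 3"
  define t where "t = b - (b - a) / 3"
  have st: "a < s" "s < t" "t < b" using assms unfolding s_def t_def by (auto simp: field_simps)
  define \<beta> where "\<beta> x = bump (1 / (t - s) * x + - s / (t - s))" for x
  have \<beta>_eq: "\<beta> x = bump ((x - s) / (t - s))" for x by (simp add: \<beta>_def diff_divide_distrib)
  have sm: "smooth \<beta>" unfolding \<beta>_def by (rule smooth_affine[OF smooth_bump])
  have out: "\<beta> x = 0" if "x \<notin> {s..t}" for x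
    unfolding \<beta>_eq by (rule bump_outside) (use that st in \<open>auto simp: field_simps\<close>)
  have "integral {a..b} \<beta> \<noteq> 0"
  proof
    assume "integral {a..b} \<beta> = 0"
    then have "\<forall>x\<in>{a..b}. \<beta> x = 0"
      using integral_eq_0_iff[of a b \<beta>] smooth_continuous[OF sm] bump_nonneg assms by (auto simp: \<beta>_eq)
    then have "\<beta> ((s + t) / 2) = 0" using st by auto
    moreover have "((s + t) / 2 - s) / (t - s) = 1 / 2" using st by (simp add: field_simps)
    ultimately have "bump (1 / 2) = 0" by (simp only: \<beta>_eq)
    then show False by (simp add: bump_def flat_fun_1)
  qed
  define I where "I = integral {a..b} \<beta>"
  have "smooth (\<lambda>x. 1 / I * \<beta> x)" by (intro smooth_mult smooth_const sm)
  then have "test_fun a b (\<lambda>x. 1 / I * \<beta> x)"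
    unfolding test_fun_def smooth_def using st out by (intro conjI exI[of _ s] exI[of _ t]) auto
  moreover have "integral {a..b} (\<lambda>x. 1 / I * \<beta> x) = 1"
    using \<open>integral {a..b} \<beta> \<noteq> 0\<close> by (simp add: I_def)
  ultimately show ?thesis using that by blast
qed

text \<open>
  The difference \<open>D\<close> of \<open>f\<close> and the primitive of \<open>g\<close> is orthogonal to all derivatives of test functions, that is, to all test
  functions of integral zero. Subtracting from an arbitrary \<open>\<theta>\<close> the multiple of a fixed \<open>\<beta>\<close> with the same integral shows that
  \<open>D\<close> is constant.
\<close>
lemma du_Bois_Reymond:
  fixes f g :: "real \<Rightarrow> real"
  assumes ab: "a < b" and f: "integrable (lebesgue_on {a..b}) f" and g: "integrable (lebesgue_on {a..b}) g"
    and weak: "\<And>\<phi>. test_fun a b \<phi> \<Longrightarrow>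
      (LINT x|lebesgue_on {a..b}. f x * deriv \<phi> x) = - (LINT x|lebesgue_on {a..b}. g x * \<phi> x)"
  shows "\<exists>c. AE x in lebesgue_on {a..b}. f x = c + integral {a..x} g"
proof -
  have gi: "g integrable_on {a..b}" using g by (auto intro: integrable_on_lebesgue_on)
  define G where "G x = integral {a..x} g" for x
  have cG: "continuous_on {a..b} G"
    unfolding G_def by (rule indefinite_integral_continuous_1[OF gi])
  define D where "D x = f x - G x" for x
  have D: "integrable (lebesgue_on {a..b}) D" unfolding D_def
    by (intro Bochner_Integration.integrable_diff f continuous_imp_integrable_real cG)
  have LINT_eq: "(LINT x|lebesgue_on {a..b}. h x) = integral {a..b} h" if "continuous_on {a..b} h" for h :: "real \<Rightarrow> real"
    by (intro lebesgue_integral_eq_integral continuous_imp_integrable_real that) auto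
  have D0: "(LINT x|lebesgue_on {a..b}. D x * \<psi> x) = 0"
    if \<psi>: "smooth \<psi>" "\<And>x. x \<notin> {c..d} \<Longrightarrow> \<psi> x = 0" "integral {a..b} \<psi> = 0" "a < c" "d < b" for \<psi> c d
  proof -
    define \<phi> where "\<phi> x = integral {a..x} \<psi>" for x
    have \<phi>: "test_fun a b \<phi>" "deriv \<phi> = \<psi>"
      using test_fun_antiderivative[of a c d b \<psi>] \<psi> ab unfolding \<phi>_def by auto
    have c\<psi>: "continuous_on {a..b} \<psi>" using \<psi>(1) by (rule smooth_continuous)
    have ends: "\<phi> a = 0" "\<phi> b = 0" using \<psi>(3) by (auto simp: \<phi>_def)
    have "(LINT x|lebesgue_on {a..b}. G x * \<psi> x) = G b * \<phi> b - G a * \<phi> a - (LINT x|lebesgue_on {a..b}. g x * \<phi> x)"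
      using ab by (intro integral_by_parts_absolutely_continuous g continuous_imp_integrable_real c\<psi>)
        (auto simp: G_def \<phi>_def)
    then have "(LINT x|lebesgue_on {a..b}. G x * \<psi> x) = (LINT x|lebesgue_on {a..b}. f x * \<psi> x)"
      using weak[OF \<phi>(1)] ends by (simp add: \<phi>(2))
    moreover have "(LINT x|lebesgue_on {a..b}. D x * \<psi> x)
        = (LINT x|lebesgue_on {a..b}. f x * \<psi> x) - (LINT x|lebesgue_on {a..b}. G x * \<psi> x)"
      unfolding D_def left_diff_distrib
      by (intro Bochner_Integration.integral_diff integrable_mult_continuous f c\<psi> continuous_imp_integrable_real cG)
    ultimately show ?thesis by simp
  qed
  obtain \<beta> where \<beta>: "test_fun a b \<beta>" "integral {a..b} \<beta> = 1"
    using exists_test_fun_integral_1[OF ab] .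
  define c where "c = (LINT x|lebesgue_on {a..b}. D x * \<beta> x)"
  have "AE x in lebesgue_on {a..b}. D x - c = 0"
  proof (rule fundamental_lemma_calculus_of_variations)
    show "integrable (lebesgue_on {a..b}) (\<lambda>x. D x - c)"
      by (intro Bochner_Integration.integrable_diff D continuous_imp_integrable_real continuous_intros)
    fix \<theta> assume \<theta>: "test_fun a b \<theta>"
    define J where "J = integral {a..b} \<theta>"
    define \<psi> where "\<psi> x = \<theta> x - J * \<beta> x" for x
    have sm: "smooth \<theta>" "smooth \<beta>" using \<theta> \<beta> test_fun_smooth by auto
    note c\<theta> = smooth_continuous[OF sm(1), of "{a..b}"] and c\<beta> = smooth_continuous[OF sm(2), of "{a..b}"]
    obtain c1 d1 where 1: "a < c1" "d1 < b" "\<And>x. x \<notin> {c1..d1} \<Longrightarrow> \<theta> x = 0" using \<theta> unfolding test_fun_def by blast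
    obtain c2 d2 where 2: "a < c2" "d2 < b" "\<And>x. x \<notin> {c2..d2} \<Longrightarrow> \<beta> x = 0" using \<beta>(1) unfolding test_fun_def by blast
    have "(LINT x|lebesgue_on {a..b}. D x * \<psi> x) = 0"
    proof (rule D0[where c = "min c1 c2" and d = "max d1 d2"])
      show "smooth \<psi>" unfolding \<psi>_def by (intro smooth_diff smooth_mult smooth_const sm)
      show "integral {a..b} \<psi> = 0"
        unfolding \<psi>_def using \<beta>(2)
        by (subst Henstock_Kurzweil_Integration.integral_diff)
           (auto intro!: integrable_continuous_real c\<theta> c\<beta> continuous_intros simp: J_def)
      fix x assume "x \<notin> {min c1 c2..max d1 d2}"
      then have "x \<notin> {c1..d1}" "x \<notin> {c2..d2}" by (auto simp: min_le_iff_disj le_max_iff_disj)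
      then have "\<theta> x = 0" "\<beta> x = 0" using 1(3) 2(3) by auto
      then show "\<psi> x = 0" by (simp add: \<psi>_def)
    qed (use 1 2 in auto)
    moreover have "(LINT x|lebesgue_on {a..b}. D x * \<psi> x) = (LINT x|lebesgue_on {a..b}. D x * \<theta> x) - J * c"
    proof -
      have "(LINT x|lebesgue_on {a..b}. D x * \<psi> x)
          = (LINT x|lebesgue_on {a..b}. D x * \<theta> x - J * (D x * \<beta> x))"
        unfolding \<psi>_def by (simp add: algebra_simps)
      also have "\<dots> = (LINT x|lebesgue_on {a..b}. D x * \<theta> x) - (LINT x|lebesgue_on {a..b}. J * (D x * \<beta> x))"
        by (intro Bochner_Integration.integral_diff integrable_mult_right integrable_mult_continuous D c\<theta> c\<beta>)
      finally show ?thesis by (simp add: c_def)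
    qed
    moreover have "(LINT x|lebesgue_on {a..b}. (D x - c) * \<theta> x) = (LINT x|lebesgue_on {a..b}. D x * \<theta> x) - c * J"
    proof -
      have "(LINT x|lebesgue_on {a..b}. (D x - c) * \<theta> x)
          = (LINT x|lebesgue_on {a..b}. D x * \<theta> x) - (LINT x|lebesgue_on {a..b}. c * \<theta> x)"
        unfolding left_diff_distrib
        by (intro Bochner_Integration.integral_diff integrable_mult_right integrable_mult_continuous D c\<theta> continuous_imp_integrable_real)
      then show ?thesis using LINT_eq[OF c\<theta>] by (simp add: J_def)
    qed
    ultimately show "(LINT x|lebesgue_on {a..b}. (D x - c) * \<theta> x) = 0" by simp
  qed
  then have "AE x in lebesgue_on {a..b}. f x = c + integral {a..x} g"
    by eventually_elim (simp add: D_def G_def)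
  then show ?thesis by blast
qed

section \<open>Integral inequalities for real functions\<close>

text \<open>
  This computes derivatives of quadratic quantities. If \<open>X\<close> evolves by \<open>X(t) - X(s) = \<integral> R\<close>, then
  \<open>X(t)\<^sup>2 - X(s)\<^sup>2 = \<integral> R(r) (X(s) + X(t)) dr\<close>, which has the form of the hypothesis with \<open>B r t = R(r) X(t)\<close>, and the derivative of
  \<open>X\<^sup>2\<close> is \<open>2 B r r\<close>. It also applies when \<open>R\<close> and \<open>X\<close> live in spaces in duality.
\<close>
lemma integral_diagonal_of_increments:
  fixes B :: "real \<Rightarrow> real \<Rightarrow> real" and \<Phi> :: "real \<Rightarrow> real"
  assumes B: "continuous_on ({0..} \<times> {0..}) (\<lambda>(r, t). B r t)"
    and inc: "\<And>s t. 0 \<le> s \<Longrightarrow> s \<le> t \<Longrightarrow> \<Phi> t - \<Phi> s = integral {s..t} (\<lambda>r. B r s + B r t)"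
    and ab: "0 \<le> a" "a \<le> b"
  shows "\<Phi> b - \<Phi> a = integral {a..b} (\<lambda>r. 2 * B r r)"
proof -
  have cB: "continuous_on {s..t} (\<lambda>r. B r u)" if "0 \<le> s" "0 \<le> u" for s t u
    by (rule continuous_on_compose2[OF B, of _ "\<lambda>r. (r, u)", simplified]) (use that in \<open>auto intro!: continuous_intros\<close>)
  have cD: "continuous_on {s..t} (\<lambda>r. B r r)" if "0 \<le> s" for s t
    by (rule continuous_on_compose2[OF B, of _ "\<lambda>r. (r, r)", simplified]) (use that in \<open>auto intro!: continuous_intros\<close>)
  define \<Psi> where "\<Psi> t = \<Phi> t - integral {a..t} (\<lambda>r. 2 * B r r)" for t
  have "\<Psi> b = \<Psi> a"
  proof (rule eq_by_local_increments[OF ab(2), where M = "\<lambda>x. x"])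
    fix e :: real assume e: "e > 0"
    have "continuous_on ({a..b} \<times> {a..b}) (\<lambda>(r, t). B r t)"
      by (rule continuous_on_subset[OF B]) (use ab in auto)
    then have "uniformly_continuous_on ({a..b} \<times> {a..b}) (\<lambda>(r, t). B r t)"
      by (intro compact_uniformly_continuous compact_Times) auto
    then obtain d where "d > 0" and d: "\<And>p q. p \<in> {a..b} \<times> {a..b} \<Longrightarrow> q \<in> {a..b} \<times> {a..b} \<Longrightarrow>
        dist q p < d \<Longrightarrow> dist (case q of (r, t) \<Rightarrow> B r t) (case p of (r, t) \<Rightarrow> B r t) < e / 2"
      unfolding uniformly_continuous_on_def using e by (metis half_gt_zero)
    show "\<exists>d>0. \<forall>s t. a \<le> s \<and> s \<le> t \<and> t \<le> b \<and> t - s < d \<longrightarrow> \<bar>\<Psi> t - \<Psi> s\<bar> \<le> e * (t - s)"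
    proof (intro exI[of _ d] conjI allI impI \<open>d > 0\<close>)
      fix s t assume st: "a \<le> s \<and> s \<le> t \<and> t \<le> b \<and> t - s < d"
      have near: "\<bar>B r u - B r r\<bar> \<le> e / 2" if "r \<in> {s..t}" "u \<in> {s..t}" for r u
      proof -
        have "\<bar>u - r\<bar> < d" using st that by auto
        then show ?thesis
          using d[of "(r, r)" "(r, u)"] st that by (auto simp: dist_Pair_Pair dist_real_def)
      qed
      have "integral {a..t} (\<lambda>r. 2 * B r r) - integral {a..s} (\<lambda>r. 2 * B r r) = integral {s..t} (\<lambda>r. 2 * B r r)"
        using Henstock_Kurzweil_Integration.integral_combine[of a s t "\<lambda>r. 2 * B r r"] st ab
        by (simp add: integrable_continuous_real cD continuous_on_mult_left)
      then have "\<Psi> t - \<Psi> s = integral {s..t} (\<lambda>r. B r s + B r t) - integral {s..t} (\<lambda>r. 2 * B r r)"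
        using inc[of s t] st ab by (simp add: \<Psi>_def)
      also have "\<dots> = integral {s..t} (\<lambda>r. B r s + B r t - 2 * B r r)"
        using st ab by (intro Henstock_Kurzweil_Integration.integral_diff[symmetric] integrable_continuous_real
            continuous_intros cB cD) auto
      finally have "norm (\<Psi> t - \<Psi> s) \<le> integral {s..t} (\<lambda>r. e)"
      proof (simp only:, intro Henstock_Kurzweil_Integration.integral_norm_bound_integral)
        show "(\<lambda>r. B r s + B r t - 2 * B r r) integrable_on {s..t}"
          using st ab by (intro integrable_continuous_real continuous_intros cB cD) auto
        fix r assume r: "r \<in> {s..t}"
        show "norm (B r s + B r t - 2 * B r r) \<le> e"
          using near[OF r, of s] near[OF r, of t] st by (smt (verit) atLeastAtMost_iff field_sum_of_halves real_norm_def)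
      qed auto
      then show "\<bar>\<Psi> t - \<Psi> s\<bar> \<le> e * (t - s)" using st by (simp add: mult.commute)
    qed
  qed
  then show ?thesis by (simp add: \<Psi>_def)
qed

text \<open>
  If \<open>\<Phi>\<close> were differentiable, both sides of the hypothesis would be of order \<open>(t - s)\<^sup>2 / 2\<close>, and comparing the coefficients
  would give \<open>\<Phi>' \<le> m K\<close>. Without derivatives, subtract the claimed bound and a small multiple of \<open>t\<close> from \<open>\<Phi>\<close>: were the
  result \<open>\<psi>\<close> to increase from \<open>a\<close> to \<open>b\<close>, it would attain its minimum at some \<open>s < b\<close>, and just after \<open>s\<close> the mean of
  \<open>\<psi> - \<psi> s\<close> would be both nonnegative and negative.
\<close>
lemma mean_increment_bound:
  fixes \<Phi> m K :: "real \<Rightarrow> real"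
  assumes ab: "a \<le> b" and cont: "continuous_on {a..b} \<Phi>" "continuous_on {a..b} m" "continuous_on {a..b} K"
    and inc: "\<And>s t. a \<le> s \<Longrightarrow> s \<le> t \<Longrightarrow> t \<le> b \<Longrightarrow>
       integral {s..t} (\<lambda>r. \<Phi> r - \<Phi> s) \<le> integral {s..t} (\<lambda>r. m r * integral {s..r} K)"
  shows "\<Phi> b - \<Phi> a \<le> integral {a..b} (\<lambda>r. m r * K r)"
proof (rule field_le_epsilon)
  fix e' :: real assume "e' > 0"
  define e where "e = e' / (b - a + 1)"
  have e: "e > 0" "e * (b - a) \<le> e'" using \<open>e' > 0\<close> ab by (auto simp: e_def field_simps)
  define mK where "mK r = m r * K r" for r
  have cmK: "continuous_on {a..b} mK" unfolding mK_def by (intro continuous_intros cont)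
  have sub: "continuous_on {s..t} f" if "continuous_on {a..b} f" "a \<le> s" "t \<le> b" for f :: "real \<Rightarrow> real" and s t
    using continuous_on_subset[OF that(1), of "{s..t}"] that by auto
  define \<psi> where "\<psi> t = \<Phi> t - integral {a..t} mK - e * (t - a)" for t
  have c\<psi>: "continuous_on {a..b} \<psi>" unfolding \<psi>_def
    by (intro continuous_intros cont indefinite_integral_continuous_1 integrable_continuous_real cmK)
  obtain C where C: "C > 0" "\<And>r. r \<in> {a..b} \<Longrightarrow> \<bar>K r\<bar> \<le> C"
  proof -
    have "bounded (K ` {a..b})" by (intro compact_imp_bounded compact_continuous_image cont) auto
    then show ?thesis using that unfolding bounded_pos by auto
  qed
  have "\<psi> b \<le> \<psi> a"
  proof (rule ccontr)
    assume "\<not> \<psi> b \<le> \<psi> a"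
    then have gt: "\<psi> a < \<psi> b" by simp
    obtain s where s: "s \<in> {a..b}" and min: "\<And>r. r \<in> {a..b} \<Longrightarrow> \<psi> s \<le> \<psi> r"
      using continuous_attains_inf[of "{a..b}" \<psi>] c\<psi> ab by auto
    have "s < b" using s min[of a] gt ab by (cases "s = b") auto
    have "uniformly_continuous_on {a..b} m" using cont(2) by (intro compact_uniformly_continuous) auto
    then obtain d where "d > 0" and d: "\<And>x y. x \<in> {a..b} \<Longrightarrow> y \<in> {a..b} \<Longrightarrow> dist y x < d \<Longrightarrow> dist (m y) (m x) < e / (2 * C)"
      unfolding uniformly_continuous_on_def using e C(1)
      by (metis divide_pos_pos mult_pos_pos zero_less_numeral)
    define t where "t = min b (s + d / 2)"
    have t: "s < t" "t \<le> b" "t - s < d" using \<open>s < b\<close> \<open>d > 0\<close> by (auto simp: t_def min_def)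
    have as: "a \<le> s" using s by simp
    note int = integrable_continuous_real
    have cI: "continuous_on {s..t} (\<lambda>r. integral {s..r} f)" if "continuous_on {a..b} f" for f :: "real \<Rightarrow> real"
      using sub[OF that as t(2)] by (intro indefinite_integral_continuous_1 int)
    have \<psi>_diff: "\<psi> r - \<psi> s = \<Phi> r - \<Phi> s - integral {s..r} mK - e * (r - s)" if "r \<in> {s..t}" for r
    proof -
      have "integral {a..s} mK + integral {s..r} mK = integral {a..r} mK"
        using that t s by (intro Henstock_Kurzweil_Integration.integral_combine int sub[OF cmK]) auto
      then show ?thesis by (simp add: \<psi>_def algebra_simps)
    qed
    have "0 \<le> integral {s..t} (\<lambda>r. \<psi> r - \<psi> s)"
      using min as t by (intro integral_nonneg int continuous_intros sub[OF c\<psi>]) auto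
    also have "\<dots> = integral {s..t} (\<lambda>r. (\<Phi> r - \<Phi> s) - (integral {s..r} mK + e * (r - s)))"
      by (intro integral_cong) (simp add: \<psi>_diff)
    also have "\<dots> = integral {s..t} (\<lambda>r. \<Phi> r - \<Phi> s) - integral {s..t} (\<lambda>r. integral {s..r} mK + e * (r - s))"
      using as t by (intro Henstock_Kurzweil_Integration.integral_diff int continuous_intros sub[OF cont(1)] cI[OF cmK]) auto
    also have "\<dots> \<le> integral {s..t} (\<lambda>r. m r * integral {s..r} K) - integral {s..t} (\<lambda>r. integral {s..r} mK + e * (r - s))"
      using inc[of s t] as t by auto
    also have "\<dots> = integral {s..t} (\<lambda>r. m r * integral {s..r} K - (integral {s..r} mK + e * (r - s)))"
      using as t by (intro Henstock_Kurzweil_Integration.integral_diff[symmetric] int continuous_intros sub[OF cont(2)] cI[OF cont(3)] cI[OF cmK]) auto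
    also have "\<dots> \<le> integral {s..t} (\<lambda>r. - (e / 2) * (r - s))"
    proof (rule integral_le)
      show "(\<lambda>r. m r * integral {s..r} K - (integral {s..r} mK + e * (r - s))) integrable_on {s..t}"
        using as t by (intro int continuous_intros sub[OF cont(2)] cI[OF cont(3)] cI[OF cmK]) auto
      show "(\<lambda>r. - (e / 2) * (r - s)) integrable_on {s..t}"
        by (intro int continuous_intros)
      fix r assume r: "r \<in> {s..t}"
      have cKr: "continuous_on {s..r} K" "continuous_on {s..r} mK"
        using r as t by (auto intro!: sub[OF cont(3)] sub[OF cmK])
      have "m r * integral {s..r} K - integral {s..r} mK = integral {s..r} (\<lambda>q. m r * K q - mK q)"
        using cKr by (subst Henstock_Kurzweil_Integration.integral_diff) (auto intro!: int continuous_intros)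
      also have "\<dots> \<le> integral {s..r} (\<lambda>q. e / 2)"
      proof (rule integral_le)
        show "(\<lambda>q. m r * K q - mK q) integrable_on {s..r}" using cKr by (intro int continuous_intros)
        fix q assume q: "q \<in> {s..r}"
        have "\<bar>m r - m q\<bar> * \<bar>K q\<bar> \<le> e / (2 * C) * C"
          using d[of q r] C(2)[of q] q r as t C(1) e by (intro mult_mono) (auto simp: dist_real_def)
        then have "\<bar>(m r - m q) * K q\<bar> \<le> e / 2" using C(1) by (simp add: abs_mult)
        moreover have "m r * K q - mK q = (m r - m q) * K q" by (simp add: mK_def left_diff_distrib)
        ultimately show "m r * K q - mK q \<le> e / 2" by linarith
      qed (auto intro: int)
      also have "\<dots> = e / 2 * (r - s)" using r by simp
      finally have "m r * integral {s..r} K - integral {s..r} mK \<le> e / 2 * (r - s)" .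
      moreover have "e * (r - s) = 2 * (e / 2 * (r - s))" "- (e / 2) * (r - s) = - (e / 2 * (r - s))"
        by simp_all
      ultimately show "m r * integral {s..r} K - (integral {s..r} mK + e * (r - s)) \<le> - (e / 2) * (r - s)"
        by linarith
    qed
    also have "\<dots> < 0"
    proof -
      have "((\<lambda>r. - (e / 2) * (r - s)) has_integral (- (e / 4) * (t - s)^2 - (- (e / 4) * (s - s)^2))) {s..t}"
        using t by (intro fundamental_theorem_of_calculus)
          (auto intro!: derivative_eq_intros simp: has_real_derivative_iff_has_vector_derivative[symmetric])
      from integral_unique[OF this] show ?thesis using e t by (simp only:) simp
    qed
    finally show False by simp
  qed
  then have "\<Phi> b - \<Phi> a \<le> integral {a..b} mK + e * (b - a)" by (simp add: \<psi>_def)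
  then show "\<Phi> b - \<Phi> a \<le> integral {a..b} (\<lambda>r. m r * K r) + e'"
    using e(2) by (simp add: mK_def[abs_def])
qed

text \<open>
  Gronwall's inequality in integrated form. For short intervals the hypothesis gives
  \<open>L t \<le> (1 - c (t - s)) L s\<close> up to a small multiple of \<open>t - s\<close>, and \<open>1 - x \<le> exp (- x)\<close> because \<open>L s\<close> is nonnegative.
\<close>
lemma exponential_decay_of_integral_inequality:
  fixes L :: "real \<Rightarrow> real"
  assumes T: "0 \<le> T" and cont: "continuous_on {0..T} L" and nonneg: "\<And>t. t \<in> {0..T} \<Longrightarrow> 0 \<le> L t" and c: "c > 0"
    and ineq: "\<And>s t. 0 \<le> s \<Longrightarrow> s \<le> t \<Longrightarrow> t \<le> T \<Longrightarrow> L t - L s \<le> - c * integral {s..t} L"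
  shows "L T \<le> L 0 * exp (- c * T)"
proof -
  have "L T * exp (c * T) \<le> L 0 * exp (c * 0)"
  proof (rule le_by_local_increments[OF T, where M = "\<lambda>x. x" and \<Psi> = "\<lambda>t. L t * exp (c * t)"])
    fix e :: real assume e: "e > 0"
    define e' where "e' = e / (c * exp (c * T))"
    have "e' > 0" using e c by (simp add: e'_def)
    have "uniformly_continuous_on {0..T} L" using cont by (intro compact_uniformly_continuous) auto
    then obtain d where "d > 0" and d: "\<And>x y. x \<in> {0..T} \<Longrightarrow> y \<in> {0..T} \<Longrightarrow> dist y x < d \<Longrightarrow> dist (L y) (L x) < e'"
      unfolding uniformly_continuous_on_def using \<open>e' > 0\<close> by metis
    show "\<exists>d>0. \<forall>s t. 0 \<le> s \<and> s \<le> t \<and> t \<le> T \<and> t - s < d \<longrightarrow> L t * exp (c * t) - L s * exp (c * s) \<le> e * (t - s)"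
    proof (intro exI[of _ d] conjI allI impI \<open>d > 0\<close>)
      fix s t assume st: "0 \<le> s \<and> s \<le> t \<and> t \<le> T \<and> t - s < d"
      have "integral {s..t} (\<lambda>r. L s - e') \<le> integral {s..t} L"
      proof (rule integral_le)
        show "L integrable_on {s..t}"
          using st by (intro integrable_continuous_real continuous_on_subset[OF cont]) auto
        fix r assume "r \<in> {s..t}"
        then show "L s - e' \<le> L r" using d[of s r] st by (auto simp: dist_real_def abs_less_iff)
      qed auto
      then have "(t - s) * (L s - e') \<le> integral {s..t} L" using st by simp
      then have "c * ((t - s) * (L s - e')) \<le> c * integral {s..t} L" using c by (intro mult_left_mono) auto
      then have "L t \<le> L s * (1 - c * (t - s)) + c * e' * (t - s)"
        using ineq[of s t] st by (simp add: algebra_simps)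
      also have "\<dots> \<le> L s * exp (- (c * (t - s))) + c * e' * (t - s)"
        using exp_ge_add_one_self[of "- (c * (t - s))"] nonneg[of s] st by (intro add_right_mono mult_left_mono) auto
      finally have "L t * exp (c * t) \<le> (L s * exp (- (c * (t - s))) + c * e' * (t - s)) * exp (c * t)"
        by (intro mult_right_mono) auto
      also have "\<dots> = L s * exp (c * s) + c * e' * exp (c * t) * (t - s)"
        by (simp add: algebra_simps exp_add[symmetric])
      also have "\<dots> \<le> L s * exp (c * s) + c * e' * exp (c * T) * (t - s)"
        using st c \<open>e' > 0\<close> by (intro add_left_mono mult_right_mono mult_left_mono) auto
      also have "c * e' * exp (c * T) = e" using c by (simp add: e'_def)
      finally show "L t * exp (c * t) - L s * exp (c * s) \<le> e * (t - s)" by simp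
    qed
  qed
  then have "L T * exp (c * T) * exp (- c * T) \<le> L 0 * exp (- c * T)" by (intro mult_right_mono) auto
  then show ?thesis by (simp add: mult.assoc exp_add[symmetric])
qed

text \<open>
  At the first time at which \<open>F\<close> reaches \<open>d\<close> somewhere, which exists by compactness of the space interval, the bound \<open>F \<le> d\<close>
  has held up to that time, so it improves to a strict one.
\<close>
lemma continuation_principle:
  fixes F :: "real \<Rightarrow> real \<Rightarrow> real"
  assumes cont: "continuous_on ({0..} \<times> {0..1}) (\<lambda>(t, y). F t y)"
    and init: "\<And>y. y \<in> {0..1} \<Longrightarrow> F 0 y < d"
    and improve: "\<And>T. 0 \<le> T \<Longrightarrow> (\<And>t y. t \<in> {0..T} \<Longrightarrow> y \<in> {0..1} \<Longrightarrow> F t y \<le> d) \<Longrightarrow> \<forall>y\<in>{0..1}. F T y < d"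
    and t: "0 \<le> t" and y: "y \<in> {0..1}"
  shows "F t y < d"
proof (rule ccontr)
  assume "\<not> F t y < d"
  define S where "S = {p \<in> {0..t} \<times> {0..1}. d \<le> (case p of (t, y) \<Rightarrow> F t y)}"
  have "continuous_on ({0..t} \<times> {0..1}) (\<lambda>(t, y). F t y)"
    by (rule continuous_on_subset[OF cont]) auto
  then have "closed S" unfolding S_def
    by (intro continuous_on_closed_Collect_le continuous_on_const closed_Times) auto
  moreover have "bounded S" unfolding S_def
    by (rule bounded_subset[of "{0..t} \<times> {0..1}"]) (auto intro: bounded_Times)
  ultimately have "compact S" by (simp add: compact_eq_bounded_closed)
  then have "compact (fst ` S)" by (intro compact_continuous_image continuous_on_fst continuous_on_id)
  moreover have "(t, y) \<in> S" using \<open>\<not> F t y < d\<close> t y by (simp add: S_def)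
  then have "fst ` S \<noteq> {}" by blast
  ultimately obtain T where T: "T \<in> fst ` S" and least: "\<And>r. r \<in> fst ` S \<Longrightarrow> T \<le> r"
    using compact_attains_inf[of "fst ` S"] by blast
  then obtain z where z: "z \<in> {0..1}" "d \<le> F T z" "0 \<le> T" "T \<le> t" by (auto simp: S_def)
  have before: "F r x < d" if "r \<in> {0..<T}" "x \<in> {0..1}" for r x
  proof (rule ccontr)
    assume "\<not> F r x < d"
    then have "r \<in> fst ` S" using that z by (auto simp: S_def intro!: image_eqI[of _ _ "(r, x)"])
    then show False using least that by force
  qed
  have "T > 0" using z init[of z] by (cases "T = 0") auto
  have at_T: "F T x \<le> d" if x: "x \<in> {0..1}" for x
  proof -
    have "continuous_on {0..T} (\<lambda>r. F r x)"
      by (rule continuous_on_compose2[OF cont, of _ "\<lambda>r. (r, x)", simplified])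
         (use x in \<open>auto intro!: continuous_intros\<close>)
    then have "((\<lambda>r. F r x) \<longlongrightarrow> F T x) (at T within {0..T})"
      using z by (auto simp: continuous_on_def)
    then have "((\<lambda>r. F r x) \<longlongrightarrow> F T x) (at_left T)"
      using \<open>T > 0\<close> by (simp add: at_within_Icc_at_left)
    moreover have "\<forall>\<^sub>F r in at_left T. F r x \<le> d"
      unfolding eventually_at_left_field using \<open>T > 0\<close> before x by (intro exI[of _ 0]) (auto intro: less_imp_le)
    ultimately show ?thesis by (rule tendsto_upperbound) simp
  qed
  have "F r x \<le> d" if "r \<in> {0..T}" "x \<in> {0..1}" for r x
    using before[of r x] at_T[of x] that by (cases "r = T") auto
  from bspec[OF improve[OF z(3) this] z(1)] show False using z(2) by simp
qed

section \<open>Square integrable functions\<close>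

definition L2_inner :: "(real \<Rightarrow> real) \<Rightarrow> (real \<Rightarrow> real) \<Rightarrow> real" where
  "L2_inner f g = (LINT y|lebesgue_on Omega. f y * g y)"

lemma L2_measurable: "f \<in> L2 \<Longrightarrow> f \<in> borel_measurable (lebesgue_on Omega)"
  and L2_square_integrable: "f \<in> L2 \<Longrightarrow> integrable (lebesgue_on Omega) (\<lambda>y. (f y)\<^sup>2)"
  by (auto simp: L2_def)

lemma L2_mult_integrable:
  assumes "f \<in> L2" "g \<in> L2" shows "integrable (lebesgue_on Omega) (\<lambda>y. f y * g y)"
proof (rule Bochner_Integration.integrable_bound)
  show "integrable (lebesgue_on Omega) (\<lambda>y. (f y)\<^sup>2 + (g y)\<^sup>2)"
    using assms by (intro Bochner_Integration.integrable_add L2_square_integrable)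
  show "(\<lambda>y. f y * g y) \<in> borel_measurable (lebesgue_on Omega)"
    using assms by (intro borel_measurable_times L2_measurable)
  have "\<bar>x * y\<bar> \<le> x\<^sup>2 + y\<^sup>2" for x y :: real
    using sum_squares_bound[of "\<bar>x\<bar>" "\<bar>y\<bar>"] abs_ge_zero[of "x * y"] unfolding abs_mult power2_abs by linarith
  then show "AE y in lebesgue_on Omega. norm (f y * g y) \<le> norm ((f y)\<^sup>2 + (g y)\<^sup>2)"
    by (intro AE_I2) (auto simp: abs_of_nonneg)
qed

lemma L2_continuous_function: "continuous_on Omega f \<Longrightarrow> f \<in> L2"
  unfolding L2_def
  by (auto intro!: continuous_imp_measurable_on_sets_lebesgue continuous_imp_integrable_real continuous_intros)

lemma L2_const [simp]: "(\<lambda>y. c) \<in> L2"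
  by (intro L2_continuous_function continuous_intros)

lemma L2_integrable: "f \<in> L2 \<Longrightarrow> integrable (lebesgue_on Omega) f"
  using L2_mult_integrable[of f "\<lambda>y. 1"] by simp

lemma L2_scale: "f \<in> L2 \<Longrightarrow> (\<lambda>y. c * f y) \<in> L2"
  unfolding L2_def by (auto simp: power_mult_distrib)

lemma L2_add: assumes "f \<in> L2" "g \<in> L2" shows "(\<lambda>y. f y + g y) \<in> L2"
proof -
  have "integrable (lebesgue_on Omega) (\<lambda>y. (f y)\<^sup>2 + (g y)\<^sup>2 + 2 * (f y * g y))"
    using assms by (intro Bochner_Integration.integrable_add integrable_mult_right L2_square_integrable L2_mult_integrable)
  then have "integrable (lebesgue_on Omega) (\<lambda>y. (f y + g y)\<^sup>2)"
    by (simp add: power2_sum mult.assoc)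
  then show ?thesis using assms by (auto simp: L2_def)
qed

lemma L2_diff: "f \<in> L2 \<Longrightarrow> g \<in> L2 \<Longrightarrow> (\<lambda>y. f y - g y) \<in> L2"
  using L2_add[of f "\<lambda>y. (- 1) * g y"] L2_scale[of g "- 1"] by simp

lemma L2_inner_commute: "L2_inner f g = L2_inner g f"
  unfolding L2_inner_def by (simp add: mult.commute)

lemma L2_inner_add_left:
  "f \<in> L2 \<Longrightarrow> g \<in> L2 \<Longrightarrow> h \<in> L2 \<Longrightarrow> L2_inner (\<lambda>y. f y + g y) h = L2_inner f h + L2_inner g h"
  unfolding L2_inner_def distrib_right by (intro Bochner_Integration.integral_add L2_mult_integrable)

lemma L2_inner_diff_left:
  "f \<in> L2 \<Longrightarrow> g \<in> L2 \<Longrightarrow> h \<in> L2 \<Longrightarrow> L2_inner (\<lambda>y. f y - g y) h = L2_inner f h - L2_inner g h"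
  unfolding L2_inner_def left_diff_distrib by (intro Bochner_Integration.integral_diff L2_mult_integrable)

lemma L2_inner_scale_left: "L2_inner (\<lambda>y. c * f y) h = c * L2_inner f h"
  unfolding L2_inner_def by (simp add: mult.assoc)

lemma L2_inner_add_right:
  "f \<in> L2 \<Longrightarrow> g \<in> L2 \<Longrightarrow> h \<in> L2 \<Longrightarrow> L2_inner h (\<lambda>y. f y + g y) = L2_inner h f + L2_inner h g"
  by (simp add: L2_inner_commute[of h] L2_inner_add_left)

lemma L2_inner_diff_right:
  "f \<in> L2 \<Longrightarrow> g \<in> L2 \<Longrightarrow> h \<in> L2 \<Longrightarrow> L2_inner h (\<lambda>y. f y - g y) = L2_inner h f - L2_inner h g"
  by (simp add: L2_inner_commute[of h] L2_inner_diff_left)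

lemma L2_inner_scale_right: "L2_inner h (\<lambda>y. c * f y) = c * L2_inner h f"
  by (simp add: L2_inner_commute[of h] L2_inner_scale_left)

lemma L2_norm_square: "(L2_norm f)\<^sup>2 = L2_inner f f"
  unfolding L2_norm_def L2_inner_def power2_eq_square[symmetric] by simp

lemma L2_norm_nonneg [simp]: "0 \<le> L2_norm f"
  unfolding L2_norm_def by simp

lemma L2_inner_mono:
  assumes "f \<in> L2" "g \<in> L2" "f' \<in> L2" "g' \<in> L2" "\<And>y. y \<in> Omega \<Longrightarrow> f y * g y \<le> f' y * g' y"
  shows "L2_inner f g \<le> L2_inner f' g'"
  unfolding L2_inner_def using assms by (intro integral_mono L2_mult_integrable) auto

text \<open>
  The quadratic form \<open>\<parallel>x f + y g\<parallel>\<^sup>2\<close> is nonnegative; the degenerate case \<open>\<parallel>g\<parallel> = 0\<close> is treated apart.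
\<close>
lemma L2_Cauchy_Schwarz:
  assumes f: "f \<in> L2" and g: "g \<in> L2" shows "\<bar>L2_inner f g\<bar> \<le> L2_norm f * L2_norm g"
proof -
  define a b c where "a = L2_inner f f" and "b = L2_inner f g" and "c = L2_inner g g"
  have a: "a \<ge> 0" and c: "c \<ge> 0" unfolding a_def c_def L2_norm_square[symmetric] by auto
  have quad: "x\<^sup>2 * a + 2 * x * y * b + y\<^sup>2 * c \<ge> 0" for x y
  proof -
    have fg: "(\<lambda>z. x * f z + y * g z) \<in> L2" by (intro L2_add L2_scale f g)
    have "0 \<le> L2_inner (\<lambda>z. x * f z + y * g z) (\<lambda>z. x * f z + y * g z)"
      by (metis L2_norm_square zero_le_power2)
    also have "\<dots> = x\<^sup>2 * a + 2 * x * y * b + y\<^sup>2 * c"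
      using f g fg by (simp add: L2_inner_add_left L2_inner_add_right L2_inner_scale_left L2_inner_scale_right
          L2_scale a_def b_def c_def L2_inner_commute[of g f] power2_eq_square algebra_simps)
    finally show ?thesis .
  qed
  have "b\<^sup>2 \<le> a * c"
  proof (cases "c = 0")
    case True
    have "b = 0"
    proof (rule ccontr)
      assume "b \<noteq> 0"
      \<comment> \<open>The second coefficient is chosen to give the form the value \<open>- 1\<close>.\<close>
      have "1\<^sup>2 * a + 2 * 1 * (- (a + 1) / (2 * b)) * b + (- (a + 1) / (2 * b))\<^sup>2 * c = - 1"
        using True \<open>b \<noteq> 0\<close> by (simp add: field_simps)
      then show False using quad[of 1 "- (a + 1) / (2 * b)"] by simp
    qed
    then show ?thesis using True by simp
  next
    case False
    have "c\<^sup>2 * a + 2 * c * (- b) * b + (- b)\<^sup>2 * c = c * (a * c - b\<^sup>2)"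
      by (simp add: power2_eq_square algebra_simps)
    then have "0 \<le> c * (a * c - b\<^sup>2)" using quad[of c "- b"] by simp
    then show ?thesis using False c by (simp add: zero_le_mult_iff)
  qed
  then have "sqrt (b\<^sup>2) \<le> sqrt (a * c)" by (rule real_sqrt_le_mono)
  then show ?thesis
    unfolding real_sqrt_abs real_sqrt_mult a_def b_def c_def L2_norm_square[symmetric] by simp
qed

lemma L2_norm_scale: "L2_norm (\<lambda>y. c * f y) = \<bar>c\<bar> * L2_norm f"
  unfolding L2_norm_def by (simp add: power_mult_distrib real_sqrt_mult)

lemma L2_norm_triangle:
  assumes f: "f \<in> L2" and g: "g \<in> L2" shows "L2_norm (\<lambda>y. f y + g y) \<le> L2_norm f + L2_norm g"
proof (rule power2_le_imp_le)
  have "(L2_norm (\<lambda>y. f y + g y))\<^sup>2 = (L2_norm f)\<^sup>2 + 2 * L2_inner f g + (L2_norm g)\<^sup>2"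
    using f g L2_add[OF f g] by (simp add: L2_norm_square L2_inner_add_left L2_inner_add_right L2_inner_commute[of g f])
  also have "\<dots> \<le> (L2_norm f + L2_norm g)\<^sup>2"
    using L2_Cauchy_Schwarz[OF f g] by (simp add: power2_sum abs_le_iff)
  finally show "(L2_norm (\<lambda>y. f y + g y))\<^sup>2 \<le> (L2_norm f + L2_norm g)\<^sup>2" .
qed simp

lemma L2_norm_minus: "L2_norm (\<lambda>y. f y - g y) = L2_norm (\<lambda>y. g y - f y)"
  unfolding L2_norm_def by (simp add: power2_commute)

lemma L2_norm_triangle_diff:
  assumes f: "f \<in> L2" and g: "g \<in> L2" shows "L2_norm (\<lambda>y. f y - g y) \<le> L2_norm f + L2_norm g"
  using L2_norm_triangle[OF f L2_scale[OF g, of "- 1"]] by (simp add: L2_norm_scale[of "-1", simplified])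

lemma L2_norm_diff_bound:
  assumes f: "f \<in> L2" and g: "g \<in> L2" shows "\<bar>L2_norm f - L2_norm g\<bar> \<le> L2_norm (\<lambda>y. f y - g y)"
  using L2_norm_triangle[OF L2_diff[OF f g] g] L2_norm_triangle[OF L2_diff[OF g f] f] L2_norm_minus[of f g] by simp

lemma L2_norm_AE_cong:
  assumes "f \<in> borel_measurable (lebesgue_on Omega)" "g \<in> borel_measurable (lebesgue_on Omega)"
    "AE y in lebesgue_on Omega. f y = g y"
  shows "L2_norm f = L2_norm g"
proof -
  have "AE y in lebesgue_on Omega. (f y)\<^sup>2 = (g y)\<^sup>2" using assms(3) by eventually_elim simp
  then have "(LINT y|lebesgue_on Omega. (f y)\<^sup>2) = (LINT y|lebesgue_on Omega. (g y)\<^sup>2)"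
    using assms(1,2) by (intro integral_cong_AE) auto
  then show ?thesis unfolding L2_norm_def by simp
qed

lemma L2_inner_AE_cong:
  assumes "f \<in> borel_measurable (lebesgue_on Omega)" "g \<in> borel_measurable (lebesgue_on Omega)" "h \<in> L2"
    "AE y in lebesgue_on Omega. f y = g y"
  shows "L2_inner f h = L2_inner g h"
proof -
  have "AE y in lebesgue_on Omega. f y * h y = g y * h y" using assms(4) by eventually_elim simp
  then show ?thesis
    unfolding L2_inner_def using assms(1,2) L2_measurable[OF assms(3)] by (intro integral_cong_AE) auto
qed

lemma L2_inner_cong:
  assumes "\<And>y. y \<in> Omega \<Longrightarrow> f y = f' y" "\<And>y. y \<in> Omega \<Longrightarrow> g y = g' y"
  shows "L2_inner f g = L2_inner f' g'"
  unfolding L2_inner_def using assms by (intro Bochner_Integration.integral_cong) auto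

lemma L2_inner_eq_integral:
  assumes "f \<in> L2" "g \<in> L2" shows "L2_inner f g = integral Omega (\<lambda>y. f y * g y)"
  unfolding L2_inner_def using assms by (intro lebesgue_integral_eq_integral L2_mult_integrable) auto

lemma L2_inner_one: "L2_inner (\<lambda>y. 1) (\<lambda>y. c) = c"
  by (subst L2_inner_eq_integral) auto

lemma L2_norm_le_sup:
  assumes "f \<in> L2" "0 \<le> c" "\<And>y. y \<in> Omega \<Longrightarrow> \<bar>f y\<bar> \<le> c" shows "L2_norm f \<le> c"
proof (rule power2_le_imp_le)
  have "f y * f y \<le> 1 * c\<^sup>2" if "y \<in> Omega" for y
    using power_mono[OF assms(3)[OF that] abs_ge_zero, of 2] by (simp add: power2_eq_square)
  then have "L2_inner f f \<le> L2_inner (\<lambda>y. 1) (\<lambda>y. c\<^sup>2)" using assms by (intro L2_inner_mono) auto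
  then show "(L2_norm f)\<^sup>2 \<le> c\<^sup>2" by (simp add: L2_norm_square L2_inner_one)
qed (use assms in simp)

lemma L2_norm_mult_le:
  assumes f: "f \<in> L2" and kf: "(\<lambda>y. k y * f y) \<in> L2" and "0 \<le> c" "\<And>y. y \<in> Omega \<Longrightarrow> \<bar>k y\<bar> \<le> c"
  shows "L2_norm (\<lambda>y. k y * f y) \<le> c * L2_norm f"
proof (rule power2_le_imp_le)
  have "(k y * f y) * (k y * f y) \<le> (c * f y) * (c * f y)" if "y \<in> Omega" for y
  proof -
    have "(k y)\<^sup>2 \<le> c\<^sup>2" using power_mono[OF assms(4)[OF that] abs_ge_zero, of 2] by simp
    then have "(k y)\<^sup>2 * (f y)\<^sup>2 \<le> c\<^sup>2 * (f y)\<^sup>2" by (intro mult_right_mono) auto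
    then show ?thesis by (simp add: power2_eq_square mult_ac)
  qed
  then have "L2_inner (\<lambda>y. k y * f y) (\<lambda>y. k y * f y) \<le> L2_inner (\<lambda>y. c * f y) (\<lambda>y. c * f y)"
    using f kf by (intro L2_inner_mono L2_scale)
  then show "(L2_norm (\<lambda>y. k y * f y))\<^sup>2 \<le> (c * L2_norm f)\<^sup>2"
    by (simp add: L2_norm_square L2_inner_scale_left L2_inner_scale_right power_mult_distrib power2_eq_square[of c])
qed (use assms in simp)

lemma abs_integral_le_L2_norm:
  assumes f: "f \<in> L2" and xy: "{x..y} \<subseteq> Omega" shows "\<bar>integral {x..y} f\<bar> \<le> L2_norm f"
proof -
  have fi: "f absolutely_integrable_on Omega"
    using L2_integrable[OF f] by (simp add: absolutely_integrable_on_iff_lebesgue_on)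
  have ai: "f absolutely_integrable_on {x..y}" using absolutely_integrable_on_subinterval[OF fi xy] .
  have "\<bar>integral {x..y} f\<bar> \<le> integral {x..y} (\<lambda>z. \<bar>f z\<bar>)"
    using ai absolutely_integrable_on_def[of "{x..y}" f] Henstock_Kurzweil_Integration.integral_norm_bound_integral[of f "{x..y}" "\<lambda>z. \<bar>f z\<bar>"] by simp
  also have "\<dots> \<le> integral Omega (\<lambda>z. \<bar>f z\<bar>)"
    using ai fi xy unfolding absolutely_integrable_on_def by (intro integral_subset_le) auto
  also have "\<dots> = L2_inner (\<lambda>z. \<bar>f z\<bar>) (\<lambda>z. 1)"
    using f L2_square_integrable[OF f] by (subst L2_inner_eq_integral) (auto simp: L2_def)
  also have "\<dots> \<le> L2_norm (\<lambda>z. \<bar>f z\<bar>) * L2_norm (\<lambda>z. 1)"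
    using L2_Cauchy_Schwarz[of "\<lambda>z. \<bar>f z\<bar>" "\<lambda>z. 1"] f by (auto simp: L2_def)
  also have "\<dots> \<le> L2_norm f * 1"
    using L2_norm_le_sup[of "\<lambda>z. 1" 1] by (intro mult_mono) (auto simp: L2_norm_def)
  finally show ?thesis by simp
qed

text \<open>
  Norm continuity on the half line, for curves given by functions of time and space. Unlike \<^const>\<open>in_C_time\<close> it is not
  tied to a time horizon.
\<close>
definition L2_continuous :: "(real \<Rightarrow> real \<Rightarrow> real) \<Rightarrow> bool" where
  "L2_continuous U \<longleftrightarrow> (\<forall>t\<ge>0. U t \<in> L2) \<and>
     (\<forall>s\<ge>0. ((\<lambda>t. L2_norm (\<lambda>y. U t y - U s y)) \<longlongrightarrow> 0) (at s within {0..}))"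

lemma L2_continuousD: "L2_continuous U \<Longrightarrow> 0 \<le> t \<Longrightarrow> U t \<in> L2"
  by (simp add: L2_continuous_def)

lemma L2_continuous_sequence:
  assumes U: "L2_continuous U" and t: "\<And>n. 0 \<le> t n" "0 \<le> s" "t \<longlonglongrightarrow> s"
  shows "(\<lambda>n. L2_norm (\<lambda>y. U (t n) y - U s y)) \<longlonglongrightarrow> 0"
proof -
  have z: "L2_norm (\<lambda>y. U s y - U s y) = 0" by (simp add: L2_norm_def)
  have "continuous (at s within {0..}) (\<lambda>t. L2_norm (\<lambda>y. U t y - U s y))"
    using U t(2) z unfolding continuous_within L2_continuous_def by simp
  from continuous_within_tendsto_compose[OF this _ t(3)] t(1) z show ?thesis by simp
qed

lemma L2_continuous_constant: "q \<in> L2 \<Longrightarrow> L2_continuous (\<lambda>t. q)"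
  by (simp add: L2_continuous_def L2_norm_def)

lemma L2_continuous_scale:
  assumes "L2_continuous U" shows "L2_continuous (\<lambda>t y. c * U t y)"
proof -
  have "((\<lambda>t. \<bar>c\<bar> * L2_norm (\<lambda>y. U t y - U s y)) \<longlongrightarrow> \<bar>c\<bar> * 0) (at s within {0..})" if "s \<ge> 0" for s
    using assms that by (intro tendsto_intros) (auto simp: L2_continuous_def)
  then show ?thesis using assms
    by (auto simp: L2_continuous_def L2_scale right_diff_distrib[symmetric] L2_norm_scale)
qed

lemma L2_continuous_add:
  assumes U: "L2_continuous U" and V: "L2_continuous V" shows "L2_continuous (\<lambda>t y. U t y + V t y)"
  unfolding L2_continuous_def
proof (intro conjI allI impI)
  fix s :: real assume s: "0 \<le> s"
  have "((\<lambda>t. L2_norm (\<lambda>y. U t y - U s y) + L2_norm (\<lambda>y. V t y - V s y)) \<longlongrightarrow> 0) (at s within {0..})"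
    using U V s by (intro tendsto_add_zero) (auto simp: L2_continuous_def)
  moreover have "\<forall>\<^sub>F t in at s within {0..}. norm (L2_norm (\<lambda>y. (U t y + V t y) - (U s y + V s y)))
      \<le> L2_norm (\<lambda>y. U t y - U s y) + L2_norm (\<lambda>y. V t y - V s y)"
    unfolding eventually_at_filter
  proof (intro always_eventually allI impI)
    fix t :: real assume "t \<in> {0..}"
    then have "L2_norm (\<lambda>y. (U t y - U s y) + (V t y - V s y)) \<le> L2_norm (\<lambda>y. U t y - U s y) + L2_norm (\<lambda>y. V t y - V s y)"
      using U V s by (intro L2_norm_triangle L2_diff) (auto simp: L2_continuous_def)
    then show "norm (L2_norm (\<lambda>y. (U t y + V t y) - (U s y + V s y)))
      \<le> L2_norm (\<lambda>y. U t y - U s y) + L2_norm (\<lambda>y. V t y - V s y)"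
      by (simp add: algebra_simps)
  qed
  ultimately show "((\<lambda>t. L2_norm (\<lambda>y. (U t y + V t y) - (U s y + V s y))) \<longlongrightarrow> 0) (at s within {0..})"
    by (rule Lim_null_comparison[rotated])
qed (use U V in \<open>auto simp: L2_continuous_def L2_add\<close>)

lemma L2_continuous_diff:
  assumes U: "L2_continuous U" and V: "L2_continuous V" shows "L2_continuous (\<lambda>t y. U t y - V t y)"
  using L2_continuous_add[OF U L2_continuous_scale[OF V, of "- 1"]] by simp

lemma L2_continuous_norm:
  assumes U: "L2_continuous U" shows "continuous_on {0..} (\<lambda>t. L2_norm (U t))"
  unfolding continuous_on_def
proof
  fix s :: real assume s: "s \<in> {0..}"
  have "((\<lambda>t. L2_norm (U t) - L2_norm (U s)) \<longlongrightarrow> 0) (at s within {0..})"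
  proof (rule Lim_null_comparison)
    show "((\<lambda>t. L2_norm (\<lambda>y. U t y - U s y)) \<longlongrightarrow> 0) (at s within {0..})" using U s by (simp add: L2_continuous_def)
    show "\<forall>\<^sub>F t in at s within {0..}. norm (L2_norm (U t) - L2_norm (U s)) \<le> L2_norm (\<lambda>y. U t y - U s y)"
      unfolding eventually_at_filter real_norm_def
      using U s by (intro always_eventually allI impI L2_norm_diff_bound) (auto simp: L2_continuous_def)
  qed
  then show "((\<lambda>t. L2_norm (U t)) \<longlongrightarrow> L2_norm (U s)) (at s within {0..})"
    by (simp add: Lim_null[symmetric])
qed

lemma L2_continuous_inner:
  assumes U: "L2_continuous U" and V: "L2_continuous V"
  shows "continuous_on ({0..} \<times> {0..}) (\<lambda>(r, t). L2_inner (U r) (V t))"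
  unfolding continuous_on_sequentially
proof (intro allI ballI impI, elim conjE)
  fix x :: "nat \<Rightarrow> real \<times> real" and p
  assume "p \<in> {0..} \<times> {0..}" and x: "\<forall>n. x n \<in> {0..} \<times> {0..}" and lim: "x \<longlonglongrightarrow> p"
  then obtain r0 t0 where p: "p = (r0, t0)" and pos: "r0 \<ge> 0" "t0 \<ge> 0" by auto
  define r t where "r n = fst (x n)" and "t n = snd (x n)" for n
  have rt: "r n \<ge> 0" "t n \<ge> 0" for n using x[rule_format, of n] by (auto simp: r_def t_def mem_Times_iff)
  have lims: "r \<longlonglongrightarrow> r0" "t \<longlonglongrightarrow> t0"
    using tendsto_fst[OF lim] tendsto_snd[OF lim] p by (auto simp: r_def[abs_def] t_def[abs_def])
  note limU = L2_continuous_sequence[OF U rt(1) pos(1) lims(1)]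
    and limV = L2_continuous_sequence[OF V rt(2) pos(2) lims(2)]
  have "(\<lambda>n. L2_inner (U (r n)) (V (t n)) - L2_inner (U r0) (V t0)) \<longlonglongrightarrow> 0"
  proof (rule Lim_null_comparison[OF always_eventually], rule allI)
    have "(\<lambda>n. L2_norm (\<lambda>y. U (r n) y - U r0 y) * (L2_norm (V t0) + L2_norm (\<lambda>y. V (t n) y - V t0 y))
        + L2_norm (U r0) * L2_norm (\<lambda>y. V (t n) y - V t0 y)) \<longlonglongrightarrow> 0 * (L2_norm (V t0) + 0) + L2_norm (U r0) * 0"
      by (intro tendsto_intros limU limV)
    then show "(\<lambda>n. L2_norm (\<lambda>y. U (r n) y - U r0 y) * (L2_norm (V t0) + L2_norm (\<lambda>y. V (t n) y - V t0 y))
        + L2_norm (U r0) * L2_norm (\<lambda>y. V (t n) y - V t0 y)) \<longlonglongrightarrow> 0" by simp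
    fix n
    note mem = L2_continuousD[OF U rt(1)[of n]] L2_continuousD[OF U pos(1)]
      L2_continuousD[OF V rt(2)[of n]] L2_continuousD[OF V pos(2)]
    note mem' = L2_diff[OF mem(1,2)] L2_diff[OF mem(3,4)]
    have eq: "L2_inner (U (r n)) (V (t n)) - L2_inner (U r0) (V t0)
        = L2_inner (\<lambda>y. U (r n) y - U r0 y) (V (t n)) + L2_inner (U r0) (\<lambda>y. V (t n) y - V t0 y)"
      unfolding L2_inner_diff_left[OF mem(1,2,3)] L2_inner_diff_right[OF mem(3,4,2)] by simp
    have "norm (L2_inner (U (r n)) (V (t n)) - L2_inner (U r0) (V t0))
      \<le> \<bar>L2_inner (\<lambda>y. U (r n) y - U r0 y) (V (t n))\<bar> + \<bar>L2_inner (U r0) (\<lambda>y. V (t n) y - V t0 y)\<bar>"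
      unfolding eq real_norm_def by (rule abs_triangle_ineq)
    also have "\<dots> \<le> L2_norm (\<lambda>y. U (r n) y - U r0 y) * L2_norm (V (t n)) + L2_norm (U r0) * L2_norm (\<lambda>y. V (t n) y - V t0 y)"
      by (intro add_mono L2_Cauchy_Schwarz mem mem')
    also have "\<dots> \<le> L2_norm (\<lambda>y. U (r n) y - U r0 y) * (L2_norm (V t0) + L2_norm (\<lambda>y. V (t n) y - V t0 y))
        + L2_norm (U r0) * L2_norm (\<lambda>y. V (t n) y - V t0 y)"
      using L2_norm_diff_bound[OF mem(3,4)] by (intro add_right_mono mult_left_mono) auto
    finally show "norm (L2_inner (U (r n)) (V (t n)) - L2_inner (U r0) (V t0)) \<le>
       L2_norm (\<lambda>y. U (r n) y - U r0 y) * (L2_norm (V t0) + L2_norm (\<lambda>y. V (t n) y - V t0 y))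
        + L2_norm (U r0) * L2_norm (\<lambda>y. V (t n) y - V t0 y)" .
  qed
  then show "((\<lambda>(r, t). L2_inner (U r) (V t)) \<circ> x) \<longlonglongrightarrow> (case p of (r, t) \<Rightarrow> L2_inner (U r) (V t))"
    unfolding p by (subst (asm) LIM_zero_iff) (simp add: o_def r_def t_def case_prod_beta)
qed

lemma L2_continuous_if_jointly_continuous:
  assumes k: "continuous_on ({0..} \<times> Omega) (\<lambda>(t, y). k t y)"
  shows "L2_continuous k"
  unfolding L2_continuous_def
proof (intro conjI allI impI)
  have ck: "continuous_on Omega (k t)" if "t \<ge> 0" for t
    by (rule continuous_on_compose2[OF k, of _ "\<lambda>y. (t, y)", simplified]) (use that in \<open>auto intro!: continuous_intros\<close>)
  then show "k t \<in> L2" if "t \<ge> 0" for t using that by (intro L2_continuous_function)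
  fix s :: real assume s: "0 \<le> s"
  show "((\<lambda>t. L2_norm (\<lambda>y. k t y - k s y)) \<longlongrightarrow> 0) (at s within {0..})"
    unfolding Lim_within
  proof (intro allI impI)
    fix e :: real assume e: "e > 0"
    have "continuous_on ({0..s + 1} \<times> Omega) (\<lambda>(t, y). k t y)"
      by (rule continuous_on_subset[OF k]) auto
    then have "uniformly_continuous_on ({0..s + 1} \<times> Omega) (\<lambda>(t, y). k t y)"
      by (intro compact_uniformly_continuous compact_Times) auto
    then obtain d where "d > 0" and d: "\<And>p q. p \<in> {0..s + 1} \<times> Omega \<Longrightarrow> q \<in> {0..s + 1} \<times> Omega \<Longrightarrow>
        dist q p < d \<Longrightarrow> dist (case q of (t, y) \<Rightarrow> k t y) (case p of (t, y) \<Rightarrow> k t y) < e / 2"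
      unfolding uniformly_continuous_on_def using e by (metis half_gt_zero)
    show "\<exists>d>0. \<forall>t\<in>{0..}. 0 < dist t s \<and> dist t s < d \<longrightarrow> dist (L2_norm (\<lambda>y. k t y - k s y)) 0 < e"
    proof (intro exI[of _ "min d 1"] conjI ballI impI)
      fix t :: real assume t: "t \<in> {0..}" "0 < dist t s \<and> dist t s < min d 1"
      have "L2_norm (\<lambda>y. k t y - k s y) \<le> e / 2"
      proof (rule L2_norm_le_sup)
        show "(\<lambda>y. k t y - k s y) \<in> L2" using ck s t by (intro L2_diff L2_continuous_function) auto
        fix y assume "y \<in> Omega"
        moreover have "t \<le> s + 1" "\<bar>t - s\<bar> < d" using t by (auto simp: dist_real_def)
        ultimately show "\<bar>k t y - k s y\<bar> \<le> e / 2"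
          using d[of "(s, y)" "(t, y)"] s t by (auto simp: dist_Pair_Pair dist_real_def)
      qed (use e in simp)
      then show "dist (L2_norm (\<lambda>y. k t y - k s y)) 0 < e" using e by simp
    qed (use \<open>d > 0\<close> in simp)
  qed
qed

lemma L2_inner_integral_swap:
  fixes R :: "real \<Rightarrow> real \<Rightarrow> real"
  assumes st: "s \<le> t" and R: "continuous_on ({s..t} \<times> Omega) (\<lambda>(r, y). R r y)" and h: "continuous_on Omega h"
  shows "L2_inner (\<lambda>y. integral {s..t} (\<lambda>r. R r y)) h = integral {s..t} (\<lambda>r. L2_inner (R r) h)"
proof -
  have cR: "continuous_on Omega (R r)" if "r \<in> {s..t}" for r
    by (rule continuous_on_compose2[OF R, of _ "\<lambda>y. (r, y)", simplified]) (use that in \<open>auto intro!: continuous_intros\<close>)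
  have cRh: "continuous_on ({s..t} \<times> Omega) (\<lambda>(r, y). R r y * h y)"
    unfolding case_prod_beta
    by (intro continuous_intros R[unfolded case_prod_beta] continuous_on_compose2[OF h, of _ snd]) auto
  have swap: "continuous_on (Omega \<times> {s..t}) (\<lambda>(y, r). R r y)"
    unfolding case_prod_beta
    by (rule continuous_on_compose2[OF R, of _ "\<lambda>p. (snd p, fst p)", unfolded case_prod_beta, simplified])
       (auto intro!: continuous_intros)
  have "continuous_on Omega (\<lambda>y. integral {s..t} (\<lambda>r. R r y))"
    using integral_continuous_on_param[of Omega s t "\<lambda>y r. R r y", unfolded box_real, OF swap] .
  then have "L2_inner (\<lambda>y. integral {s..t} (\<lambda>r. R r y)) h = integral Omega (\<lambda>y. integral {s..t} (\<lambda>r. R r y) * h y)"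
    using h by (intro L2_inner_eq_integral L2_continuous_function)
  also have "\<dots> = integral Omega (\<lambda>y. integral {s..t} (\<lambda>r. R r y * h y))"
    by simp
  also have "\<dots> = integral {s..t} (\<lambda>r. integral Omega (\<lambda>y. R r y * h y))"
    using integral_swap_continuous[of s 0 t 1 "\<lambda>r y. R r y * h y"] cRh by (simp add: cbox_Pair_eq)
  also have "\<dots> = integral {s..t} (\<lambda>r. L2_inner (R r) h)"
    using cR h by (intro integral_cong L2_inner_eq_integral[symmetric] L2_continuous_function) auto
  finally show ?thesis .
qed

section \<open>Sobolev functions on the unit interval\<close>

lemma integrable_on_lebesgue_on_AE_cong:
  fixes f g :: "real \<Rightarrow> real"
  assumes f: "integrable (lebesgue_on S) f" and S: "S \<in> sets lebesgue" and eq: "AE x in lebesgue_on S. g x = f x"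
  shows "integrable (lebesgue_on S) g" and "integral\<^sup>L (lebesgue_on S) g = integral\<^sup>L (lebesgue_on S) f"
proof -
  obtain N where N: "N \<in> null_sets (lebesgue_on S)" "{x \<in> space (lebesgue_on S). g x \<noteq> f x} \<subseteq> N"
    using eq unfolding eventually_ae_filter by auto
  then have "negligible N" using S by (simp add: negligible_iff_null_sets null_sets_restrict_space)
  moreover have "f absolutely_integrable_on S" using f S by (simp add: absolutely_integrable_on_iff_lebesgue_on)
  ultimately have "g absolutely_integrable_on S"
    using absolutely_integrable_spike[of S f N g] N(2) by auto
  then show g: "integrable (lebesgue_on S) g" using S by (simp add: absolutely_integrable_on_iff_lebesgue_on)
  show "integral\<^sup>L (lebesgue_on S) g = integral\<^sup>L (lebesgue_on S) f"
    using f g eq by (intro integral_cong_AE) auto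
qed

lemma L2_norm_eq_0_continuous:
  assumes d: "continuous_on Omega d" and "L2_norm d = 0" and y: "y \<in> Omega"
  shows "d y = 0"
proof -
  have "integral Omega (\<lambda>y. d y * d y) = 0"
    using assms L2_norm_square[of d] L2_inner_eq_integral[of d d] L2_continuous_function[OF d] by simp
  moreover have "continuous_on Omega (\<lambda>y. d y * d y)" by (intro continuous_intros d)
  ultimately have "\<forall>y\<in>Omega. d y * d y = 0"
    using integral_eq_0_iff[of 0 1 "\<lambda>y. d y * d y"] by simp
  then show ?thesis using y by simp
qed

lemma AE_eq_imp_eq_continuous:
  fixes f g :: "real \<Rightarrow> real"
  assumes f: "continuous_on Omega f" and g: "continuous_on Omega g" and eq: "AE y in lebesgue_on Omega. f y = g y"
    and y: "y \<in> Omega"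
  shows "f y = g y"
proof -
  have c: "continuous_on Omega (\<lambda>y. f y - g y)" by (intro continuous_intros f g)
  have "AE y in lebesgue_on Omega. f y - g y = 0" using eq by eventually_elim simp
  then have "L2_norm (\<lambda>y. f y - g y) = L2_norm (\<lambda>y. 0)"
    by (intro L2_norm_AE_cong continuous_imp_measurable_on_sets_lebesgue c) auto
  then have "f y - g y = 0" by (intro L2_norm_eq_0_continuous[OF c _ y]) (simp add: L2_norm_def)
  then show ?thesis by simp
qed

lemma has_weak_deriv_iff_inner:
  "has_weak_deriv f g \<longleftrightarrow> f \<in> L2 \<and> g \<in> L2 \<and>
     (\<forall>\<phi>. test_fun 0 1 \<phi> \<longrightarrow> L2_inner f (deriv \<phi>) = - L2_inner g \<phi>)"
  unfolding has_weak_deriv_def L2_inner_def ..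

lemma test_fun_L2: "test_fun a b \<phi> \<Longrightarrow> \<phi> \<in> L2" and test_fun_deriv_L2: "test_fun a b \<phi> \<Longrightarrow> deriv \<phi> \<in> L2"
  by (simp_all add: L2_continuous_function smooth_continuous smooth_deriv test_fun_smooth)

lemma has_weak_deriv_diff:
  assumes "has_weak_deriv f g" "has_weak_deriv f' g'"
  shows "has_weak_deriv (\<lambda>y. f y - f' y) (\<lambda>y. g y - g' y)"
  using assms unfolding has_weak_deriv_iff_inner
  by (auto simp: L2_diff L2_inner_diff_left test_fun_L2 test_fun_deriv_L2)

lemma has_weak_deriv_linear:
  assumes "has_weak_deriv f g" "has_weak_deriv f' g'"
  shows "has_weak_deriv (\<lambda>y. c * f y + f' y) (\<lambda>y. c * g y + g' y)"
  using assms unfolding has_weak_deriv_iff_inner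
  by (auto simp: L2_add L2_scale L2_inner_add_left L2_inner_scale_left test_fun_L2 test_fun_deriv_L2)

lemma weak_deriv_unique:
  assumes "has_weak_deriv f g" "has_weak_deriv f g'"
  shows "AE y in lebesgue_on Omega. g y = g' y"
proof -
  have "AE y in lebesgue_on Omega. g y - g' y = 0"
  proof (rule fundamental_lemma_calculus_of_variations)
    show "integrable (lebesgue_on Omega) (\<lambda>y. g y - g' y)"
      using assms by (auto simp: has_weak_deriv_def intro!: L2_integrable L2_diff)
    fix \<theta> assume "test_fun 0 1 \<theta>"
    then have "L2_inner (\<lambda>y. g y - g' y) \<theta> = 0"
      using assms by (auto simp: has_weak_deriv_iff_inner L2_inner_diff_left test_fun_L2)
    then show "(LINT y|lebesgue_on Omega. (g y - g' y) * \<theta> y) = 0" by (simp add: L2_inner_def)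
  qed
  then show ?thesis by eventually_elim simp
qed

lemma L2_imp_integrable_on: "g \<in> L2 \<Longrightarrow> {s..t} \<subseteq> Omega \<Longrightarrow> g integrable_on {s..t}"
  using integrable_on_subinterval[of g Omega s t] integrable_on_lebesgue_on[OF L2_integrable] by auto

lemma has_weak_deriv_imp_AE_integral:
  assumes "has_weak_deriv f g"
  shows "\<exists>c. AE y in lebesgue_on Omega. f y = c + integral {0..y} g"
  using assms by (intro du_Bois_Reymond) (auto simp: has_weak_deriv_def intro: L2_integrable)

text \<open>
  The continuous representative is the primitive at every point; this is where continuity in the definition of \<^const>\<open>H1\<close>
  is used.
\<close>
lemma has_weak_deriv_imp_integral:
  assumes fg: "has_weak_deriv f g" and f: "continuous_on Omega f" and y: "y \<in> Omega"
  shows "f y = f 0 + integral {0..y} g"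
proof -
  obtain c where c: "AE y in lebesgue_on Omega. f y = c + integral {0..y} g"
    using has_weak_deriv_imp_AE_integral[OF fg] ..
  have "continuous_on Omega (\<lambda>y. c + integral {0..y} g)"
    using fg by (intro continuous_on_add continuous_on_const indefinite_integral_continuous_1 L2_imp_integrable_on)
      (simp_all add: has_weak_deriv_def)
  then have eq: "f z = c + integral {0..z} g" if "z \<in> Omega" for z
    by (rule AE_eq_imp_eq_continuous[OF f _ c that])
  have f0: "f 0 = c" using eq[of 0] by simp
  show ?thesis unfolding f0 by (rule eq[OF y])
qed

lemma has_weak_derivI_integral:
  assumes g: "g \<in> L2" and f: "\<And>y. y \<in> Omega \<Longrightarrow> f y = f 0 + integral {0..y} g"
  shows "has_weak_deriv f g" and "continuous_on Omega f"
proof -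
  show c: "continuous_on Omega f"
    by (rule continuous_on_if_integral[OF L2_imp_integrable_on[OF g order_refl] f])
  have "L2_inner f (deriv \<phi>) = - L2_inner g \<phi>" if \<phi>: "test_fun 0 1 \<phi>" for \<phi>
  proof -
    note sm = test_fun_smooth[OF \<phi>]
    obtain c d where "0 < c" "d < 1" and out: "\<And>x. x \<notin> {c..d} \<Longrightarrow> \<phi> x = 0"
      using \<phi> unfolding test_fun_def by blast
    then have ends: "\<phi> 0 = 0" "\<phi> 1 = 0" by auto
    have "\<phi> x = \<phi> 0 + integral {0..x} (deriv \<phi>)" if "x \<in> Omega" for x
    proof -
      have "(deriv \<phi> has_integral (\<phi> x - \<phi> 0)) {0..x}"
        using that by (intro fundamental_theorem_of_calculus)
          (auto simp: has_real_derivative_iff_has_vector_derivative[symmetric] intro!: DERIV_subset[OF smooth_has_deriv[OF sm]])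
      then show ?thesis by (simp add: integral_unique)
    qed
    with f have "(LINT x|lebesgue_on Omega. f x * deriv \<phi> x) = f 1 * \<phi> 1 - f 0 * \<phi> 0 - (LINT x|lebesgue_on Omega. g x * \<phi> x)"
      by (rule integral_by_parts_absolutely_continuous[rotated 3])
         (simp_all add: L2_integrable g test_fun_deriv_L2[OF \<phi>])
    then show ?thesis by (simp add: L2_inner_def ends)
  qed
  then show "has_weak_deriv f g"
    unfolding has_weak_deriv_iff_inner using g L2_continuous_function[OF c] by blast
qed

lemma has_weak_deriv_const: "has_weak_deriv (\<lambda>y. c) (\<lambda>y. 0)"
  by (rule has_weak_derivI_integral) auto

lemma has_weak_deriv_wderiv: "has_weak_deriv f g \<Longrightarrow> has_weak_deriv f (wderiv f)"
  unfolding wderiv_def by (rule someI[where P = "has_weak_deriv f"])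

lemma H1_wderiv: "f \<in> H1 \<Longrightarrow> has_weak_deriv f (wderiv f)"
  by (auto simp: H1_def intro: has_weak_deriv_wderiv)

lemma H1_continuous: "f \<in> H1 \<Longrightarrow> continuous_on Omega f"
  by (simp add: H1_def)

lemma H1_L2: "f \<in> H1 \<Longrightarrow> f \<in> L2" and H1_wderiv_L2: "f \<in> H1 \<Longrightarrow> wderiv f \<in> L2"
  using H1_wderiv by (auto simp: has_weak_deriv_def)

lemma H1I: "continuous_on Omega f \<Longrightarrow> has_weak_deriv f g \<Longrightarrow> f \<in> H1"
  by (auto simp: H1_def)

lemma L2_norm_wderiv:
  assumes "has_weak_deriv f g" shows "L2_norm (wderiv f) = L2_norm g"
proof -
  have w: "has_weak_deriv f (wderiv f)" using assms by (rule has_weak_deriv_wderiv)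
  show ?thesis
    using w assms by (intro L2_norm_AE_cong weak_deriv_unique[OF w assms]) (auto simp: has_weak_deriv_def L2_measurable)
qed

lemma H1_norm_eq:
  assumes "has_weak_deriv f g" shows "H1_norm f = sqrt ((L2_norm f)\<^sup>2 + (L2_norm g)\<^sup>2)"
  unfolding H1_norm_def L2_norm_wderiv[OF assms] ..

lemma H1_diff:
  assumes "f \<in> H1" "g \<in> H1" shows "(\<lambda>y. f y - g y) \<in> H1"
proof (rule H1I)
  show "has_weak_deriv (\<lambda>y. f y - g y) (\<lambda>y. wderiv f y - wderiv g y)"
    using assms by (intro has_weak_deriv_diff H1_wderiv)
  show "continuous_on Omega (\<lambda>y. f y - g y)"
    using assms by (intro continuous_on_diff H1_continuous)
qed

lemma H1_norm_ge:
  assumes "has_weak_deriv f g" shows "L2_norm f \<le> H1_norm f" "L2_norm g \<le> H1_norm f"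
  unfolding H1_norm_eq[OF assms] by (auto intro!: real_le_rsqrt)

lemma H1_norm_nonneg: "0 \<le> H1_norm f"
  unfolding H1_norm_def by simp

text \<open>
  Values at two points differ by at most the norm of the derivative, and the value at some point is at most the \<open>L\<^sup>2\<close> norm of
  \<open>f\<close>.
\<close>
lemma H1_sup_bound:
  assumes f: "f \<in> H1" and y: "y \<in> Omega" shows "\<bar>f y\<bar> \<le> 2 * H1_norm f"
proof -
  define c where "c = \<bar>f y\<bar> - L2_norm (wderiv f)"
  have cf: "c \<le> \<bar>f x\<bar>" if x: "x \<in> Omega" for x
  proof -
    note eq = has_weak_deriv_imp_integral[OF H1_wderiv[OF f] H1_continuous[OF f]]
    have "\<bar>f s - f t\<bar> \<le> L2_norm (wderiv f)" if "s \<le> t" "s \<in> Omega" "t \<in> Omega" for s t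
    proof -
      have "integral {0..s} (wderiv f) + integral {s..t} (wderiv f) = integral {0..t} (wderiv f)"
        using that f by (intro Henstock_Kurzweil_Integration.integral_combine L2_imp_integrable_on H1_wderiv_L2) auto
      then have "f t - f s = integral {s..t} (wderiv f)" using eq[OF that(2)] eq[OF that(3)] by simp
      then show ?thesis
        using abs_integral_le_L2_norm[of "wderiv f" s t] f that by (auto simp: H1_wderiv_L2 abs_minus_commute)
    qed
    from this[of x y] this[of y x] have "\<bar>f x - f y\<bar> \<le> L2_norm (wderiv f)"
      using x y by (cases "x \<le> y") (auto simp: abs_minus_commute)
    then show ?thesis unfolding c_def by linarith
  qed
  have "c \<le> L2_norm f"
  proof (cases "c \<le> 0")
    case True then show ?thesis using L2_norm_nonneg[of f] by linarith
  next
    case False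
    have "(\<lambda>x. 1) y * (\<lambda>x. c\<^sup>2) y \<le> f y * f y" if "y \<in> Omega" for y
      using power_mono[OF cf[OF that], of 2] False by (simp add: power2_eq_square)
    then have "L2_inner (\<lambda>x. 1) (\<lambda>x. c\<^sup>2) \<le> L2_inner f f"
      using H1_L2[OF f] by (intro L2_inner_mono) auto
    then have "c\<^sup>2 \<le> (L2_norm f)\<^sup>2" unfolding L2_inner_one L2_norm_square[of f] .
    then show ?thesis by (rule power2_le_imp_le) simp
  qed
  then show ?thesis using H1_norm_ge[OF H1_wderiv[OF f]] unfolding c_def by linarith
qed

text \<open>
  The class of admissible test functions is enlarged from smooth ones with compact support to primitives of square
  integrable functions that vanish at both ends. The function \<open>W\<close> is only determined up to a null set, so it is first replaced by a
  primitive.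
\<close>
lemma weak_deriv_duality:
  assumes W: "has_weak_deriv W g" and \<psi>': "\<psi>' \<in> L2" "integral Omega \<psi>' = 0"
  shows "L2_inner g (\<lambda>y. integral {0..y} \<psi>') = - L2_inner W \<psi>'"
proof -
  have mem: "W \<in> L2" "g \<in> L2" using W by (auto simp: has_weak_deriv_def)
  obtain c where c: "AE y in lebesgue_on Omega. W y = c + integral {0..y} g"
    using has_weak_deriv_imp_AE_integral[OF W] ..
  define K where "K y = c + integral {0..y} g" for y
  have K: "K \<in> L2" unfolding K_def
    by (intro L2_continuous_function continuous_on_add continuous_on_const indefinite_integral_continuous_1
        L2_imp_integrable_on mem) simp
  have "L2_inner W \<psi>' = L2_inner K \<psi>'"
    by (rule L2_inner_AE_cong[OF L2_measurable[OF mem(1)] L2_measurable[OF K] \<psi>'(1)]) (use c in \<open>simp add: K_def\<close>)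
  also have "\<dots> = K 1 * integral {0..1} \<psi>' - K 0 * integral {0..0} \<psi>' - (LINT y|lebesgue_on Omega. g y * integral {0..y} \<psi>')"
    unfolding L2_inner_def
    by (rule integral_by_parts_absolutely_continuous) (auto simp: K_def intro!: L2_integrable mem \<psi>')
  finally show ?thesis using \<psi>'(2) by (simp add: L2_inner_def)
qed

text \<open>
  The essential supremum \<open>r\<close> is finite by compactness, and \<open>max \<bar>g\<bar> r = r\<close> holds almost everywhere between continuous
  functions, hence everywhere.
\<close>
lemma continuous_le_Linf_norm:
  assumes g: "continuous_on Omega g" and y: "y \<in> Omega" shows "\<bar>g y\<bar> \<le> Linf_norm g"
proof -
  let ?M = "lebesgue_on Omega"
  define E where "E = esssup ?M (\<lambda>y. ereal \<bar>g y\<bar>)"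
  have meas: "(\<lambda>y. ereal \<bar>g y\<bar>) \<in> borel_measurable ?M"
    by (intro borel_measurable_ereal continuous_imp_measurable_on_sets_lebesgue continuous_intros g) auto
  have AE: "AE y in ?M. ereal \<bar>g y\<bar> \<le> E" unfolding E_def by (rule esssup_AE)
  obtain C where C: "\<And>y. y \<in> Omega \<Longrightarrow> \<bar>g y\<bar> \<le> C"
  proof -
    have "bounded (g ` Omega)" by (intro compact_imp_bounded compact_continuous_image g) auto
    then obtain C where "\<forall>y\<in>Omega. \<bar>g y\<bar> \<le> C" by (auto simp: bounded_iff)
    then show ?thesis by (intro that[of C]) auto
  qed
  have "E \<le> ereal C" unfolding E_def by (rule esssup_I[OF meas], rule AE_I2) (use C in auto)
  moreover have "0 \<le> E"
  proof (rule ccontr)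
    assume "\<not> 0 \<le> E"
    have "AE y in ?M. (1::real) = 0"
      using AE
    proof eventually_elim
      case (elim y)
      have "ereal 0 \<le> ereal \<bar>g y\<bar>" by simp
      then have "0 \<le> E" using elim by (metis order_trans zero_ereal_def)
      then show ?case using \<open>\<not> 0 \<le> E\<close> by simp
    qed
    then have "(1::real) = 0"
      by (intro AE_eq_imp_eq_continuous[of "\<lambda>y. 1" "\<lambda>y. 0" 0]) auto
    then show False by simp
  qed
  ultimately obtain r where r: "E = ereal r" by (cases E) auto
  have "AE y in ?M. max \<bar>g y\<bar> r = r" using AE by eventually_elim (simp add: r max_def)
  then have "max \<bar>g y\<bar> r = r"
    by (intro AE_eq_imp_eq_continuous[of "\<lambda>y. max \<bar>g y\<bar> r" "\<lambda>y. r"] y) (auto intro!: continuous_intros g)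
  then show ?thesis unfolding Linf_norm_def E_def[symmetric] r by simp
qed

lemma Linf_norm_le:
  assumes g: "continuous_on Omega g" and c: "\<And>y. y \<in> Omega \<Longrightarrow> \<bar>g y\<bar> \<le> c" shows "Linf_norm g \<le> c"
proof -
  let ?E = "esssup (lebesgue_on Omega) (\<lambda>y. ereal \<bar>g y\<bar>)"
  have "(\<lambda>y. ereal \<bar>g y\<bar>) \<in> borel_measurable (lebesgue_on Omega)"
    by (intro borel_measurable_ereal continuous_imp_measurable_on_sets_lebesgue continuous_intros g) auto
  then have "?E \<le> ereal c" by (rule esssup_I, intro AE_I2) (use c in auto)
  moreover have "0 \<le> c" using c[of 0] by (simp add: order_trans[OF abs_ge_zero])
  ultimately show ?thesis unfolding Linf_norm_def by (cases ?E) auto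
qed

lemma Linf_norm_nonneg: "continuous_on Omega g \<Longrightarrow> 0 \<le> Linf_norm g"
  using continuous_le_Linf_norm[of g 0] by (simp add: order_trans[OF abs_ge_zero])

section \<open>Curves of square integrable functions\<close>

text \<open>
  Testing with a fixed \<open>h\<close> reduces the time derivative in the sense of distributions to a scalar one. The pairing of the
  derivative with \<open>h\<close> is only compared with a continuous function almost everywhere, so its own measurability is a
  consequence.
\<close>
lemma weak_time_deriv_imp_integral:
  assumes T: "T > 0" and wt: "has_weak_time_deriv T u ut" and h: "h \<in> L2"
    and U: "continuous_on {0..T} (\<lambda>t. L2_inner (u t) h)" and g: "continuous_on {0..T} g"
    and eq: "AE t in lebesgue_on {0..T}. L2_inner (ut t) h = g t"
    and st: "0 \<le> s" "s \<le> t" "t \<le> T"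
  shows "L2_inner (u t) h - L2_inner (u s) h = integral {s..t} g"
proof -
  have "\<exists>c. AE t in lebesgue_on {0..T}. L2_inner (u t) h = c + integral {0..t} g"
  proof (rule du_Bois_Reymond[OF T])
    fix \<phi> assume \<phi>: "test_fun 0 T \<phi>"
    have "(LINT t|lebesgue_on {0..T}. L2_inner (u t) h * deriv \<phi> t) = - (LINT t|lebesgue_on {0..T}. L2_inner (ut t) h * \<phi> t)"
      using wt \<phi> h unfolding has_weak_time_deriv_def L2_inner_def by blast
    also have "(LINT t|lebesgue_on {0..T}. L2_inner (ut t) h * \<phi> t) = (LINT t|lebesgue_on {0..T}. g t * \<phi> t)"
    proof (rule integrable_on_lebesgue_on_AE_cong)
      show "integrable (lebesgue_on {0..T}) (\<lambda>t. g t * \<phi> t)"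
        by (intro continuous_imp_integrable_real continuous_intros g smooth_continuous test_fun_smooth[OF \<phi>])
      show "AE t in lebesgue_on {0..T}. L2_inner (ut t) h * \<phi> t = g t * \<phi> t"
        using eq by eventually_elim simp
    qed auto
    finally show "(LINT t|lebesgue_on {0..T}. L2_inner (u t) h * deriv \<phi> t) = - (LINT t|lebesgue_on {0..T}. g t * \<phi> t)" .
  qed (intro continuous_imp_integrable_real U g)+
  then obtain c where c: "AE t in lebesgue_on {0..T}. L2_inner (u t) h = c + integral {0..t} g" ..
  have all: "L2_inner (u t) h = c + integral {0..t} g" if "t \<in> {0..T}" for t
  proof -
    define d where "d y = L2_inner (u (T * y)) h - (c + integral {0..T * y} g)" for y
    have gi: "g integrable_on {0..T}" by (rule integrable_continuous_real[OF g])
    have cd: "continuous_on {0..T} (\<lambda>t. L2_inner (u t) h - (c + integral {0..t} g))"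
      by (intro continuous_intros U indefinite_integral_continuous_1 gi)
    then have csq: "continuous_on {0..T} (\<lambda>t. (L2_inner (u t) h - (c + integral {0..t} g))\<^sup>2)"
      by (rule continuous_on_power)
    have "(LINT t|lebesgue_on {0..T}. (L2_inner (u t) h - (c + integral {0..t} g))\<^sup>2) = (LINT t|lebesgue_on {0..T}. 0)"
    proof (rule integrable_on_lebesgue_on_AE_cong)
      show "AE t in lebesgue_on {0..T}. (L2_inner (u t) h - (c + integral {0..t} g))\<^sup>2 = 0"
        using c by eventually_elim simp
    qed auto
    then have "integral {0..T} (\<lambda>t. (L2_inner (u t) h - (c + integral {0..t} g))\<^sup>2) = 0"
      using lebesgue_integral_eq_integral[OF continuous_imp_integrable_real[OF csq]] by simp
    then have "\<forall>t\<in>{0..T}. (L2_inner (u t) h - (c + integral {0..t} g))\<^sup>2 = 0"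
      using integral_eq_0_iff[OF csq] T by simp
    then show ?thesis using that by simp
  qed
  have "integral {0..s} g + integral {s..t} g = integral {0..t} g"
    using st by (intro Henstock_Kurzweil_Integration.integral_combine integrable_continuous_real continuous_on_subset[OF g]) auto
  then show ?thesis using all[of t] all[of s] st by simp
qed

lemma in_C_time_half_line:
  assumes u: "\<And>T. T > 0 \<Longrightarrow> in_C_time X N T u" and s: "0 \<le> s"
  shows "u s \<in> X" and "((\<lambda>t. N (\<lambda>y. u t y - u s y)) \<longlongrightarrow> 0) (at s within {0..})"
proof -
  have T: "s \<in> {0..s + 1}" "s + 1 > 0" using s by auto
  show "u s \<in> X" using u[OF T(2)] T(1) by (auto simp: in_C_time_def)
  have "((\<lambda>t. N (\<lambda>y. u t y - u s y)) \<longlongrightarrow> 0) (at s within {0..s + 1})"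
    using u[OF T(2)] T(1) unfolding in_C_time_def by blast
  moreover have "at s within {0..s + 1} = at s within {0..}"
    by (rule at_within_nhd[of s "{..<s + 1}"]) auto
  ultimately show "((\<lambda>t. N (\<lambda>y. u t y - u s y)) \<longlongrightarrow> 0) (at s within {0..})" by simp
qed

lemma L2_continuous_wderiv:
  assumes u: "\<And>T. T > 0 \<Longrightarrow> in_C_time H1 H1_norm T u"
  shows "L2_continuous (\<lambda>t. wderiv (u t))"
  unfolding L2_continuous_def
proof (intro conjI allI impI)
  have H1: "u t \<in> H1" if "0 \<le> t" for t
    by (rule in_C_time_half_line(1)[of H1 H1_norm]) (use u that in auto)
  have lim: "((\<lambda>t. H1_norm (\<lambda>y. u t y - u s y)) \<longlongrightarrow> 0) (at s within {0..})" if "0 \<le> s" for s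
    by (rule in_C_time_half_line(2)[of H1 H1_norm]) (use u that in auto)
  show "wderiv (u t) \<in> L2" if "0 \<le> t" for t using H1[OF that] by (simp add: H1_wderiv_L2)
  fix s :: real assume s: "0 \<le> s"
  show "((\<lambda>t. L2_norm (\<lambda>y. wderiv (u t) y - wderiv (u s) y)) \<longlongrightarrow> 0) (at s within {0..})"
  proof (rule Lim_null_comparison)
    show "((\<lambda>t. H1_norm (\<lambda>y. u t y - u s y)) \<longlongrightarrow> 0) (at s within {0..})"
      by (rule lim[OF s])
    show "\<forall>\<^sub>F t in at s within {0..}. norm (L2_norm (\<lambda>y. wderiv (u t) y - wderiv (u s) y)) \<le> H1_norm (\<lambda>y. u t y - u s y)"
      unfolding eventually_at_filter
    proof (intro always_eventually allI impI)
      fix t :: real assume "t \<in> {0..}"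
      then have "has_weak_deriv (\<lambda>y. u t y - u s y) (\<lambda>y. wderiv (u t) y - wderiv (u s) y)"
        using H1[of t] H1[OF s] by (intro has_weak_deriv_diff H1_wderiv) auto
      from H1_norm_ge(2)[OF this]
      show "norm (L2_norm (\<lambda>y. wderiv (u t) y - wderiv (u s) y)) \<le> H1_norm (\<lambda>y. u t y - u s y)" by simp
    qed
  qed
qed

lemma jointly_continuous_if_in_C_time_H1:
  assumes u: "\<And>T. T > 0 \<Longrightarrow> in_C_time H1 H1_norm T u"
  shows "continuous_on ({0..} \<times> Omega) (\<lambda>(t, y). u t y)"
  unfolding continuous_on_sequentially
proof (intro allI ballI impI, elim conjE)
  have H1: "u t \<in> H1" if "0 \<le> t" for t
    by (rule in_C_time_half_line(1)[of H1 H1_norm]) (use u that in auto)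
  have lim: "((\<lambda>t. H1_norm (\<lambda>y. u t y - u s y)) \<longlongrightarrow> 0) (at s within {0..})" if "0 \<le> s" for s
    by (rule in_C_time_half_line(2)[of H1 H1_norm]) (use u that in auto)
  fix x :: "nat \<Rightarrow> real \<times> real" and p
  assume "p \<in> {0..} \<times> Omega" and x: "\<forall>n. x n \<in> {0..} \<times> Omega" and x_lim: "x \<longlonglongrightarrow> p"
  then obtain s z where p: "p = (s, z)" and pos: "0 \<le> s" "z \<in> Omega" by auto
  define t y where "t n = fst (x n)" and "y n = snd (x n)" for n
  have ty: "0 \<le> t n" "y n \<in> Omega" for n using x[rule_format, of n] by (auto simp: t_def y_def mem_Times_iff)
  have lims: "t \<longlonglongrightarrow> s" "y \<longlonglongrightarrow> z"
    using tendsto_fst[OF x_lim] tendsto_snd[OF x_lim] p by (auto simp: t_def[abs_def] y_def[abs_def])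
  have zero: "H1_norm (\<lambda>y. u s y - u s y) = 0"
  proof -
    from H1_norm_eq[OF has_weak_deriv_const[of 0]] show ?thesis by (simp add: L2_norm_def)
  qed
  have "continuous (at s within {0..}) (\<lambda>t. H1_norm (\<lambda>y. u t y - u s y))"
    using lim[OF pos(1)] unfolding continuous_within zero .
  from continuous_within_tendsto_compose[OF this _ lims(1)]
  have 1: "(\<lambda>n. H1_norm (\<lambda>y. u (t n) y - u s y)) \<longlonglongrightarrow> 0" using ty(1) unfolding zero by simp
  have 2: "(\<lambda>n. u s (y n)) \<longlonglongrightarrow> u s z"
    using continuous_on_tendsto_compose[OF H1_continuous[OF H1[OF pos(1)]] lims(2) pos(2)] ty(2) by simp
  have "(\<lambda>n. u (t n) (y n) - u s (y n)) \<longlonglongrightarrow> 0"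
  proof (rule Lim_null_comparison[OF always_eventually], rule allI)
    show "(\<lambda>n. 2 * H1_norm (\<lambda>y. u (t n) y - u s y)) \<longlonglongrightarrow> 0" using tendsto_mult_right_zero[OF 1] .
    fix n
    show "norm (u (t n) (y n) - u s (y n)) \<le> 2 * H1_norm (\<lambda>y. u (t n) y - u s y)"
      using H1_sup_bound[OF H1_diff[OF H1[OF ty(1)] H1[OF pos(1)]] ty(2), of n n] by simp
  qed
  from tendsto_add[OF this 2] show "((\<lambda>(t, y). u t y) \<circ> x) \<longlonglongrightarrow> (case p of (t, y) \<Rightarrow> u t y)"
    by (simp add: p o_def t_def y_def case_prod_beta)
qed

lemma jointly_continuous_slices:
  assumes k: "continuous_on ({0..} \<times> Omega) (\<lambda>(t, y). k t y)"
  shows "0 \<le> t \<Longrightarrow> continuous_on Omega (k t)" and "y \<in> Omega \<Longrightarrow> continuous_on {0..} (\<lambda>t. k t y)"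
  by (rule continuous_on_compose2[OF k, of _ "\<lambda>y. (t, y)", simplified], auto intro!: continuous_intros)
     (rule continuous_on_compose2[OF k, of _ "\<lambda>t. (t, y)", simplified], auto intro!: continuous_intros)

text \<open>
  The defect of the pointwise equation is a continuous function of \<open>y\<close> and so may itself serve as the test function \<open>h\<close>;
  interchanging the integrals shows that it has norm zero.
\<close>
lemma pointwise_if_weak_evolution:
  fixes X R :: "real \<Rightarrow> real \<Rightarrow> real"
  assumes X: "\<And>t. 0 \<le> t \<Longrightarrow> continuous_on Omega (X t)" and R: "continuous_on ({0..} \<times> Omega) (\<lambda>(t, y). R t y)"
    and weak: "\<And>h. continuous_on Omega h \<Longrightarrow> L2_inner (X t) h - L2_inner (X s) h = integral {s..t} (\<lambda>r. L2_inner (R r) h)"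
    and st: "0 \<le> s" "s \<le> t" and y: "y \<in> Omega"
  shows "X t y - X s y = integral {s..t} (\<lambda>r. R r y)"
proof -
  have R': "continuous_on ({s..t} \<times> Omega) (\<lambda>(t, y). R t y)"
    by (rule continuous_on_subset[OF R]) (use st in auto)
  have swap: "continuous_on (Omega \<times> {s..t}) (\<lambda>(y, r). R r y)"
    unfolding case_prod_beta
    by (rule continuous_on_compose2[OF R', of _ "\<lambda>p. (snd p, fst p)", unfolded case_prod_beta, simplified])
       (auto intro!: continuous_intros)
  have cI: "continuous_on Omega (\<lambda>y. integral {s..t} (\<lambda>r. R r y))"
    using integral_continuous_on_param[of Omega s t "\<lambda>y r. R r y", unfolded box_real, OF swap] .
  have cX: "continuous_on Omega (X t)" "continuous_on Omega (X s)" using X st by auto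
  define d where "d y = (X t y - X s y) - integral {s..t} (\<lambda>r. R r y)" for y
  have cd: "continuous_on Omega d" unfolding d_def by (intro continuous_on_diff cX cI)
  note mem = L2_continuous_function[OF cX(1)] L2_continuous_function[OF cX(2)] L2_continuous_function[OF cI]
    L2_continuous_function[OF cd]
  have "L2_inner d h = (L2_inner (X t) h - L2_inner (X s) h) - L2_inner (\<lambda>y. integral {s..t} (\<lambda>r. R r y)) h"
    if "h \<in> L2" for h
    unfolding d_def L2_inner_diff_left[OF L2_diff[OF mem(1,2)] mem(3) that] L2_inner_diff_left[OF mem(1,2) that] ..
  from this[OF mem(4)]
  have "L2_inner d d = (L2_inner (X t) d - L2_inner (X s) d) - L2_inner (\<lambda>y. integral {s..t} (\<lambda>r. R r y)) d" .
  also have "\<dots> = 0"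
    using weak[OF cd] L2_inner_integral_swap[OF st(2) R' cd] by simp
  finally have "L2_norm d = 0" using L2_norm_square[of d] by simp
  then have "d y = 0" by (rule L2_norm_eq_0_continuous[OF cd _ y])
  then show ?thesis by (simp add: d_def)
qed

lemma weak_energy_identity:
  assumes U: "L2_continuous U" and R: "L2_continuous R"
    and weak: "\<And>s t h. 0 \<le> s \<Longrightarrow> s \<le> t \<Longrightarrow> h \<in> L2 \<Longrightarrow>
       L2_inner (U t) h - L2_inner (U s) h = integral {s..t} (\<lambda>r. L2_inner (R r) h)"
    and ab: "0 \<le> a" "a \<le> b"
  shows "L2_inner (U b) (U b) - L2_inner (U a) (U a) = integral {a..b} (\<lambda>r. 2 * L2_inner (R r) (U r))"
proof (rule integral_diagonal_of_increments[OF L2_continuous_inner[OF R U] _ ab])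
  fix s t :: real assume st: "0 \<le> s" "s \<le> t"
  then have t: "0 \<le> t" by simp
  note mem = L2_continuousD[OF U t] L2_continuousD[OF U st(1)]
  have "L2_inner (U t) (U t) - L2_inner (U s) (U s)
      = L2_inner (U t) (\<lambda>y. U s y + U t y) - L2_inner (U s) (\<lambda>y. U s y + U t y)"
    unfolding L2_inner_add_right[OF mem(2,1,1)] L2_inner_add_right[OF mem(2,1,2)]
    by (simp add: L2_inner_commute[of "U t" "U s"])
  also have "\<dots> = integral {s..t} (\<lambda>r. L2_inner (R r) (\<lambda>y. U s y + U t y))"
    by (rule weak[OF st L2_add[OF mem(2,1)]])
  also have "\<dots> = integral {s..t} (\<lambda>r. L2_inner (R r) (U s) + L2_inner (R r) (U t))"
    using st by (intro integral_cong L2_inner_add_right mem L2_continuousD[OF R]) auto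
  finally show "L2_inner (U t) (U t) - L2_inner (U s) (U s) = integral {s..t} (\<lambda>r. L2_inner (R r) (U s) + L2_inner (R r) (U t))" .
qed

lemma pointwise_energy_identity:
  fixes X R :: "real \<Rightarrow> real"
  assumes R: "continuous_on {0..} R" and X: "\<And>s t. 0 \<le> s \<Longrightarrow> s \<le> t \<Longrightarrow> X t - X s = integral {s..t} R"
    and ab: "0 \<le> a" "a \<le> b"
  shows "continuous_on {0..} X" and "(X b)\<^sup>2 - (X a)\<^sup>2 = integral {a..b} (\<lambda>r. 2 * (R r * X r))"
proof -
  have Ri: "R integrable_on {s..t}" if "0 \<le> s" for s t
    by (intro integrable_continuous_real continuous_on_subset[OF R]) (use that in auto)
  show cX: "continuous_on {0..} X"
    unfolding continuous_on_eq_continuous_within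
  proof
    fix t :: real assume t: "t \<in> {0..}"
    have "continuous_on {0..t + 1} X"
    proof (rule continuous_on_if_integral)
      show "R integrable_on {0..t + 1}" by (rule Ri) simp
      show "X r = X 0 + integral {0..r} R" if "r \<in> {0..t + 1}" for r using X[of 0 r] that by auto
    qed
    then have "continuous (at t within {0..t + 1}) X" using t by (simp add: continuous_on_eq_continuous_within)
    moreover have "at t within {0..t + 1} = at t within {0..}"
      by (rule at_within_nhd[of t "{..<t + 1}"]) auto
    ultimately show "continuous (at t within {0..}) X" by (simp add: continuous_within)
  qed
  show "(X b)\<^sup>2 - (X a)\<^sup>2 = integral {a..b} (\<lambda>r. 2 * (R r * X r))"
  proof (rule integral_diagonal_of_increments[where B = "\<lambda>r t. R r * X t", OF _ _ ab])
    show "continuous_on ({0..} \<times> {0..}) (\<lambda>(r, t). R r * X t)"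
      unfolding case_prod_beta
      by (intro continuous_on_mult continuous_on_compose2[OF R, of _ fst] continuous_on_compose2[OF cX, of _ snd]
          continuous_on_fst continuous_on_snd continuous_on_id) auto
    fix s t :: real assume st: "0 \<le> s" "s \<le> t"
    have "(X t)\<^sup>2 - (X s)\<^sup>2 = integral {s..t} R * (X s + X t)"
      unfolding X[OF st, symmetric] by (simp add: power2_eq_square algebra_simps)
    also have "\<dots> = integral {s..t} (\<lambda>r. R r * (X s + X t))" by simp
    finally show "(X t)\<^sup>2 - (X s)\<^sup>2 = integral {s..t} (\<lambda>r. R r * X s + R r * X t)"
      by (simp add: distrib_left)
  qed
qed

section \<open>Perturbations of the equilibrium\<close>

text \<open>
  The two diagonal terms are bounded below by twice the claimed constant when the fluidity stays above half its equilibrium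
  value, and the remaining cross term is of third order.
\<close>
lemma damping_form:
  fixes A m n fs :: real
  assumes pos: "A > 0" "m > 0" "n > 0" "fs > 0"
  obtains \<delta> c where "0 < \<delta>" "0 < c"
    "\<And>x z. \<bar>z\<bar> \<le> \<delta> \<Longrightarrow> - A * (fs + z) * x\<^sup>2 + m * ((fs + z)\<^sup>2 - fs\<^sup>2) * x * z - n * (fs + z)\<^sup>2 * z\<^sup>2 \<le> - c * (x\<^sup>2 + z\<^sup>2)"
proof -
  define c where "c = min (A * fs / 4) (n * fs\<^sup>2 / 8)"
  \<comment> \<open>The first bound keeps \<open>fs + z\<close> above \<open>fs / 2\<close>, the second one makes the cross term at most \<open>c (x\<^sup>2 + z\<^sup>2)\<close>.\<close>
  define \<delta> where "\<delta> = min (fs / 2) (c / (2 * m * fs))"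
  have c: "c > 0" using pos by (simp add: c_def)
  have \<delta>: "\<delta> > 0" using pos c by (simp add: \<delta>_def)
  have "- A * (fs + z) * x\<^sup>2 + m * ((fs + z)\<^sup>2 - fs\<^sup>2) * x * z - n * (fs + z)\<^sup>2 * z\<^sup>2 \<le> - c * (x\<^sup>2 + z\<^sup>2)"
    if z: "\<bar>z\<bar> \<le> \<delta>" for x z
  proof -
    have z1: "\<bar>z\<bar> \<le> fs / 2" and z2: "\<bar>z\<bar> \<le> c / (2 * m * fs)" using z unfolding \<delta>_def by auto
    have f: "fs / 2 \<le> fs + z" using z1 by linarith
    have "(A * (fs / 2)) * x\<^sup>2 \<le> (A * (fs + z)) * x\<^sup>2"
      using f pos by (intro mult_right_mono mult_left_mono) auto
    moreover have "2 * c * x\<^sup>2 \<le> (A * (fs / 2)) * x\<^sup>2"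
      by (intro mult_right_mono) (auto simp: c_def min_def)
    ultimately have 1: "2 * c * x\<^sup>2 \<le> A * (fs + z) * x\<^sup>2" by linarith
    have "(fs / 2)\<^sup>2 \<le> (fs + z)\<^sup>2" using f pos by (intro power_mono) auto
    then have "(n * (fs / 2)\<^sup>2) * z\<^sup>2 \<le> (n * (fs + z)\<^sup>2) * z\<^sup>2"
      using pos by (intro mult_right_mono mult_left_mono) auto
    moreover have "2 * c * z\<^sup>2 \<le> (n * (fs / 2)\<^sup>2) * z\<^sup>2"
      by (intro mult_right_mono) (auto simp: c_def min_def power2_eq_square)
    ultimately have 2: "2 * c * z\<^sup>2 \<le> n * (fs + z)\<^sup>2 * z\<^sup>2" by linarith
    have "\<bar>(fs + z)\<^sup>2 - fs\<^sup>2\<bar> = \<bar>z\<bar> * \<bar>2 * fs + z\<bar>"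
      by (simp add: abs_mult[symmetric] power2_eq_square algebra_simps)
    also have "\<dots> \<le> c / (2 * m * fs) * (4 * fs)"
      using z1 z2 pos by (intro mult_mono) auto
    also have "\<dots> = 2 * c / m" using pos by simp
    finally have "\<bar>m * ((fs + z)\<^sup>2 - fs\<^sup>2)\<bar> \<le> m * (2 * c / m)"
      using pos unfolding abs_mult by (intro mult_mono) auto
    also have "\<dots> = 2 * c" using pos by simp
    finally have m: "\<bar>m * ((fs + z)\<^sup>2 - fs\<^sup>2)\<bar> \<le> 2 * c" .
    have "\<bar>m * ((fs + z)\<^sup>2 - fs\<^sup>2) * (x * z)\<bar> \<le> (2 * c) * \<bar>x * z\<bar>"
      unfolding abs_mult[of "m * _"] using m by (intro mult_right_mono) auto
    also have "\<dots> \<le> c * (x\<^sup>2 + z\<^sup>2)"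
    proof -
      have "2 * \<bar>x * z\<bar> \<le> x\<^sup>2 + z\<^sup>2"
        using sum_squares_bound[of "\<bar>x\<bar>" "\<bar>z\<bar>"] unfolding abs_mult power2_abs by linarith
      then show ?thesis using c by (simp add: mult.assoc[symmetric])
    qed
    finally have 3: "m * ((fs + z)\<^sup>2 - fs\<^sup>2) * x * z \<le> c * (x\<^sup>2 + z\<^sup>2)" by (simp add: mult.assoc)
    have "c * (x\<^sup>2 + z\<^sup>2) = c * x\<^sup>2 + c * z\<^sup>2" "- c * (x\<^sup>2 + z\<^sup>2) = - (c * x\<^sup>2) - c * z\<^sup>2"
      by (simp_all add: algebra_simps)
    then show ?thesis using 1 2 3 by linarith
  qed
  then show ?thesis using that \<delta> c by blast
qed

text \<open>
  The equilibrium enters only through the constants \<open>fs\<close> (fluidity) and \<open>ts\<close> (stress) and the relation between them that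
  makes the fluidity stationary.
\<close>
locale coefficients =
  fixes \<rho> \<eta> lam G \<xi> \<nu> fs ts :: real
  assumes pos: "0 < \<rho>" "0 < \<eta>" "0 < lam" "0 < G" "0 < \<xi>" "0 < \<nu>" "0 < fs" "0 < ts"
    and balance: "\<xi> * ts - 1 = \<nu> * fs"
begin

text \<open>
  The weight of \<open>\<parallel>\<phi>\<parallel>\<^sup>2\<close> in the energy for which the terms in \<open>\<sigma> \<phi>\<close> coming from the stress and the fluidity equation cancel at
  equilibrium.
\<close>
definition k :: real where "k = ts / (G * fs\<^sup>2 * \<xi>)"

lemma k_pos: "0 < k" unfolding k_def using pos by simp

end

text \<open>
  What remains of a global solution after subtracting the equilibrium: \<open>p\<close> is the velocity gradient, \<open>\<sigma>\<close> the stress and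
  \<open>\<phi>\<close> the fluidity. The velocity is recovered as a primitive of \<open>p\<close>, and the mean value of \<open>p\<close> vanishes because the velocity
  perturbation is zero at both ends. The three evolution laws are tested in space and integrated in time, so that no
  second derivative in space and no derivative in time appears; the momentum law is tested with primitives of \<open>\<psi>\<close> that
  vanish at both ends.
\<close>
locale perturbation = coefficients +
  fixes p \<sigma> \<phi> :: "real \<Rightarrow> real \<Rightarrow> real"
  assumes p: "L2_continuous p" and p_mean: "\<And>t. 0 \<le> t \<Longrightarrow> integral Omega (p t) = 0"
    and \<sigma>: "continuous_on ({0..} \<times> Omega) (\<lambda>(t, y). \<sigma> t y)"
    and \<phi>: "continuous_on ({0..} \<times> Omega) (\<lambda>(t, y). \<phi> t y)"
    and momentum: "\<And>s t \<psi>. 0 \<le> s \<Longrightarrow> s \<le> t \<Longrightarrow> \<psi> \<in> L2 \<Longrightarrow> integral Omega \<psi> = 0 \<Longrightarrow>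
      \<rho> * (L2_inner (\<lambda>y. integral {0..y} (p t)) (\<lambda>y. integral {0..y} \<psi>)
         - L2_inner (\<lambda>y. integral {0..y} (p s)) (\<lambda>y. integral {0..y} \<psi>))
      = - integral {s..t} (\<lambda>r. L2_inner (\<lambda>y. \<eta> * p r y + \<sigma> r y) \<psi>)"
    and stress: "\<And>s t h. 0 \<le> s \<Longrightarrow> s \<le> t \<Longrightarrow> h \<in> L2 \<Longrightarrow>
      L2_inner (\<sigma> t) h - L2_inner (\<sigma> s) h
      = integral {s..t} (\<lambda>r. L2_inner (\<lambda>y. (1 / lam) * (G * p r y - ((fs + \<phi> r y) * \<sigma> r y + ts * \<phi> r y))) h)"
    and fluidity: "\<And>s t h. 0 \<le> s \<Longrightarrow> s \<le> t \<Longrightarrow> h \<in> L2 \<Longrightarrow>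
      L2_inner (\<phi> t) h - L2_inner (\<phi> s) h
      = integral {s..t} (\<lambda>r. L2_inner (\<lambda>y. (- 1 + \<xi> * \<bar>ts + \<sigma> r y\<bar>) * (fs + \<phi> r y)\<^sup>2 - \<nu> * (fs + \<phi> r y) ^ 3) h)"
begin

definition v :: "real \<Rightarrow> real \<Rightarrow> real" where "v t y = integral {0..y} (p t)"
text \<open>
  The perturbation of the total stress \<open>\<eta> \<partial>\<^sub>y u + \<tau>\<close>, whose space derivative drives the velocity.
\<close>
definition w :: "real \<Rightarrow> real \<Rightarrow> real" where "w t y = \<eta> * p t y + \<sigma> t y"
text \<open>
  \<open>S\<close> and \<open>Q\<close> are the right hand sides of the stress and the fluidity law, so they are the time derivatives of \<open>\<sigma>\<close> and \<open>\<phi>\<close>.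
\<close>
definition S :: "real \<Rightarrow> real \<Rightarrow> real" where
  "S t y = (1 / lam) * (G * p t y - ((fs + \<phi> t y) * \<sigma> t y + ts * \<phi> t y))"
definition Q :: "real \<Rightarrow> real \<Rightarrow> real" where
  "Q t y = (- 1 + \<xi> * \<bar>ts + \<sigma> t y\<bar>) * (fs + \<phi> t y)\<^sup>2 - \<nu> * (fs + \<phi> t y) ^ 3"
definition D :: "real \<Rightarrow> real" where "D t = L2_inner (p t) (p t) + L2_inner (\<sigma> t) (\<sigma> t) + L2_inner (\<phi> t) (\<phi> t)"
definition E0 :: "real \<Rightarrow> real" where
  "E0 t = \<rho> / 2 * L2_inner (v t) (v t) + lam / (2 * G) * L2_inner (\<sigma> t) (\<sigma> t) + k / 2 * L2_inner (\<phi> t) (\<phi> t)"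
definition small :: "real \<Rightarrow> real \<Rightarrow> bool" where
  "small \<delta> T \<longleftrightarrow> (\<forall>t\<in>{0..T}. \<forall>y\<in>Omega. \<bar>\<sigma> t y\<bar> \<le> \<delta> \<and> \<bar>\<phi> t y\<bar> \<le> \<delta>)"

lemmas \<sigma>L2 = L2_continuous_if_jointly_continuous[OF \<sigma>] and \<phi>L2 = L2_continuous_if_jointly_continuous[OF \<phi>]

lemma nonlinear_part_continuous:
  "continuous_on ({0..} \<times> Omega) (\<lambda>(t, y). (fs + \<phi> t y) * \<sigma> t y + ts * \<phi> t y)"
  using \<sigma> \<phi> unfolding case_prod_beta by (intro continuous_intros)

lemma Q_continuous: "continuous_on ({0..} \<times> Omega) (\<lambda>(t, y). Q t y)"
  using \<sigma> \<phi> unfolding case_prod_beta Q_def by (intro continuous_intros)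

lemma wL2: "L2_continuous w" unfolding w_def
  by (intro L2_continuous_add L2_continuous_scale p \<sigma>L2)
lemma SL2: "L2_continuous S" unfolding S_def
  by (intro L2_continuous_diff L2_continuous_scale p L2_continuous_if_jointly_continuous nonlinear_part_continuous)
lemmas QL2 = L2_continuous_if_jointly_continuous[OF Q_continuous]

lemmas pm = L2_continuousD[OF p] and wm = L2_continuousD[OF wL2] and Sm = L2_continuousD[OF SL2]
  and Qm = L2_continuousD[OF QL2] and \<sigma>m = L2_continuousD[OF \<sigma>L2] and \<phi>m = L2_continuousD[OF \<phi>L2]

lemma inner_continuous:
  assumes "L2_continuous U" "L2_continuous V" shows "continuous_on {0..} (\<lambda>t. L2_inner (U t) (V t))"
  by (rule continuous_on_compose2[OF L2_continuous_inner[OF assms], of _ "\<lambda>t. (t, t)", simplified])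
     (auto intro!: continuous_intros)

lemma D_continuous: "continuous_on {0..} D"
  unfolding D_def by (intro continuous_on_add inner_continuous p \<sigma>L2 \<phi>L2)

lemma norms_le_D: "0 \<le> D t" "(L2_norm (p t))\<^sup>2 \<le> D t" "(L2_norm (\<sigma> t))\<^sup>2 \<le> D t" "(L2_norm (\<phi> t))\<^sup>2 \<le> D t"
  unfolding D_def L2_norm_square[symmetric] by auto

lemma norms_le_sqrt_D: "L2_norm (p t) \<le> sqrt (D t)" "L2_norm (\<sigma> t) \<le> sqrt (D t)" "L2_norm (\<phi> t) \<le> sqrt (D t)"
  using norms_le_D[of t] by (auto intro: real_le_rsqrt)

lemma v_continuous: "0 \<le> t \<Longrightarrow> continuous_on Omega (v t)"
  unfolding v_def by (intro indefinite_integral_continuous_1 L2_imp_integrable_on pm) auto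

lemma v_L2: "0 \<le> t \<Longrightarrow> v t \<in> L2"
  by (intro L2_continuous_function v_continuous)

lemma v_le_p: assumes "0 \<le> t" shows "L2_norm (v t) \<le> L2_norm (p t)"
  by (rule L2_norm_le_sup[OF v_L2[OF assms]]) (auto simp: v_def intro!: abs_integral_le_L2_norm pm assms)

section \<open>Energy dissipation\<close>

text \<open>
  Besides the energy balance (\<open>q = 0\<close>) this covers the distance to a fixed time (\<open>q = p s\<close>), which \<open>flux_energy_inequality\<close>
  needs.
\<close>
lemma velocity_energy_identity:
  assumes q: "q \<in> L2" "integral Omega q = 0" and ab: "0 \<le> a" "a \<le> b"
  shows "\<rho> * L2_inner (\<lambda>y. v b y - integral {0..y} q) (\<lambda>y. v b y - integral {0..y} q)
       - \<rho> * L2_inner (\<lambda>y. v a y - integral {0..y} q) (\<lambda>y. v a y - integral {0..y} q)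
    = integral {a..b} (\<lambda>r. 2 * - L2_inner (w r) (\<lambda>y. p r y - q y))"
proof (rule integral_diagonal_of_increments[where B = "\<lambda>r t. - L2_inner (w r) (\<lambda>y. p t y - q y)", OF _ _ ab])
  have pq: "L2_continuous (\<lambda>t y. p t y - q y)"
    by (intro L2_continuous_diff p) (auto simp: L2_continuous_def q L2_norm_def)
  show "continuous_on ({0..} \<times> {0..}) (\<lambda>(r, t). - L2_inner (w r) (\<lambda>y. p t y - q y))"
    using L2_continuous_inner[OF wL2 pq] unfolding case_prod_beta by (intro continuous_on_minus)
  fix s t :: real assume st: "0 \<le> s" "s \<le> t"
  define z where "z y = integral {0..y} q" for y
  have t: "0 \<le> t" using st by simp
  have zm: "z \<in> L2" unfolding z_def
    by (intro L2_continuous_function indefinite_integral_continuous_1 L2_imp_integrable_on q) auto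
  define \<psi> where "\<psi> y = (p s y - q y) + (p t y - q y)" for y
  have \<psi>m: "\<psi> \<in> L2" unfolding \<psi>_def by (intro L2_add L2_diff pm q st t)
  have I\<psi>: "integral {0..y} \<psi> = (v s y - z y) + (v t y - z y)" if "y \<in> Omega" for y
  proof -
    have i: "f integrable_on {0..y}" if "f \<in> L2" for f
      using L2_imp_integrable_on[OF that, of 0 y] \<open>y \<in> Omega\<close> by auto
    have "(\<psi> has_integral (v s y - z y) + (v t y - z y)) {0..y}"
      unfolding \<psi>_def v_def z_def
      by (intro has_integral_add has_integral_diff integrable_integral i pm q st t)
    then show ?thesis by (rule integral_unique)
  qed
  have mean: "integral Omega \<psi> = 0"
    using I\<psi>[of 1] p_mean[OF st(1)] p_mean[OF t] q(2) by (simp add: v_def z_def)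
  define a b where "a = (\<lambda>y. v t y - z y)" and "b = (\<lambda>y. v s y - z y)"
  have am: "a \<in> L2" and bm: "b \<in> L2" unfolding a_def b_def by (intro L2_diff v_L2 zm st t)+
  define \<Psi> where "\<Psi> = (\<lambda>y. b y + a y)"
  have \<Psi>m: "\<Psi> \<in> L2" unfolding \<Psi>_def by (intro L2_add am bm)
  have "L2_inner a a - L2_inner b b = L2_inner a \<Psi> - L2_inner b \<Psi>"
    unfolding \<Psi>_def L2_inner_add_right[OF bm am am] L2_inner_add_right[OF bm am bm]
    by (simp add: L2_inner_commute[of a b])
  also have "\<dots> = L2_inner (v t) \<Psi> - L2_inner (v s) \<Psi>"
    unfolding a_def b_def L2_inner_diff_left[OF v_L2[OF t] zm \<Psi>m] L2_inner_diff_left[OF v_L2[OF st(1)] zm \<Psi>m] by simp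
  also have "L2_inner (v t) \<Psi> = L2_inner (v t) (\<lambda>y. integral {0..y} \<psi>)"
    by (rule L2_inner_cong) (auto simp: I\<psi> \<Psi>_def a_def b_def)
  also have "L2_inner (v s) \<Psi> = L2_inner (v s) (\<lambda>y. integral {0..y} \<psi>)"
    by (rule L2_inner_cong) (auto simp: I\<psi> \<Psi>_def a_def b_def)
  finally have "\<rho> * L2_inner a a - \<rho> * L2_inner b b
      = \<rho> * (L2_inner (v t) (\<lambda>y. integral {0..y} \<psi>) - L2_inner (v s) (\<lambda>y. integral {0..y} \<psi>))"
    by (simp add: right_diff_distrib[symmetric])
  also have "\<dots> = - integral {s..t} (\<lambda>r. L2_inner (w r) \<psi>)"
    using momentum[OF st \<psi>m mean] unfolding v_def[abs_def] w_def[abs_def] .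
  also have "\<dots> = integral {s..t} (\<lambda>r. - L2_inner (w r) \<psi>)"
    by simp
  also have "\<dots> = integral {s..t} (\<lambda>r. - L2_inner (w r) (\<lambda>y. p s y - q y) + - L2_inner (w r) (\<lambda>y. p t y - q y))"
  proof (rule integral_cong)
    fix r assume "r \<in> {s..t}"
    then have "L2_inner (w r) \<psi> = L2_inner (w r) (\<lambda>y. p s y - q y) + L2_inner (w r) (\<lambda>y. p t y - q y)"
      unfolding \<psi>_def using st t q by (intro L2_inner_add_right L2_diff pm wm) auto
    then show "- L2_inner (w r) \<psi> = - L2_inner (w r) (\<lambda>y. p s y - q y) + - L2_inner (w r) (\<lambda>y. p t y - q y)" by simp
  qed
  finally show "\<rho> * L2_inner (\<lambda>y. v t y - integral {0..y} q) (\<lambda>y. v t y - integral {0..y} q)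
      - \<rho> * L2_inner (\<lambda>y. v s y - integral {0..y} q) (\<lambda>y. v s y - integral {0..y} q)
      = integral {s..t} (\<lambda>r. - L2_inner (w r) (\<lambda>y. p s y - q y) + - L2_inner (w r) (\<lambda>y. p t y - q y))"
    unfolding a_def b_def z_def .
qed

lemma Q_eq:
  assumes "small \<delta> T" "\<delta> \<le> ts" "t \<in> {0..T}" "y \<in> Omega"
  shows "Q t y = (fs + \<phi> t y)\<^sup>2 * (\<xi> * \<sigma> t y - \<nu> * \<phi> t y)"
proof -
  have "\<bar>\<sigma> t y\<bar> \<le> ts" using assms unfolding small_def by force
  then have "\<bar>ts + \<sigma> t y\<bar> = ts + \<sigma> t y" by linarith
  then have "Q t y = (fs + \<phi> t y)\<^sup>2 * ((\<xi> * ts - 1) + \<xi> * \<sigma> t y - \<nu> * (fs + \<phi> t y))"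
    unfolding Q_def by (simp add: power3_eq_cube power2_eq_square algebra_simps)
  then show ?thesis unfolding balance by (simp add: algebra_simps)
qed

lemma E0_identity:
  assumes ab: "0 \<le> a" "a \<le> b"
  shows "E0 b - E0 a = integral {a..b} (\<lambda>r. - L2_inner (w r) (p r) + lam / G * L2_inner (S r) (\<sigma> r) + k * L2_inner (Q r) (\<phi> r))"
proof -
  have int: "(\<lambda>r. L2_inner (U r) (V r)) integrable_on {a..b}" if "L2_continuous U" "L2_continuous V" for U V
    using ab by (intro integrable_continuous_real continuous_on_subset[OF inner_continuous[OF that]]) auto
  note ints = int[OF wL2 p] int[OF SL2 \<sigma>L2] int[OF QL2 \<phi>L2]
  have 1: "\<rho> * L2_inner (v b) (v b) - \<rho> * L2_inner (v a) (v a) = - (2 * integral {a..b} (\<lambda>r. L2_inner (w r) (p r)))"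
    using velocity_energy_identity[of "\<lambda>y. 0" a b] ab by simp
  have 2: "L2_inner (\<sigma> b) (\<sigma> b) - L2_inner (\<sigma> a) (\<sigma> a) = 2 * integral {a..b} (\<lambda>r. L2_inner (S r) (\<sigma> r))"
    using weak_energy_identity[OF \<sigma>L2 SL2 _ ab] stress unfolding S_def[abs_def] by simp
  have 3: "L2_inner (\<phi> b) (\<phi> b) - L2_inner (\<phi> a) (\<phi> a) = 2 * integral {a..b} (\<lambda>r. L2_inner (Q r) (\<phi> r))"
    using weak_energy_identity[OF \<phi>L2 QL2 _ ab] fluidity unfolding Q_def[abs_def] by simp
  have "E0 b - E0 a = 1 / 2 * (\<rho> * L2_inner (v b) (v b) - \<rho> * L2_inner (v a) (v a))
      + lam / (2 * G) * (L2_inner (\<sigma> b) (\<sigma> b) - L2_inner (\<sigma> a) (\<sigma> a))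
      + k / 2 * (L2_inner (\<phi> b) (\<phi> b) - L2_inner (\<phi> a) (\<phi> a))"
    unfolding E0_def by (simp add: algebra_simps)
  also have "\<dots> = - integral {a..b} (\<lambda>r. L2_inner (w r) (p r)) + lam / G * integral {a..b} (\<lambda>r. L2_inner (S r) (\<sigma> r))
      + k * integral {a..b} (\<lambda>r. L2_inner (Q r) (\<phi> r))"
    unfolding 1 2 3 by simp
  also have "\<dots> = integral {a..b} (\<lambda>r. - L2_inner (w r) (p r) + lam / G * L2_inner (S r) (\<sigma> r) + k * L2_inner (Q r) (\<phi> r))"
    by (rule integral_unique[symmetric])
       (intro has_integral_add has_integral_neg has_integral_mult_right integrable_integral ints)
  finally show ?thesis .
qed

text \<open>
  The mixed terms \<open>\<langle>\<sigma>, p\<rangle>\<close> from the momentum and the stress law cancel, and the terms without \<open>p\<close> form, at each point, the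
  quadratic form of \<open>damping_form\<close>.
\<close>
lemma E0_dissipation:
  assumes sm: "small \<delta> T" "\<delta> \<le> ts" and c: "0 < c"
    and damp: "\<And>x z. \<bar>z\<bar> \<le> \<delta> \<Longrightarrow> - (1 / G) * (fs + z) * x\<^sup>2 + (k * \<xi>) * ((fs + z)\<^sup>2 - fs\<^sup>2) * x * z - (k * \<nu>) * (fs + z)\<^sup>2 * z\<^sup>2 \<le> - c * (x\<^sup>2 + z\<^sup>2)"
    and ab: "0 \<le> a" "a \<le> b" "b \<le> T"
  shows "E0 b - E0 a \<le> - min \<eta> c * integral {a..b} D"
proof -
  have "E0 b - E0 a \<le> integral {a..b} (\<lambda>r. - min \<eta> c * D r)"
    unfolding E0_identity[OF ab(1,2)]
  proof (rule integral_le)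
    show "(\<lambda>r. - L2_inner (w r) (p r) + lam / G * L2_inner (S r) (\<sigma> r) + k * L2_inner (Q r) (\<phi> r)) integrable_on {a..b}"
      by (intro integrable_continuous_real continuous_on_add continuous_on_minus continuous_on_mult continuous_on_const
          continuous_on_subset[OF inner_continuous] wL2 p SL2 \<sigma>L2 QL2 \<phi>L2) (use ab in auto)
    show "(\<lambda>r. - min \<eta> c * D r) integrable_on {a..b}"
      by (intro integrable_continuous_real continuous_on_mult continuous_on_const continuous_on_subset[OF D_continuous])
         (use ab in auto)
    fix r assume r: "r \<in> {a..b}"
    then have r0: "0 \<le> r" and rT: "r \<in> {0..T}" using ab by auto
    define N where "N y = (fs + \<phi> r y) * \<sigma> r y + ts * \<phi> r y" for y
    have Nm: "N \<in> L2" unfolding N_def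
      by (rule L2_continuousD[OF L2_continuous_if_jointly_continuous[OF nonlinear_part_continuous] r0])
    note mem = pm[OF r0] \<sigma>m[OF r0] \<phi>m[OF r0] Qm[OF r0]
    have "L2_inner (w r) (p r) = \<eta> * L2_inner (p r) (p r) + L2_inner (\<sigma> r) (p r)"
      unfolding w_def[abs_def] L2_inner_add_left[OF L2_scale[OF mem(1)] mem(2,1)] L2_inner_scale_left ..
    moreover have "lam / G * L2_inner (S r) (\<sigma> r) = L2_inner (p r) (\<sigma> r) - 1 / G * L2_inner N (\<sigma> r)"
      unfolding S_def[abs_def] L2_inner_scale_left
        N_def[symmetric] L2_inner_diff_left[OF L2_scale[OF mem(1)] Nm mem(2)] using pos by (simp add: field_simps)
    moreover have "- (1 / G) * L2_inner N (\<sigma> r) + k * L2_inner (Q r) (\<phi> r) \<le> - c * (L2_inner (\<sigma> r) (\<sigma> r) + L2_inner (\<phi> r) (\<phi> r))"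
    proof -
      have "- (1 / G) * L2_inner N (\<sigma> r) + k * L2_inner (Q r) (\<phi> r)
          = (LINT y|lebesgue_on Omega. - (1 / G) * (N y * \<sigma> r y) + k * (Q r y * \<phi> r y))"
        unfolding L2_inner_def using mem Nm by (simp add: L2_mult_integrable)
      also have "\<dots> \<le> (LINT y|lebesgue_on Omega. - c * (\<sigma> r y * \<sigma> r y + \<phi> r y * \<phi> r y))"
      proof (rule integral_mono)
        show "integrable (lebesgue_on Omega) (\<lambda>y. - (1 / G) * (N y * \<sigma> r y) + k * (Q r y * \<phi> r y))"
          using mem Nm by (intro Bochner_Integration.integrable_add integrable_mult_right L2_mult_integrable)
        show "integrable (lebesgue_on Omega) (\<lambda>y. - c * (\<sigma> r y * \<sigma> r y + \<phi> r y * \<phi> r y))"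
          using mem by (intro Bochner_Integration.integrable_add integrable_mult_right L2_mult_integrable)
        fix y assume "y \<in> space (lebesgue_on Omega)"
        then have y: "y \<in> Omega" by simp
        define x z where "x = \<sigma> r y" and "z = \<phi> r y"
        have z: "\<bar>z\<bar> \<le> \<delta>" using sm(1) rT y unfolding small_def z_def by blast
        have kts: "k * \<xi> * fs\<^sup>2 = ts / G" using pos by (simp add: k_def)
        have "- (1 / G) * (((fs + z) * x + ts * z) * x) + k * ((fs + z)\<^sup>2 * (\<xi> * x - \<nu> * z) * z)
            = - (1 / G) * (fs + z) * x\<^sup>2 + ((k * \<xi>) * (fs + z)\<^sup>2 - ts / G) * x * z - (k * \<nu>) * (fs + z)\<^sup>2 * z\<^sup>2"
          by (simp add: power2_eq_square algebra_simps add_divide_distrib)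
        also have "\<dots> = - (1 / G) * (fs + z) * x\<^sup>2 + (k * \<xi>) * ((fs + z)\<^sup>2 - fs\<^sup>2) * x * z - (k * \<nu>) * (fs + z)\<^sup>2 * z\<^sup>2"
          unfolding kts[symmetric] by (simp add: algebra_simps)
        also have "\<dots> \<le> - c * (x\<^sup>2 + z\<^sup>2)" by (rule damp[OF z])
        finally show "- (1 / G) * (N y * \<sigma> r y) + k * (Q r y * \<phi> r y) \<le> - c * (\<sigma> r y * \<sigma> r y + \<phi> r y * \<phi> r y)"
          unfolding N_def Q_eq[OF sm rT y] x_def z_def by (simp add: power2_eq_square)
      qed
      also have "\<dots> = - c * (L2_inner (\<sigma> r) (\<sigma> r) + L2_inner (\<phi> r) (\<phi> r))"
        unfolding L2_inner_def using mem by (simp add: L2_mult_integrable)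
      finally show ?thesis .
    qed
    moreover have "L2_inner (\<sigma> r) (p r) = L2_inner (p r) (\<sigma> r)" by (rule L2_inner_commute)
    ultimately have "- L2_inner (w r) (p r) + lam / G * L2_inner (S r) (\<sigma> r) + k * L2_inner (Q r) (\<phi> r)
        \<le> - (\<eta> * L2_inner (p r) (p r)) - c * (L2_inner (\<sigma> r) (\<sigma> r) + L2_inner (\<phi> r) (\<phi> r))" by linarith
    also have "\<dots> \<le> - (min \<eta> c * L2_inner (p r) (p r)) - min \<eta> c * (L2_inner (\<sigma> r) (\<sigma> r) + L2_inner (\<phi> r) (\<phi> r))"
      by (intro diff_mono iffD2[OF neg_le_iff_le] mult_right_mono) (auto simp: L2_norm_square[symmetric])
    also have "\<dots> = - min \<eta> c * D r" unfolding D_def by (simp add: algebra_simps)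
    finally show "- L2_inner (w r) (p r) + lam / G * L2_inner (S r) (\<sigma> r) + k * L2_inner (Q r) (\<phi> r) \<le> - min \<eta> c * D r" .
  qed
  then show ?thesis by simp
qed

text \<open>
  Test the stress law with the increment itself.
\<close>
lemma stress_increment:
  assumes st: "0 \<le> s" "s \<le> t"
  shows "L2_norm (\<lambda>y. \<sigma> t y - \<sigma> s y) \<le> integral {s..t} (\<lambda>r. L2_norm (S r))"
proof -
  have t: "0 \<le> t" using st by simp
  define h where "h = (\<lambda>y. \<sigma> t y - \<sigma> s y)"
  have hm: "h \<in> L2" unfolding h_def by (intro L2_diff \<sigma>m st t)
  have cS: "continuous_on {s..t} (\<lambda>r. L2_norm (S r))"
    by (rule continuous_on_subset[OF L2_continuous_norm[OF SL2]]) (use st in auto)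
  have nn: "0 \<le> integral {s..t} (\<lambda>r. L2_norm (S r))"
    by (intro integral_nonneg integrable_continuous_real cS) simp
  have "L2_norm h * L2_norm h = L2_inner (\<sigma> t) h - L2_inner (\<sigma> s) h"
    using L2_norm_square[of h] L2_inner_diff_left[OF \<sigma>m[OF t] \<sigma>m[OF st(1)] hm]
    unfolding h_def[symmetric] by (simp add: power2_eq_square)
  also have "\<dots> = integral {s..t} (\<lambda>r. L2_inner (S r) h)"
    using stress[OF st hm] unfolding S_def[abs_def] .
  also have "\<dots> \<le> integral {s..t} (\<lambda>r. L2_norm (S r) * L2_norm h)"
  proof (rule integral_le)
    show "(\<lambda>r. L2_inner (S r) h) integrable_on {s..t}"
      by (intro integrable_continuous_real continuous_on_subset[OF inner_continuous[OF SL2 L2_continuous_constant[OF hm]]])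
         (use st in auto)
    show "(\<lambda>r. L2_norm (S r) * L2_norm h) integrable_on {s..t}"
      by (intro integrable_continuous_real continuous_on_mult cS continuous_on_const)
    show "L2_inner (S r) h \<le> L2_norm (S r) * L2_norm h" if "r \<in> {s..t}" for r
      using L2_Cauchy_Schwarz[OF Sm hm, of r] that st by auto
  qed
  also have "\<dots> = integral {s..t} (\<lambda>r. L2_norm (S r)) * L2_norm h" by simp
  finally have le: "L2_norm h * L2_norm h \<le> integral {s..t} (\<lambda>r. L2_norm (S r)) * L2_norm h" .
  show ?thesis
  proof (cases "L2_norm h = 0")
    case True
    then show ?thesis using nn unfolding h_def by simp
  next
    case False
    then have "0 < L2_norm h" using L2_norm_nonneg[of h] by linarith
    from mult_right_le_imp_le[OF le this] show ?thesis unfolding h_def .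
  qed
qed

text \<open>
  By convexity \<open>\<parallel>w r\<parallel>\<^sup>2/2 - \<parallel>w s\<parallel>\<^sup>2/2 \<le> \<langle>w r, w r - w s\<rangle>\<close>, and \<open>w r - w s\<close> is \<open>\<eta> (p r - p s)\<close> plus a stress increment. The
  integral over \<open>r\<close> of \<open>\<langle>w r, p r - p s\<rangle>\<close> equals \<open>- \<rho> / 2 \<parallel>v t - v s\<parallel>\<^sup>2\<close> and can be dropped; the rest is bounded by
  \<open>stress_increment\<close> and handed to \<open>mean_increment_bound\<close>.
\<close>
lemma flux_energy_inequality:
  assumes ab: "0 \<le> a" "a \<le> b"
  shows "1 / 2 * L2_inner (w b) (w b) - 1 / 2 * L2_inner (w a) (w a) \<le> integral {a..b} (\<lambda>r. L2_norm (w r) * L2_norm (S r))"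
proof (rule mean_increment_bound[OF ab(2)])
  have sub: "continuous_on {a..b} f" if "continuous_on {0..} f" for f :: "real \<Rightarrow> real"
    by (rule continuous_on_subset[OF that]) (use ab in auto)
  show "continuous_on {a..b} (\<lambda>r. 1 / 2 * L2_inner (w r) (w r))"
    by (intro continuous_on_mult continuous_on_const sub inner_continuous wL2)
  show "continuous_on {a..b} (\<lambda>r. L2_norm (w r))" "continuous_on {a..b} (\<lambda>r. L2_norm (S r))"
    by (intro sub L2_continuous_norm wL2 SL2)+
  fix s t assume st: "a \<le> s" "s \<le> t" "t \<le> b"
  then have s0: "0 \<le> s" using ab by simp
  note ps = pm[OF s0] \<sigma>m[OF s0] wm[OF s0]
  have sub': "continuous_on {s..t} f" if "continuous_on {0..} f" for f :: "real \<Rightarrow> real"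
    by (rule continuous_on_subset[OF that]) (use s0 in auto)
  define e where "e r = L2_inner (w r) (\<lambda>y. p r y - p s y)" for r
  have ce: "continuous_on {s..t} e" unfolding e_def
    by (intro sub' inner_continuous wL2 L2_continuous_diff p L2_continuous_constant ps)
  have cI: "continuous_on {s..t} (\<lambda>r. integral {s..r} (\<lambda>r. L2_norm (S r)))"
    by (intro indefinite_integral_continuous_1 integrable_continuous_real sub' L2_continuous_norm SL2)
  have neg: "integral {s..t} e \<le> 0"
  proof -
    have zero: "L2_inner (\<lambda>y. 0) (\<lambda>y. 0) = 0" by (simp add: L2_inner_def)
    have "(\<lambda>y. v s y - integral {0..y} (p s)) = (\<lambda>y. 0)" by (simp add: v_def)
    then have "\<rho> * L2_inner (\<lambda>y. v t y - integral {0..y} (p s)) (\<lambda>y. v t y - integral {0..y} (p s)) = - (2 * integral {s..t} e)"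
      using velocity_energy_identity[OF ps(1) p_mean[OF s0] s0 st(2)] by (simp add: zero e_def[abs_def])
    moreover have "0 \<le> \<rho> * L2_inner (\<lambda>y. v t y - integral {0..y} (p s)) (\<lambda>y. v t y - integral {0..y} (p s))"
      using pos unfolding L2_norm_square[symmetric] by simp
    ultimately show ?thesis by simp
  qed
  have "integral {s..t} (\<lambda>r. 1 / 2 * L2_inner (w r) (w r) - 1 / 2 * L2_inner (w s) (w s))
     \<le> integral {s..t} (\<lambda>r. \<eta> * e r + L2_norm (w r) * integral {s..r} (\<lambda>r. L2_norm (S r)))"
  proof (rule integral_le)
    show "(\<lambda>r. 1 / 2 * L2_inner (w r) (w r) - 1 / 2 * L2_inner (w s) (w s)) integrable_on {s..t}"
      by (intro integrable_continuous_real continuous_on_diff continuous_on_mult continuous_on_const sub' inner_continuous wL2)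
    show "(\<lambda>r. \<eta> * e r + L2_norm (w r) * integral {s..r} (\<lambda>r. L2_norm (S r))) integrable_on {s..t}"
      by (intro integrable_continuous_real continuous_on_add continuous_on_mult continuous_on_const ce cI sub' L2_continuous_norm wL2)
    fix r assume r: "r \<in> {s..t}"
    then have r0: "0 \<le> r" and sr: "s \<le> r" using s0 by auto
    note mem = wm[OF r0] pm[OF r0] \<sigma>m[OF r0]
    have "L2_inner (w r) (w r) - L2_inner (w r) (w s) = L2_inner (w r) (\<lambda>y. \<eta> * (p r y - p s y) + (\<sigma> r y - \<sigma> s y))"
      unfolding L2_inner_diff_right[OF mem(1) ps(3) mem(1), symmetric]
      by (rule L2_inner_cong) (auto simp: w_def algebra_simps)
    also have "\<dots> = \<eta> * e r + L2_inner (w r) (\<lambda>y. \<sigma> r y - \<sigma> s y)"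
      unfolding e_def L2_inner_add_right[OF L2_scale[OF L2_diff[OF mem(2) ps(1)]] L2_diff[OF mem(3) ps(2)] mem(1)]
        L2_inner_scale_right ..
    finally have eq: "L2_inner (w r) (w r) - L2_inner (w r) (w s) = \<eta> * e r + L2_inner (w r) (\<lambda>y. \<sigma> r y - \<sigma> s y)" .
    have "L2_norm (w r) * L2_norm (\<lambda>y. \<sigma> r y - \<sigma> s y) \<le> L2_norm (w r) * integral {s..r} (\<lambda>r. L2_norm (S r))"
      by (intro mult_left_mono stress_increment s0 sr) simp
    then have 1: "L2_inner (w r) (w r) - L2_inner (w r) (w s) \<le> \<eta> * e r + L2_norm (w r) * integral {s..r} (\<lambda>r. L2_norm (S r))"
      using eq L2_Cauchy_Schwarz[OF mem(1) L2_diff[OF mem(3) ps(2)]] by linarith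
    have "L2_inner (w r) (w s) \<le> L2_norm (w r) * L2_norm (w s)"
      using L2_Cauchy_Schwarz[OF mem(1) ps(3)] by linarith
    moreover have "2 * (L2_norm (w r) * L2_norm (w s)) \<le> L2_inner (w r) (w r) + L2_inner (w s) (w s)"
      unfolding L2_norm_square[symmetric] using sum_squares_bound[of "L2_norm (w r)" "L2_norm (w s)"] by (simp add: mult.assoc)
    ultimately show "1 / 2 * L2_inner (w r) (w r) - 1 / 2 * L2_inner (w s) (w s)
        \<le> \<eta> * e r + L2_norm (w r) * integral {s..r} (\<lambda>r. L2_norm (S r))"
      using 1 by linarith
  qed
  also have "\<dots> = \<eta> * integral {s..t} e + integral {s..t} (\<lambda>r. L2_norm (w r) * integral {s..r} (\<lambda>r. L2_norm (S r)))"
    by (rule integral_unique)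
       (intro has_integral_add has_integral_mult_right integrable_integral integrable_continuous_real ce
          continuous_on_mult cI sub' L2_continuous_norm wL2)
  also have "\<dots> \<le> integral {s..t} (\<lambda>r. L2_norm (w r) * integral {s..r} (\<lambda>r. L2_norm (S r)))"
    using neg pos by (simp add: mult_nonneg_nonpos)
  finally show "integral {s..t} (\<lambda>r. 1 / 2 * L2_inner (w r) (w r) - 1 / 2 * L2_inner (w s) (w s))
     \<le> integral {s..t} (\<lambda>r. L2_norm (w r) * integral {s..r} (\<lambda>r. L2_norm (S r)))" .
qed

lemma L2_norm_w_le: assumes t: "0 \<le> t" shows "L2_norm (w t) \<le> (\<eta> + 1) * sqrt (D t)"
proof -
  have "L2_norm (w t) \<le> \<eta> * L2_norm (p t) + L2_norm (\<sigma> t)"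
    using L2_norm_triangle[OF L2_scale[OF pm[OF t], of \<eta>] \<sigma>m[OF t]] pos unfolding w_def[abs_def] L2_norm_scale by simp
  also have "\<dots> \<le> \<eta> * sqrt (D t) + sqrt (D t)"
    using pos by (intro add_mono mult_left_mono norms_le_sqrt_D) auto
  finally show ?thesis by (simp add: algebra_simps)
qed

lemma L2_norm_S_le:
  assumes sm: "small \<delta> T" "\<delta> \<le> fs" and t: "t \<in> {0..T}"
  shows "L2_norm (S t) \<le> (G + 2 * fs + ts) / lam * sqrt (D t)"
proof -
  have t0: "0 \<le> t" using t by simp
  note mem = pm[OF t0] \<sigma>m[OF t0] \<phi>m[OF t0]
  note c = jointly_continuous_slices(1)[OF \<sigma> t0] jointly_continuous_slices(1)[OF \<phi> t0]
  have fm: "(\<lambda>y. (fs + \<phi> t y) * \<sigma> t y) \<in> L2"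
    by (intro L2_continuous_function continuous_intros c)
  have "L2_norm (\<lambda>y. (fs + \<phi> t y) * \<sigma> t y) \<le> (2 * fs) * L2_norm (\<sigma> t)"
  proof (rule L2_norm_mult_le[OF mem(2) fm])
    show "\<bar>fs + \<phi> t y\<bar> \<le> 2 * fs" if "y \<in> Omega" for y
    proof -
      have "\<bar>\<phi> t y\<bar> \<le> \<delta>" using sm(1) t that unfolding small_def by blast
      then show ?thesis using sm(2) pos by linarith
    qed
  qed (use pos in simp)
  also have "\<dots> \<le> (2 * fs) * sqrt (D t)" using pos by (intro mult_left_mono norms_le_sqrt_D) auto
  finally have 1: "L2_norm (\<lambda>y. (fs + \<phi> t y) * \<sigma> t y) \<le> 2 * fs * sqrt (D t)" .
  have 2: "L2_norm (\<lambda>y. ts * \<phi> t y) \<le> ts * sqrt (D t)"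
    unfolding L2_norm_scale using pos by (simp add: mult_left_mono norms_le_sqrt_D)
  have 3: "L2_norm (\<lambda>y. G * p t y) \<le> G * sqrt (D t)"
    unfolding L2_norm_scale using pos by (simp add: mult_left_mono norms_le_sqrt_D)
  have "L2_norm (S t) = 1 / lam * L2_norm (\<lambda>y. G * p t y - ((fs + \<phi> t y) * \<sigma> t y + ts * \<phi> t y))"
    unfolding S_def[abs_def] L2_norm_scale using pos by simp
  also have "\<dots> \<le> 1 / lam * (L2_norm (\<lambda>y. G * p t y) + (L2_norm (\<lambda>y. (fs + \<phi> t y) * \<sigma> t y) + L2_norm (\<lambda>y. ts * \<phi> t y)))"
    using pos L2_norm_triangle_diff[OF L2_scale[OF mem(1), of G] L2_add[OF fm L2_scale[OF mem(3), of ts]]]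
      L2_norm_triangle[OF fm L2_scale[OF mem(3), of ts]] by (intro mult_left_mono) auto
  also have "\<dots> \<le> 1 / lam * (G * sqrt (D t) + (2 * fs * sqrt (D t) + ts * sqrt (D t)))"
    using pos by (intro mult_left_mono add_mono 1 2 3) auto
  finally show ?thesis by (simp add: algebra_simps add_divide_distrib)
qed

section \<open>A variable that evolves pointwise\<close>

text \<open>
  The primitive of the velocity with mean value zero. It is bounded pointwise by the energy, and its time derivative is the
  total stress minus its mean, up to the factor \<open>\<rho>\<close>.
\<close>
definition P :: "real \<Rightarrow> real \<Rightarrow> real" where
  "P t y = integral {0..y} (v t) - integral Omega (\<lambda>x. integral {0..x} (v t))"
definition m :: "real \<Rightarrow> real" where "m t = integral Omega (\<sigma> t)"
text \<open>
  The multiple of \<open>P\<close> is chosen so that the velocity gradient drops out of the time derivative \<open>RZ\<close>.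
\<close>
definition Z :: "real \<Rightarrow> real \<Rightarrow> real" where "Z t y = lam * \<sigma> t y - (G * \<rho> / \<eta>) * P t y"
definition RZ :: "real \<Rightarrow> real \<Rightarrow> real" where
  "RZ t y = - ((fs + \<phi> t y) * \<sigma> t y + ts * \<phi> t y) - (G / \<eta>) * (\<sigma> t y - m t)"

lemma P_continuous: "0 \<le> t \<Longrightarrow> continuous_on Omega (P t)"
  unfolding P_def
  by (intro continuous_on_diff continuous_on_const indefinite_integral_continuous_1 L2_imp_integrable_on v_L2) auto

lemma P_bound:
  assumes t: "0 \<le> t" and y: "y \<in> Omega" shows "\<bar>P t y\<bar> \<le> 2 * sqrt (D t)"
proof -
  have b: "\<bar>integral {0..x} (v t)\<bar> \<le> L2_norm (v t)" if "x \<in> Omega" for x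
    using that by (intro abs_integral_le_L2_norm v_L2 t) auto
  have c: "continuous_on Omega (\<lambda>x. integral {0..x} (v t))"
    by (intro indefinite_integral_continuous_1 L2_imp_integrable_on v_L2 t) auto
  have "\<bar>integral Omega (\<lambda>x. integral {0..x} (v t))\<bar> \<le> L2_norm (\<lambda>x. integral {0..x} (v t))"
    by (intro abs_integral_le_L2_norm L2_continuous_function c) auto
  also have "\<dots> \<le> L2_norm (v t)"
    by (rule L2_norm_le_sup[OF L2_continuous_function[OF c]]) (use b in auto)
  finally have "\<bar>P t y\<bar> \<le> 2 * L2_norm (v t)"
    using b[OF y] unfolding P_def by linarith
  also have "\<dots> \<le> 2 * sqrt (D t)" using v_le_p[OF t] norms_le_sqrt_D(1)[of t] by simp
  finally show ?thesis .
qed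

text \<open>
  Since \<open>P\<close> has mean zero, \<open>h\<close> may be replaced by its deviation from the mean, whose primitive vanishes at both ends and is
  thus admissible in the momentum law.
\<close>
lemma P_weak:
  assumes t: "0 \<le> t" and h: "continuous_on Omega h"
  shows "L2_inner (P t) h = - L2_inner (v t) (\<lambda>y. integral {0..y} (\<lambda>x. h x - integral Omega h))"
proof -
  define c where "c = integral Omega h"
  have hi: "h integrable_on Omega" by (rule integrable_continuous_real[OF h])
  have ch: "continuous_on Omega (\<lambda>x. h x - c)" by (intro continuous_on_diff h continuous_on_const)
  note mem = L2_continuous_function[OF P_continuous[OF t]] L2_continuous_function[OF h] L2_continuous_function[OF ch]
  have mean: "integral Omega (\<lambda>x. h x - c) = 0"
    by (subst Henstock_Kurzweil_Integration.integral_diff) (auto intro: hi simp: c_def)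
  have Pmean: "L2_inner (P t) (\<lambda>y. c) = 0"
  proof -
    have i: "(\<lambda>x. integral {0..x} (v t)) integrable_on Omega"
      by (intro integrable_continuous_real indefinite_integral_continuous_1 L2_imp_integrable_on v_L2 t) auto
    have "integral Omega (P t) = 0"
      unfolding P_def by (subst Henstock_Kurzweil_Integration.integral_diff) (auto intro: i)
    then show ?thesis by (subst L2_inner_eq_integral[OF mem(1) L2_const]) simp
  qed
  have "L2_inner (P t) h = L2_inner (P t) (\<lambda>x. h x - c)"
    using L2_inner_diff_right[OF mem(2) L2_const mem(1), of c] Pmean by simp
  also have "\<dots> = P t 1 * integral {0..1} (\<lambda>x. h x - c) - P t 0 * integral {0..0} (\<lambda>x. h x - c)
      - (LINT y|lebesgue_on Omega. v t y * integral {0..y} (\<lambda>x. h x - c))"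
    unfolding L2_inner_def
    by (rule integral_by_parts_absolutely_continuous) (auto intro!: L2_integrable v_L2 t mem simp: P_def)
  finally show ?thesis unfolding L2_inner_def c_def[symmetric] using mean by simp
qed

text \<open>
  The mean of \<open>w\<close> equals that of \<open>\<sigma>\<close> because \<open>p\<close> has mean zero.
\<close>
lemma Z_weak:
  assumes st: "0 \<le> s" "s \<le> t" and h: "continuous_on Omega h"
  shows "L2_inner (Z t) h - L2_inner (Z s) h = integral {s..t} (\<lambda>r. L2_inner (RZ r) h)"
proof -
  have t: "0 \<le> t" using st by simp
  define c where "c = integral Omega h"
  define g where "g x = h x - c" for x
  have cg: "continuous_on Omega g" unfolding g_def by (intro continuous_on_diff h continuous_on_const)
  have hm: "h \<in> L2" and gm: "g \<in> L2" by (intro L2_continuous_function h cg)+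
  have mean: "integral Omega g = 0"
    unfolding g_def by (subst Henstock_Kurzweil_Integration.integral_diff)
      (auto intro: integrable_continuous_real[OF h] simp: c_def)
  have Zh: "L2_inner (Z q) h = lam * L2_inner (\<sigma> q) h + (G / \<eta>) * (\<rho> * L2_inner (v q) (\<lambda>y. integral {0..y} g))"
    if q: "0 \<le> q" for q
  proof -
    have "L2_inner (Z q) h = lam * L2_inner (\<sigma> q) h - G * \<rho> / \<eta> * L2_inner (P q) h"
      unfolding Z_def[abs_def] L2_inner_diff_left[OF L2_scale[OF \<sigma>m[OF q]] L2_scale[OF L2_continuous_function[OF P_continuous[OF q]]] hm]
        L2_inner_scale_left ..
    then show ?thesis unfolding P_weak[OF q h] g_def[abs_def] c_def by simp
  qed
  have ints: "(\<lambda>r. L2_inner (S r) h) integrable_on {s..t}" "(\<lambda>r. L2_inner (w r) g) integrable_on {s..t}"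
    by (intro integrable_continuous_real continuous_on_subset[OF inner_continuous] SL2 wL2 L2_continuous_constant hm gm,
        use st in auto)+
  have "L2_inner (Z t) h - L2_inner (Z s) h = lam * (L2_inner (\<sigma> t) h - L2_inner (\<sigma> s) h)
      + (G / \<eta>) * (\<rho> * (L2_inner (v t) (\<lambda>y. integral {0..y} g) - L2_inner (v s) (\<lambda>y. integral {0..y} g)))"
    unfolding Zh[OF t] Zh[OF st(1)] by (simp only: right_diff_distrib)
  also have "\<dots> = lam * integral {s..t} (\<lambda>r. L2_inner (S r) h) + (G / \<eta>) * (- integral {s..t} (\<lambda>r. L2_inner (w r) g))"
    using stress[OF st hm] momentum[OF st gm mean] unfolding S_def[abs_def] w_def[abs_def] v_def[abs_def] by simp
  also have "\<dots> = integral {s..t} (\<lambda>r. lam * L2_inner (S r) h + (G / \<eta>) * (- L2_inner (w r) g))"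
    by (rule integral_unique[symmetric])
       (intro has_integral_add has_integral_mult_right has_integral_neg integrable_integral ints)
  also have "\<dots> = integral {s..t} (\<lambda>r. L2_inner (RZ r) h)"
  proof (rule integral_cong)
    fix r assume "r \<in> {s..t}"
    then have r: "0 \<le> r" using st by simp
    note mem = Sm[OF r] wm[OF r] pm[OF r] \<sigma>m[OF r]
    have w1: "L2_inner (w r) (\<lambda>y. c) = m r * c"
    proof -
      have "L2_inner (w r) (\<lambda>y. c) = \<eta> * L2_inner (p r) (\<lambda>y. c) + L2_inner (\<sigma> r) (\<lambda>y. c)"
        unfolding w_def[abs_def] L2_inner_add_left[OF L2_scale[OF mem(3)] mem(4) L2_const] L2_inner_scale_left ..
      then show ?thesis
        using p_mean[OF r] by (simp add: L2_inner_eq_integral mem m_def)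
    qed
    have m1: "L2_inner (\<lambda>y. m r) h = m r * c"
      by (subst L2_inner_eq_integral[OF L2_const hm]) (simp add: c_def)
    have "L2_inner (RZ r) h = L2_inner (\<lambda>y. (lam * S r y - (G / \<eta>) * w r y) + (G / \<eta>) * m r) h"
      using pos by (intro L2_inner_cong) (auto simp: RZ_def S_def w_def algebra_simps add_divide_distrib diff_divide_distrib)
    also have "\<dots> = lam * L2_inner (S r) h - (G / \<eta>) * L2_inner (w r) h + (G / \<eta>) * L2_inner (\<lambda>y. m r) h"
      unfolding L2_inner_add_left[OF L2_diff[OF L2_scale[OF mem(1)] L2_scale[OF mem(2)]] L2_const hm]
        L2_inner_diff_left[OF L2_scale[OF mem(1)] L2_scale[OF mem(2)] hm] L2_inner_scale_left ..
    finally have RZ: "L2_inner (RZ r) h = lam * L2_inner (S r) h - (G / \<eta>) * L2_inner (w r) h + (G / \<eta>) * (m r * c)"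
      unfolding m1 .
    have wg: "L2_inner (w r) h = L2_inner (w r) g + m r * c"
      using L2_inner_diff_right[OF hm L2_const mem(2), of c] w1 unfolding g_def[abs_def] by simp
    show "lam * L2_inner (S r) h + (G / \<eta>) * (- L2_inner (w r) g) = L2_inner (RZ r) h"
      unfolding RZ wg by (simp add: algebra_simps)
  qed
  finally show ?thesis .
qed

lemma m_continuous: "continuous_on {0..} m"
  using integral_continuous_on_param[of "{0..}" 0 1 \<sigma>, unfolded box_real, OF \<sigma>] unfolding m_def .

lemma m_bound: "0 \<le> t \<Longrightarrow> \<bar>m t\<bar> \<le> sqrt (D t)"
  unfolding m_def using abs_integral_le_L2_norm[OF \<sigma>m order_refl] norms_le_sqrt_D(2) by (rule order_trans)

lemma RZ_continuous: "continuous_on ({0..} \<times> Omega) (\<lambda>(t, y). RZ t y)"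
proof -
  have "continuous_on ({0..} \<times> Omega) (\<lambda>q :: real \<times> real. m (fst q))"
    by (rule continuous_on_compose2[OF m_continuous continuous_on_fst[OF continuous_on_id]]) auto
  then show ?thesis using \<sigma> \<phi> unfolding case_prod_beta RZ_def by (intro continuous_intros)
qed

lemma Z_pointwise:
  assumes "0 \<le> s" "s \<le> t" "y \<in> Omega" shows "Z t y - Z s y = integral {s..t} (\<lambda>r. RZ r y)"
proof (rule pointwise_if_weak_evolution[OF _ RZ_continuous _ assms])
  show "continuous_on Omega (Z t)" if "0 \<le> t" for t
    unfolding Z_def
    by (intro continuous_on_diff continuous_on_mult continuous_on_const P_continuous that jointly_continuous_slices(1)[OF \<sigma>])
qed (use Z_weak assms in blast)

lemma \<phi>_pointwise:
  assumes "0 \<le> s" "s \<le> t" "y \<in> Omega" shows "\<phi> t y - \<phi> s y = integral {s..t} (\<lambda>r. Q r y)"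
  by (rule pointwise_if_weak_evolution[OF jointly_continuous_slices(1)[OF \<phi>] Q_continuous _ assms])
     (use fluidity[OF assms(1,2) L2_continuous_function] Q_def[abs_def] in simp_all)

end

section \<open>The Lyapunov functional\<close>

text \<open>
  A threshold \<open>\<delta>\<close> below which both quadratic forms are negative definite: the first one governs the energy in \<open>L\<^sup>2\<close>, the
  second one the pointwise system for \<open>(Z, \<phi>)\<close>. The constants defined here depend on the coefficients, \<open>\<delta>\<close> and \<open>c\<close> only,
  which makes the final estimate uniform over all solutions.
\<close>
locale damped_coefficients = coefficients +
  fixes \<delta> c :: real
  assumes \<delta>: "0 < \<delta>" "\<delta> \<le> fs" "\<delta> \<le> ts" and c: "0 < c"
    and damping: "\<And>x z. \<bar>z\<bar> \<le> \<delta> \<Longrightarrow>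
      - (1 / G) * (fs + z) * x\<^sup>2 + (k * \<xi>) * ((fs + z)\<^sup>2 - fs\<^sup>2) * x * z - (k * \<nu>) * (fs + z)\<^sup>2 * z\<^sup>2 \<le> - c * (x\<^sup>2 + z\<^sup>2)"
    and damping': "\<And>x z. \<bar>z\<bar> \<le> \<delta> \<Longrightarrow>
      - (fs\<^sup>2 * \<xi> / lam / lam) * (fs + z) * x\<^sup>2 + (ts * \<xi> / lam) * ((fs + z)\<^sup>2 - fs\<^sup>2) * x * z - (ts * \<nu>) * (fs + z)\<^sup>2 * z\<^sup>2 \<le> - c * (x\<^sup>2 + z\<^sup>2)"
begin

text \<open>
  \<open>al\<close> and \<open>be\<close> are the weights of \<open>Z\<^sup>2\<close> and \<open>\<phi>\<^sup>2\<close> in the pointwise quadratic form; their ratio makes the mixed terms cancel at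
  equilibrium. \<open>b\<close> is the coefficient of \<open>P\<close> in \<open>Z\<close>.
\<close>
definition al where "al = fs\<^sup>2 * \<xi> / lam"
definition be where "be = ts"
definition b where "b = G * \<rho> / \<eta>"
text \<open>
  The remaining constants: \<open>K2\<close> bounds the growth of \<open>\<parallel>w\<parallel>\<^sup>2/2\<close> in terms of \<open>D\<close>; \<open>K3\<close> and \<open>K5\<close> compare the global energy with
  \<open>D\<close>; \<open>C1\<close> and \<open>C2\<close> bound the forcing of the pointwise system in terms of \<open>\<surd>D\<close>, and \<open>C6\<close> is the factor of \<open>D\<close> after
  Young's inequality; \<open>K6\<close> compares the pointwise form with \<open>Z\<^sup>2 + \<phi>\<^sup>2\<close>; \<open>K7\<close> bounds the Lyapunov functional initially, and
  \<open>K8\<close> bounds the perturbation by the functional.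
\<close>
definition K2 where "K2 = (\<eta> + 1) * ((G + 2 * fs + ts) / lam)"
text \<open>
  The weight of the \<open>L\<^sup>2\<close> energy: its dissipation then absorbs the growth \<open>K2 * D\<close> of \<open>\<parallel>w\<parallel>\<^sup>2/2\<close> and leaves \<open>D\<close>.
\<close>
definition A where "A = (K2 + 1) / min \<eta> c"
definition K3 where "K3 = A * (\<rho> / 2 + lam / (2 * G) + k / 2) + (\<eta> + 1)\<^sup>2 / 2"
definition K5 where "K5 = 4 / \<eta>\<^sup>2 + (2 / \<eta>\<^sup>2 + 1) * (2 * G / (lam * A)) + 2 / (k * A)"
definition C1 where "C1 = al * (4 * fs * b / lam + 2 * (G / \<eta>) * b / lam + G / \<eta>)"
definition C2 where "C2 = (be * \<xi> / lam) * (4 * fs\<^sup>2) * (2 * b)"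
definition C6 where "C6 = (C1\<^sup>2 + C2\<^sup>2) / (2 * c)"
text \<open>
  The weight of the global energy in the Lyapunov functional: it absorbs the forcing \<open>C6 * D\<close> of the pointwise system and
  leaves \<open>D\<close>.
\<close>
definition B where "B = C6 + 1"
definition K6 where "K6 = (al + be) / 2"
definition rate where "rate = min (c / (2 * K6)) (1 / (K3 * B))"
definition K7 where "K7 = K6 * (2 * lam\<^sup>2 + 24 * b\<^sup>2 + 1) + 3 * B * K3"
definition K8 where "K8 = (2 / lam\<^sup>2) * (2 / al + 4 * b\<^sup>2 * (K5 / B)) + 2 / be + K5 / B"

lemma constants_pos: "0 < al" "0 < be" "0 < b" "0 < K2" "0 < A" "0 < K3" "0 < K5" "0 < C1" "0 < C2" "0 < C6" "0 < B"
  "0 < K6" "0 < rate" "0 < K7" "0 < K8"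
proof -
  show 1: "0 < al" "0 < be" "0 < b" "0 < K2"
    using pos by (simp_all add: al_def be_def b_def K2_def add_pos_pos)
  show 2: "0 < A" using 1 pos c by (simp add: A_def add_pos_pos)
  show 3: "0 < K3" unfolding K3_def using 2 pos k_pos by (intro add_pos_pos mult_pos_pos divide_pos_pos) auto
  show 4: "0 < K5" unfolding K5_def using 2 pos k_pos by (intro add_pos_pos mult_pos_pos divide_pos_pos) auto
  show 5: "0 < C1" "0 < C2" unfolding C1_def C2_def using 1 pos by (intro add_pos_pos mult_pos_pos divide_pos_pos; simp)+
  show 6: "0 < C6" unfolding C6_def using 5 c by (intro divide_pos_pos add_pos_pos) auto
  then show 7: "0 < B" by (simp add: B_def)
  show 8: "0 < K6" using 1 by (simp add: K6_def)
  show "0 < rate" using 3 7 8 c by (simp add: rate_def)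
  have "0 < 2 * lam\<^sup>2 + 24 * b\<^sup>2 + 1" by (intro add_nonneg_pos add_nonneg_nonneg) auto
  from mult_pos_pos[OF 8 this] show "0 < K7" unfolding K7_def using 3 7 by (simp add: add_pos_pos)
  show "0 < K8" unfolding K8_def using 1 4 7 pos by (intro add_pos_pos mult_pos_pos divide_pos_pos) auto
qed

end

locale damped_perturbation = damped_coefficients + perturbation
begin

definition E where "E t = A * E0 t + 1 / 2 * L2_inner (w t) (w t)"
definition q where "q t y = al / 2 * (Z t y)\<^sup>2 + be / 2 * (\<phi> t y)\<^sup>2"
definition L where "L t y = q t y + B * E t"

lemma E_dissipation:
  assumes sm: "small \<delta> T" and ab: "0 \<le> a" "a \<le> a'" "a' \<le> T"
  shows "E a' - E a \<le> - integral {a..a'} D"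
proof -
  have cD: "continuous_on {a..a'} D" by (rule continuous_on_subset[OF D_continuous]) (use ab in auto)
  have "E0 a' - E0 a \<le> - min \<eta> c * integral {a..a'} D"
    by (rule E0_dissipation[OF sm \<delta>(3) c damping ab])
  then have "A * (E0 a' - E0 a) \<le> A * (- min \<eta> c * integral {a..a'} D)"
    using constants_pos by (intro mult_left_mono) auto
  also have "\<dots> = - (A * min \<eta> c) * integral {a..a'} D" by simp
  also have "A * min \<eta> c = K2 + 1" using pos c by (simp add: A_def)
  finally have 1: "A * (E0 a' - E0 a) \<le> - (K2 + 1) * integral {a..a'} D" .
  have "1 / 2 * L2_inner (w a') (w a') - 1 / 2 * L2_inner (w a) (w a) \<le> integral {a..a'} (\<lambda>r. L2_norm (w r) * L2_norm (S r))"
    by (rule flux_energy_inequality[OF ab(1,2)])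
  also have "\<dots> \<le> integral {a..a'} (\<lambda>r. K2 * D r)"
  proof (rule integral_le)
    show "(\<lambda>r. L2_norm (w r) * L2_norm (S r)) integrable_on {a..a'}"
      by (intro integrable_continuous_real continuous_on_mult continuous_on_subset[OF L2_continuous_norm] wL2 SL2)
         (use ab in auto)
    show "(\<lambda>r. K2 * D r) integrable_on {a..a'}"
      by (intro integrable_continuous_real continuous_on_mult continuous_on_const cD)
    fix r assume r: "r \<in> {a..a'}"
    have "L2_norm (w r) * L2_norm (S r) \<le> ((\<eta> + 1) * sqrt (D r)) * ((G + 2 * fs + ts) / lam * sqrt (D r))"
      using r ab pos norms_le_D(1)[of r] by (intro mult_mono L2_norm_w_le L2_norm_S_le[OF sm \<delta>(2)]) auto
    also have "\<dots> = K2 * (sqrt (D r) * sqrt (D r))" by (simp add: K2_def)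
    also have "\<dots> = K2 * D r" using norms_le_D(1)[of r] by simp
    finally show "L2_norm (w r) * L2_norm (S r) \<le> K2 * D r" .
  qed
  finally have "1 / 2 * L2_inner (w a') (w a') - 1 / 2 * L2_inner (w a) (w a) \<le> K2 * integral {a..a'} D" by simp
  then show ?thesis using 1 unfolding E_def by (simp add: algebra_simps)
qed

lemma E_terms:
  assumes "0 \<le> t"
  shows "A * (lam / (2 * G) * L2_inner (\<sigma> t) (\<sigma> t)) \<le> E t" "A * (k / 2 * L2_inner (\<phi> t) (\<phi> t)) \<le> E t"
    "1 / 2 * L2_inner (w t) (w t) \<le> E t" "0 \<le> E t"
proof -
  have nn: "0 \<le> A * (\<rho> / 2 * L2_inner (v t) (v t))" "0 \<le> A * (lam / (2 * G) * L2_inner (\<sigma> t) (\<sigma> t))"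
      "0 \<le> A * (k / 2 * L2_inner (\<phi> t) (\<phi> t))" "0 \<le> 1 / 2 * L2_inner (w t) (w t)"
    using pos k_pos constants_pos unfolding L2_norm_square[symmetric] by auto
  have "E t = A * (\<rho> / 2 * L2_inner (v t) (v t)) + A * (lam / (2 * G) * L2_inner (\<sigma> t) (\<sigma> t))
      + A * (k / 2 * L2_inner (\<phi> t) (\<phi> t)) + 1 / 2 * L2_inner (w t) (w t)"
    unfolding E_def E0_def by (simp add: distrib_left)
  then show "A * (lam / (2 * G) * L2_inner (\<sigma> t) (\<sigma> t)) \<le> E t" "A * (k / 2 * L2_inner (\<phi> t) (\<phi> t)) \<le> E t"
    "1 / 2 * L2_inner (w t) (w t) \<le> E t" "0 \<le> E t" using nn by linarith+
qed

lemma E_le_D: assumes t: "0 \<le> t" shows "E t \<le> K3 * D t"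
proof -
  have v: "L2_inner (v t) (v t) \<le> D t"
    using power_mono[OF v_le_p[OF t] L2_norm_nonneg, of 2] norms_le_D(2)[of t] by (simp add: L2_norm_square)
  have w: "L2_inner (w t) (w t) \<le> (\<eta> + 1)\<^sup>2 * D t"
    using power_mono[OF L2_norm_w_le[OF t] L2_norm_nonneg, of 2] norms_le_D(1)[of t]
    by (simp add: L2_norm_square power_mult_distrib)
  have "E0 t \<le> \<rho> / 2 * D t + lam / (2 * G) * D t + k / 2 * D t"
    unfolding E0_def using v norms_le_D(3,4)[of t] pos k_pos
    by (intro add_mono mult_left_mono) (auto simp: L2_norm_square)
  then have "A * E0 t \<le> A * (\<rho> / 2 * D t + lam / (2 * G) * D t + k / 2 * D t)"
    using constants_pos by (intro mult_left_mono) auto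
  moreover have "K3 * D t = A * (\<rho> / 2 * D t + lam / (2 * G) * D t + k / 2 * D t) + 1 / 2 * ((\<eta> + 1)\<^sup>2 * D t)"
    by (simp add: K3_def algebra_simps)
  ultimately show ?thesis unfolding E_def using w by linarith
qed

lemma D_le_E: assumes t: "0 \<le> t" shows "D t \<le> K5 * E t"
proof -
  note mem = pm[OF t] \<sigma>m[OF t] wm[OF t]
  define W X Y where "W = L2_inner (w t) (w t)" and "X = L2_inner (\<sigma> t) (\<sigma> t)" and "Y = L2_inner (\<phi> t) (\<phi> t)"
  have "\<eta> * L2_norm (p t) \<le> L2_norm (w t) + L2_norm (\<sigma> t)"
  proof -
    have "L2_norm (\<lambda>y. \<eta> * p t y) = L2_norm (\<lambda>y. w t y - \<sigma> t y)" by (simp add: w_def)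
    then show ?thesis
      using L2_norm_triangle_diff[OF mem(3,2)] L2_norm_scale[of \<eta> "p t"] pos by simp
  qed
  then have "(\<eta> * L2_norm (p t))\<^sup>2 \<le> (L2_norm (w t) + L2_norm (\<sigma> t))\<^sup>2" using pos by (intro power_mono) auto
  also have "\<dots> \<le> 2 * W + 2 * X"
    using sum_squares_bound[of "L2_norm (w t)" "L2_norm (\<sigma> t)"]
    unfolding W_def X_def L2_norm_square[symmetric] power2_sum by linarith
  finally have "\<eta>\<^sup>2 * L2_inner (p t) (p t) \<le> 2 * W + 2 * X" by (simp add: power_mult_distrib L2_norm_square)
  then have pp: "L2_inner (p t) (p t) \<le> 2 / \<eta>\<^sup>2 * W + 2 / \<eta>\<^sup>2 * X" using pos by (simp add: field_simps)
  have W: "W \<le> 2 * E t" using E_terms(3)[OF t] by (simp add: W_def)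
  have X: "X \<le> 2 * G / (lam * A) * E t"
    using E_terms(1)[OF t] pos constants_pos by (simp add: X_def field_simps)
  have Y: "Y \<le> 2 / (k * A) * E t"
    using E_terms(2)[OF t] k_pos constants_pos by (simp add: Y_def field_simps)
  have "D t \<le> 2 / \<eta>\<^sup>2 * W + (2 / \<eta>\<^sup>2 + 1) * X + Y"
    unfolding D_def X_def[symmetric] Y_def[symmetric] using pp by (simp add: algebra_simps)
  also have "\<dots> \<le> 2 / \<eta>\<^sup>2 * (2 * E t) + (2 / \<eta>\<^sup>2 + 1) * (2 * G / (lam * A) * E t) + 2 / (k * A) * E t"
    using pos by (intro add_mono mult_left_mono W X Y) auto
  also have "\<dots> = K5 * E t" by (simp add: K5_def algebra_simps)
  finally show ?thesis .
qed

text \<open>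
  Substituting \<open>\<sigma> = (Z + b P) / lam\<close> produces the damping form in \<open>(Z, \<phi>)\<close>, whose mixed terms cancel at equilibrium by the
  choice of \<open>al\<close> and \<open>be\<close>, a negative term that is discarded, and products of \<open>Z\<close> and \<open>\<phi>\<close> with the forcing terms \<open>S1\<close> and
  \<open>S2\<close>. The latter are linear in \<open>P\<close> and the mean stress, hence of size \<open>\<surd>D\<close>, and are split by Young's inequality.
\<close>
lemma q_derivative_bound:
  assumes sm: "small \<delta> T" and r: "r \<in> {0..T}" and y: "y \<in> Omega"
  shows "al * (RZ r y * Z r y) + be * (Q r y * \<phi> r y) \<le> - (c / 2) * ((Z r y)\<^sup>2 + (\<phi> r y)\<^sup>2) + C6 * D r"
proof -
  have r0: "0 \<le> r" using r by simp
  define X z where "X = Z r y" and "z = \<phi> r y"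
  define f where "f = fs + z"
  define Pr where "Pr = P r y"
  define mr where "mr = m r"
  define d where "d = sqrt (D r)"
  have d: "0 \<le> d" "d\<^sup>2 = D r" using norms_le_D(1)[of r] by (auto simp: d_def)
  have z: "\<bar>z\<bar> \<le> \<delta>" using sm r y unfolding small_def z_def by blast
  then have f: "0 \<le> f" "f \<le> 2 * fs" using \<delta>(2) unfolding f_def by linarith+
  have Pr: "\<bar>Pr\<bar> \<le> 2 * d" unfolding Pr_def d_def by (rule P_bound[OF r0 y])
  have mr: "\<bar>mr\<bar> \<le> d" unfolding mr_def d_def by (rule m_bound[OF r0])
  have \<sigma>: "\<sigma> r y = (X + b * Pr) / lam"
    using pos unfolding X_def Z_def b_def Pr_def by simp
  define S1 where "S1 = al * (- (f * b / lam) * Pr - (G / \<eta> * b / lam) * Pr + (G / \<eta>) * mr)"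
  define S2 where "S2 = (be * \<xi> / lam) * f\<^sup>2 * (b * Pr)"
  have RZ: "RZ r y = - (f * ((X + b * Pr) / lam) + ts * z) - (G / \<eta>) * ((X + b * Pr) / lam - mr)"
    unfolding RZ_def \<sigma> f_def z_def mr_def ..
  have Q: "Q r y = f\<^sup>2 * (\<xi> * ((X + b * Pr) / lam) - \<nu> * z)"
    unfolding Q_eq[OF sm \<delta>(3) r y] \<sigma> f_def z_def ..
  have bal: "al * ts = (be * \<xi> / lam) * fs\<^sup>2" by (simp add: al_def be_def)
  have "al * (RZ r y * X) = - (al / lam) * f * X\<^sup>2 - (al * ts) * X * z - al * (G / \<eta>) / lam * X\<^sup>2 + X * S1"
    unfolding RZ S1_def by (simp add: power2_eq_square algebra_simps add_divide_distrib)
  moreover have "be * (Q r y * z) = (be * \<xi> / lam) * f\<^sup>2 * X * z - (be * \<nu>) * f\<^sup>2 * z\<^sup>2 + z * S2"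
    unfolding Q S2_def by (simp add: power2_eq_square algebra_simps add_divide_distrib)
  moreover have "(be * \<xi> / lam) * f\<^sup>2 * X * z - (al * ts) * X * z = (ts * \<xi> / lam) * (f\<^sup>2 - fs\<^sup>2) * X * z"
    unfolding bal be_def by (simp only: left_diff_distrib right_diff_distrib)
  moreover have "- (al / lam) * f * X\<^sup>2 + (ts * \<xi> / lam) * (f\<^sup>2 - fs\<^sup>2) * X * z - (be * \<nu>) * f\<^sup>2 * z\<^sup>2 \<le> - c * (X\<^sup>2 + z\<^sup>2)"
    using damping'[OF z, of X] unfolding al_def be_def f_def .
  moreover have "0 \<le> al * (G / \<eta>) / lam * X\<^sup>2" using pos constants_pos(1) by simp
  moreover have "X * S1 \<le> (c / 2) * X\<^sup>2 + C1\<^sup>2 * D r / (2 * c)" "z * S2 \<le> (c / 2) * z\<^sup>2 + C2\<^sup>2 * D r / (2 * c)"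
  proof -
    \<comment> \<open>The weight \<open>c / 2\<close> keeps half of the damping.\<close>
    have Young: "x * s \<le> (c / 2) * x\<^sup>2 + C\<^sup>2 * D r / (2 * c)" if s: "\<bar>s\<bar> \<le> C * d" for x s C
    proof -
      have "0 \<le> (c * x - s)\<^sup>2" by simp
      then have "2 * c * (x * s) \<le> c\<^sup>2 * x\<^sup>2 + s\<^sup>2" by (simp add: power2_diff power_mult_distrib algebra_simps)
      moreover have "s\<^sup>2 \<le> C\<^sup>2 * D r"
        using power_mono[OF s abs_ge_zero, of 2] d(2) by (simp add: power_mult_distrib)
      ultimately have "2 * c * (x * s) \<le> c\<^sup>2 * x\<^sup>2 + C\<^sup>2 * D r" by linarith
      then have "(2 * c * (x * s)) / (2 * c) \<le> (c\<^sup>2 * x\<^sup>2 + C\<^sup>2 * D r) / (2 * c)"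
        using c by (intro divide_right_mono) auto
      then show ?thesis using c by (simp add: add_divide_distrib power2_eq_square)
    qed
    have b0: "0 \<le> b" and al0: "0 \<le> al" and be0: "0 \<le> be" using constants_pos by simp_all
    have "\<bar>S1\<bar> \<le> C1 * d"
    proof -
      have 1: "\<bar>(f * b / lam) * Pr\<bar> \<le> (2 * fs * b / lam) * (2 * d)"
        unfolding abs_mult using f b0 pos Pr by (intro mult_mono) (auto intro: divide_right_mono mult_right_mono)
      have 2: "\<bar>(G / \<eta> * b / lam) * Pr\<bar> \<le> (G / \<eta> * b / lam) * (2 * d)"
        unfolding abs_mult using b0 pos Pr by (intro mult_mono) auto
      have 3: "\<bar>(G / \<eta>) * mr\<bar> \<le> (G / \<eta>) * d"
        unfolding abs_mult using pos mr by (intro mult_mono) auto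
      have "\<bar>- (f * b / lam) * Pr - (G / \<eta> * b / lam) * Pr + (G / \<eta>) * mr\<bar>
          \<le> (2 * fs * b / lam) * (2 * d) + (G / \<eta> * b / lam) * (2 * d) + (G / \<eta>) * d"
        using 1 2 3 unfolding mult_minus_left by linarith
      then have "\<bar>S1\<bar> \<le> al * ((2 * fs * b / lam) * (2 * d) + (G / \<eta> * b / lam) * (2 * d) + (G / \<eta>) * d)"
        unfolding S1_def abs_mult[of al] using al0 by (simp add: mult_left_mono)
      also have "\<dots> = C1 * d" by (simp add: C1_def algebra_simps)
      finally show ?thesis .
    qed
    then show "X * S1 \<le> (c / 2) * X\<^sup>2 + C1\<^sup>2 * D r / (2 * c)" by (rule Young)
    have "\<bar>S2\<bar> \<le> C2 * d"
    proof -
      have f2: "f\<^sup>2 \<le> 4 * fs\<^sup>2" using power_mono[OF f(2,1), of 2] by (simp add: power_mult_distrib)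
      have bP: "\<bar>b * Pr\<bar> \<le> b * (2 * d)" unfolding abs_mult using b0 Pr by (intro mult_mono) auto
      have "\<bar>S2\<bar> = (be * \<xi> / lam) * f\<^sup>2 * \<bar>b * Pr\<bar>"
        unfolding S2_def using be0 pos by (simp add: abs_mult)
      also have "\<dots> \<le> (be * \<xi> / lam) * (4 * fs\<^sup>2) * (b * (2 * d))"
        using be0 pos b0 d by (intro mult_mono f2 bP) auto
      also have "\<dots> = C2 * d" by (simp add: C2_def)
      finally show ?thesis .
    qed
    then show "z * S2 \<le> (c / 2) * z\<^sup>2 + C2\<^sup>2 * D r / (2 * c)" by (rule Young)
  qed
  moreover have "C6 * D r = C1\<^sup>2 * D r / (2 * c) + C2\<^sup>2 * D r / (2 * c)"
    by (simp add: C6_def add_divide_distrib distrib_right)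
  moreover have "- c * (X\<^sup>2 + z\<^sup>2) = - (c * X\<^sup>2) - c * z\<^sup>2" "- (c / 2) * (X\<^sup>2 + z\<^sup>2) = - (c / 2 * X\<^sup>2) - c / 2 * z\<^sup>2"
     "c * X\<^sup>2 = 2 * (c / 2 * X\<^sup>2)" "c * z\<^sup>2 = 2 * (c / 2 * z\<^sup>2)"
    by (simp_all add: algebra_simps)
  ultimately show ?thesis unfolding X_def[symmetric] z_def[symmetric] by linarith
qed

lemma Z_slice:
  assumes y: "y \<in> Omega"
  shows "continuous_on {0..} (\<lambda>t. Z t y)"
    and "0 \<le> a \<Longrightarrow> a \<le> a' \<Longrightarrow> (Z a' y)\<^sup>2 - (Z a y)\<^sup>2 = integral {a..a'} (\<lambda>r. 2 * (RZ r y * Z r y))"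
proof -
  note id = pointwise_energy_identity[of "\<lambda>t. RZ t y" "\<lambda>t. Z t y",
      OF jointly_continuous_slices(2)[OF RZ_continuous y] Z_pointwise[OF _ _ y]]
  show "continuous_on {0..} (\<lambda>t. Z t y)" by (rule id(1)[of 0 0]) auto
  show "0 \<le> a \<Longrightarrow> a \<le> a' \<Longrightarrow> (Z a' y)\<^sup>2 - (Z a y)\<^sup>2 = integral {a..a'} (\<lambda>r. 2 * (RZ r y * Z r y))" by (rule id(2))
qed

lemma \<phi>_slice:
  assumes y: "y \<in> Omega"
  shows "continuous_on {0..} (\<lambda>t. \<phi> t y)"
    and "0 \<le> a \<Longrightarrow> a \<le> a' \<Longrightarrow> (\<phi> a' y)\<^sup>2 - (\<phi> a y)\<^sup>2 = integral {a..a'} (\<lambda>r. 2 * (Q r y * \<phi> r y))"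
proof -
  note id = pointwise_energy_identity[of "\<lambda>t. Q t y" "\<lambda>t. \<phi> t y",
      OF jointly_continuous_slices(2)[OF Q_continuous y] \<phi>_pointwise[OF _ _ y]]
  show "continuous_on {0..} (\<lambda>t. \<phi> t y)" by (rule jointly_continuous_slices(2)[OF \<phi> y])
  show "0 \<le> a \<Longrightarrow> a \<le> a' \<Longrightarrow> (\<phi> a' y)\<^sup>2 - (\<phi> a y)\<^sup>2 = integral {a..a'} (\<lambda>r. 2 * (Q r y * \<phi> r y))" by (rule id(2))
qed

lemma v_L2_continuous: "L2_continuous v"
  unfolding L2_continuous_def
proof (intro conjI allI impI v_L2)
  fix s :: real assume s: "0 \<le> s"
  show "((\<lambda>t. L2_norm (\<lambda>y. v t y - v s y)) \<longlongrightarrow> 0) (at s within {0..})"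
  proof (rule Lim_null_comparison)
    show "((\<lambda>t. L2_norm (\<lambda>y. p t y - p s y)) \<longlongrightarrow> 0) (at s within {0..})"
      using p s by (simp add: L2_continuous_def)
    show "\<forall>\<^sub>F t in at s within {0..}. norm (L2_norm (\<lambda>y. v t y - v s y)) \<le> L2_norm (\<lambda>y. p t y - p s y)"
      unfolding eventually_at_filter
    proof (intro always_eventually allI impI)
      fix t :: real assume "t \<in> {0..}"
      then have t: "0 \<le> t" by simp
      have "L2_norm (\<lambda>y. v t y - v s y) \<le> L2_norm (\<lambda>y. p t y - p s y)"
      proof (rule L2_norm_le_sup[OF L2_diff[OF v_L2[OF t] v_L2[OF s]]])
        fix y assume y: "y \<in> Omega"
        then have i: "p r integrable_on {0..y}" if "0 \<le> r" for r
          using L2_imp_integrable_on[OF pm[OF that], of 0 y] by auto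
        have "v t y - v s y = integral {0..y} (\<lambda>y. p t y - p s y)"
          unfolding v_def by (rule Henstock_Kurzweil_Integration.integral_diff[symmetric]) (intro i t s)+
        then show "\<bar>v t y - v s y\<bar> \<le> L2_norm (\<lambda>y. p t y - p s y)"
          using abs_integral_le_L2_norm[OF L2_diff[OF pm[OF t] pm[OF s]], of 0 y] y by auto
      qed simp
      then show "norm (L2_norm (\<lambda>y. v t y - v s y)) \<le> L2_norm (\<lambda>y. p t y - p s y)" by simp
    qed
  qed
qed

lemma E_continuous: "continuous_on {0..} E"
  unfolding E_def E0_def
  by (intro continuous_on_add continuous_on_mult continuous_on_const inner_continuous \<sigma>L2 \<phi>L2 wL2 v_L2_continuous)

lemma L_continuous: "y \<in> Omega \<Longrightarrow> continuous_on {0..} (\<lambda>t. L t y)"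
  unfolding L_def q_def
  by (intro continuous_on_add continuous_on_mult continuous_on_const continuous_on_power Z_slice \<phi>_slice E_continuous)

text \<open>
  Half of \<open>c\<close> is left from the pointwise damping and one unit of \<open>D\<close> from the global energy; each controls its part of \<open>L\<close>.
\<close>
lemma L_dissipation:
  assumes sm: "small \<delta> T" and y: "y \<in> Omega" and ab: "0 \<le> a" "a \<le> a'" "a' \<le> T"
  shows "L a' y - L a y \<le> - rate * integral {a..a'} (\<lambda>r. L r y)"
proof -
  have sub: "continuous_on {a..a'} f" if "continuous_on {0..} f" for f :: "real \<Rightarrow> real"
    by (rule continuous_on_subset[OF that]) (use ab in auto)
  note cZ = sub[OF Z_slice(1)[OF y]] and c\<phi> = sub[OF \<phi>_slice(1)[OF y]] and cD = sub[OF D_continuous]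
    and cR = sub[OF jointly_continuous_slices(2)[OF RZ_continuous y]] and cQ = sub[OF jointly_continuous_slices(2)[OF Q_continuous y]]
    and cL = sub[OF L_continuous[OF y]]
  note int = integrable_continuous_real continuous_on_add continuous_on_diff continuous_on_mult continuous_on_const
    continuous_on_power cZ c\<phi> cD cR cQ cL
  have "q a' y - q a y = al / 2 * ((Z a' y)\<^sup>2 - (Z a y)\<^sup>2) + be / 2 * ((\<phi> a' y)\<^sup>2 - (\<phi> a y)\<^sup>2)"
    by (simp add: q_def algebra_simps)
  also have "\<dots> = al * integral {a..a'} (\<lambda>r. RZ r y * Z r y) + be * integral {a..a'} (\<lambda>r. Q r y * \<phi> r y)"
    unfolding Z_slice(2)[OF y ab(1,2)] \<phi>_slice(2)[OF y ab(1,2)] by simp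
  also have "\<dots> = integral {a..a'} (\<lambda>r. al * (RZ r y * Z r y) + be * (Q r y * \<phi> r y))"
    by (rule integral_unique[symmetric]) (intro has_integral_add has_integral_mult_right integrable_integral int)
  finally have "L a' y - L a y \<le> integral {a..a'} (\<lambda>r. al * (RZ r y * Z r y) + be * (Q r y * \<phi> r y)) + B * (- integral {a..a'} D)"
    using mult_left_mono[OF E_dissipation[OF sm ab], of B] constants_pos unfolding L_def by (simp add: algebra_simps)
  also have "\<dots> = integral {a..a'} (\<lambda>r. al * (RZ r y * Z r y) + be * (Q r y * \<phi> r y) + B * - D r)"
    by (rule integral_unique[symmetric])
       (intro has_integral_add has_integral_mult_right has_integral_neg integrable_integral int)
  also have "\<dots> \<le> integral {a..a'} (\<lambda>r. - rate * L r y)"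
  proof (rule integral_le)
    show "(\<lambda>r. al * (RZ r y * Z r y) + be * (Q r y * \<phi> r y) + B * - D r) integrable_on {a..a'}"
      by (intro int continuous_on_minus)
    show "(\<lambda>r. - rate * L r y) integrable_on {a..a'}" by (intro int)
    fix r assume "r \<in> {a..a'}"
    then have r: "r \<in> {0..T}" "0 \<le> r" using ab by auto
    have 1: "al * (RZ r y * Z r y) + be * (Q r y * \<phi> r y) \<le> - (c / 2) * ((Z r y)\<^sup>2 + (\<phi> r y)\<^sup>2) + C6 * D r"
      by (rule q_derivative_bound[OF sm r(1) y])
    have "q r y \<le> K6 * (Z r y)\<^sup>2 + K6 * (\<phi> r y)\<^sup>2"
      unfolding q_def K6_def using constants_pos(1,2) by (intro add_mono mult_right_mono) auto
    then have "rate * q r y \<le> (c / (2 * K6)) * (K6 * (Z r y)\<^sup>2 + K6 * (\<phi> r y)\<^sup>2)"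
      using constants_pos c by (intro mult_mono) (auto simp: rate_def q_def)
    also have "\<dots> = (c / 2) * ((Z r y)\<^sup>2 + (\<phi> r y)\<^sup>2)" using constants_pos by (simp add: field_simps)
    finally have 2: "rate * q r y \<le> (c / 2) * ((Z r y)\<^sup>2 + (\<phi> r y)\<^sup>2)" .
    have "rate * (B * E r) \<le> (1 / (K3 * B)) * (B * (K3 * D r))"
      using constants_pos E_terms(4)[OF r(2)] E_le_D[OF r(2)] by (intro mult_mono) (auto simp: rate_def)
    also have "\<dots> = D r" using constants_pos by simp
    finally have 3: "rate * (B * E r) \<le> D r" .
    have "- rate * L r y = - (rate * q r y) - rate * (B * E r)" "B * - D r = - (C6 * D r) - D r"
      by (simp_all add: L_def B_def algebra_simps)
    then show "al * (RZ r y * Z r y) + be * (Q r y * \<phi> r y) + B * - D r \<le> - rate * L r y"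
      using 1 2 3 by linarith
  qed
  finally show ?thesis by simp
qed

lemma L_nonneg: "0 \<le> t \<Longrightarrow> 0 \<le> L t y"
  unfolding L_def q_def using constants_pos E_terms(4)[of t] by auto

lemma L_decay:
  assumes sm: "small \<delta> T" and T: "0 \<le> T" and y: "y \<in> Omega"
  shows "L T y \<le> L 0 y * exp (- rate * T)"
proof (rule exponential_decay_of_integral_inequality[OF T _ _ constants_pos(13)])
  show "continuous_on {0..T} (\<lambda>t. L t y)" by (rule continuous_on_subset[OF L_continuous[OF y]]) auto
  show "0 \<le> L t y" if "t \<in> {0..T}" for t using that by (intro L_nonneg) auto
  show "L t y - L s y \<le> - rate * integral {s..t} (\<lambda>t. L t y)" if "0 \<le> s" "s \<le> t" "t \<le> T" for s t
    by (rule L_dissipation[OF sm y that])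
qed

lemma L_initial:
  assumes y: "y \<in> Omega" and M: "L2_inner (p 0) (p 0) \<le> M" "\<And>y. y \<in> Omega \<Longrightarrow> (\<sigma> 0 y)\<^sup>2 \<le> M" "\<And>y. y \<in> Omega \<Longrightarrow> (\<phi> 0 y)\<^sup>2 \<le> M"
  shows "L 0 y \<le> K7 * M"
proof -
  have M0: "0 \<le> M" using order_trans[OF zero_le_power2 M(2)[OF y]] .
  have sq: "L2_inner f f \<le> M" if "f \<in> L2" "\<And>y. y \<in> Omega \<Longrightarrow> (f y)\<^sup>2 \<le> M" for f
  proof -
    have "L2_norm f \<le> sqrt M" using that M0 by (intro L2_norm_le_sup) (auto intro: real_le_rsqrt)
    then show ?thesis using power_mono[of "L2_norm f" "sqrt M" 2] M0 by (simp add: L2_norm_square)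
  qed
  have D0: "D 0 \<le> 3 * M" unfolding D_def
    using M(1) sq[OF \<sigma>m[OF order_refl] M(2)] sq[OF \<phi>m[OF order_refl] M(3)] by simp
  have "(P 0 y)\<^sup>2 \<le> (2 * sqrt (D 0))\<^sup>2"
    using power_mono[OF P_bound[OF order_refl y] abs_ge_zero, of 2] by simp
  then have P2: "(P 0 y)\<^sup>2 \<le> 12 * M" using D0 norms_le_D(1)[of 0] by (simp add: power_mult_distrib)
  have "(Z 0 y)\<^sup>2 \<le> 2 * (lam * \<sigma> 0 y)\<^sup>2 + 2 * (b * P 0 y)\<^sup>2"
    using sum_squares_bound[of "lam * \<sigma> 0 y" "- (b * P 0 y)"] unfolding Z_def b_def[symmetric] power2_diff by simp
  also have "\<dots> = 2 * lam\<^sup>2 * (\<sigma> 0 y)\<^sup>2 + 2 * b\<^sup>2 * (P 0 y)\<^sup>2" by (simp add: power_mult_distrib)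
  also have "\<dots> \<le> 2 * lam\<^sup>2 * M + 2 * b\<^sup>2 * (12 * M)" by (intro add_mono mult_left_mono M(2) y P2) auto
  finally have Z2: "(Z 0 y)\<^sup>2 \<le> (2 * lam\<^sup>2 + 24 * b\<^sup>2) * M" by (simp add: algebra_simps)
  have "q 0 y \<le> K6 * (Z 0 y)\<^sup>2 + K6 * (\<phi> 0 y)\<^sup>2"
    unfolding q_def K6_def using constants_pos(1,2) by (intro add_mono mult_right_mono) auto
  also have "\<dots> \<le> K6 * ((2 * lam\<^sup>2 + 24 * b\<^sup>2) * M) + K6 * M"
    using constants_pos by (intro add_mono mult_left_mono Z2 M(3) y) auto
  finally have q: "q 0 y \<le> K6 * (2 * lam\<^sup>2 + 24 * b\<^sup>2 + 1) * M" by (simp add: algebra_simps)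
  have "K3 * D 0 \<le> K3 * (3 * M)" using constants_pos by (intro mult_left_mono D0) auto
  then have "E 0 \<le> K3 * (3 * M)" using E_le_D[of 0] by simp
  then have "B * E 0 \<le> B * (K3 * (3 * M))" using constants_pos by (intro mult_left_mono) auto
  then show ?thesis using q unfolding L_def K7_def by (simp add: algebra_simps)
qed

text \<open>
  The stress is recovered from \<open>Z\<close> up to a multiple of \<open>P\<close>, which the energy bounds.
\<close>
lemma L_controls:
  assumes t: "0 \<le> t" and y: "y \<in> Omega"
  shows "(\<sigma> t y)\<^sup>2 + (\<phi> t y)\<^sup>2 + D t \<le> K8 * L t y"
proof -
  note cp = constants_pos
  have q0: "0 \<le> q t y" unfolding q_def using cp by auto
  have "B * E t \<le> L t y" using q0 by (simp add: L_def)
  then have EL: "E t \<le> L t y / B" using cp by (simp add: field_simps)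
  have D: "D t \<le> K5 / B * L t y"
    using order_trans[OF D_le_E[OF t] mult_left_mono[OF EL, of K5]] cp by simp
  have BE: "0 \<le> B * E t" using cp E_terms(4)[OF t] by simp
  have "al / 2 * (Z t y)\<^sup>2 \<le> L t y" "be / 2 * (\<phi> t y)\<^sup>2 \<le> L t y"
    using BE cp by (auto simp: L_def q_def intro: add_increasing add_increasing2)
  then have Z2: "(Z t y)\<^sup>2 \<le> 2 / al * L t y" and \<phi>2: "(\<phi> t y)\<^sup>2 \<le> 2 / be * L t y" using cp by (auto simp: field_simps)
  have "(P t y)\<^sup>2 \<le> (2 * sqrt (D t))\<^sup>2"
    using power_mono[OF P_bound[OF t y] abs_ge_zero, of 2] by simp
  then have "(P t y)\<^sup>2 \<le> 4 * D t" using norms_le_D(1)[of t] by (simp add: power_mult_distrib)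
  then have P2: "(P t y)\<^sup>2 \<le> 4 * (K5 / B * L t y)" using D by linarith
  have "lam\<^sup>2 * (\<sigma> t y)\<^sup>2 = (Z t y + b * P t y)\<^sup>2"
    unfolding Z_def b_def[symmetric] by (simp add: power_mult_distrib)
  also have "\<dots> \<le> 2 * (Z t y)\<^sup>2 + 2 * (b\<^sup>2 * (P t y)\<^sup>2)"
    using sum_squares_bound[of "Z t y" "b * P t y"] unfolding power2_sum by (simp add: power_mult_distrib mult.commute)
  also have "\<dots> \<le> 2 * (2 / al * L t y) + 2 * (b\<^sup>2 * (4 * (K5 / B * L t y)))"
    by (intro add_mono mult_left_mono Z2 P2) auto
  also have "\<dots> = lam\<^sup>2 * ((2 / lam\<^sup>2) * (2 / al + 4 * b\<^sup>2 * (K5 / B)) * L t y)"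
    using pos by (simp add: algebra_simps)
  finally have "(\<sigma> t y)\<^sup>2 \<le> (2 / lam\<^sup>2) * (2 / al + 4 * b\<^sup>2 * (K5 / B)) * L t y"
    using pos by (subst (asm) mult_le_cancel_left_pos) auto
  then show ?thesis using D \<phi>2 unfolding K8_def by (simp only: distrib_right)
qed

lemma decay_while_small:
  assumes sm: "small \<delta> T" and T: "0 \<le> T" and y: "y \<in> Omega"
    and M: "L2_inner (p 0) (p 0) \<le> M" "\<And>y. y \<in> Omega \<Longrightarrow> (\<sigma> 0 y)\<^sup>2 \<le> M" "\<And>y. y \<in> Omega \<Longrightarrow> (\<phi> 0 y)\<^sup>2 \<le> M"
  shows "(\<sigma> T y)\<^sup>2 + (\<phi> T y)\<^sup>2 + D T \<le> K8 * K7 * M * exp (- rate * T)"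
proof -
  have "K8 * L T y \<le> K8 * (L 0 y * exp (- rate * T))"
    using constants_pos by (intro mult_left_mono L_decay[OF sm T y]) auto
  also have "\<dots> \<le> K8 * (K7 * M * exp (- rate * T))"
    using constants_pos by (intro mult_left_mono mult_right_mono L_initial[OF y M]) auto
  finally show ?thesis using L_controls[OF T y] by (simp add: mult.assoc)
qed

text \<open>
  The a priori smallness is removed: as long as it holds, the decay estimate gives strict smallness.
\<close>
lemma global_decay:
  assumes M: "L2_inner (p 0) (p 0) \<le> M" "\<And>y. y \<in> Omega \<Longrightarrow> (\<sigma> 0 y)\<^sup>2 \<le> M" "\<And>y. y \<in> Omega \<Longrightarrow> (\<phi> 0 y)\<^sup>2 \<le> M"
    and M_small: "2 * M < \<delta>\<^sup>2" "K8 * K7 * M < \<delta>\<^sup>2"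
    and t: "0 \<le> t" and y: "y \<in> Omega"
  shows "(\<sigma> t y)\<^sup>2 + (\<phi> t y)\<^sup>2 + D t \<le> K8 * K7 * M * exp (- rate * t)"
proof -
  have M0: "0 \<le> M" using order_trans[OF zero_le_power2 M(2)[OF y]] .
  have smallI: "small \<delta> T" if "\<And>t y. t \<in> {0..T} \<Longrightarrow> y \<in> Omega \<Longrightarrow> (\<sigma> t y)\<^sup>2 + (\<phi> t y)\<^sup>2 \<le> \<delta>\<^sup>2" for T
    unfolding small_def
  proof (intro ballI)
    fix t y assume "t \<in> {0..T}" "y \<in> Omega"
    from that[OF this] have "(\<sigma> t y)\<^sup>2 \<le> \<delta>\<^sup>2" "(\<phi> t y)\<^sup>2 \<le> \<delta>\<^sup>2"
      using zero_le_power2[of "\<sigma> t y"] zero_le_power2[of "\<phi> t y"] by linarith+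
    then show "\<bar>\<sigma> t y\<bar> \<le> \<delta> \<and> \<bar>\<phi> t y\<bar> \<le> \<delta>" using \<delta>(1) by (auto simp: abs_le_square_iff[symmetric])
  qed
  have "(\<sigma> t y)\<^sup>2 + (\<phi> t y)\<^sup>2 < \<delta>\<^sup>2" if "0 \<le> t" "y \<in> Omega" for t y
  proof (rule continuation_principle[where F = "\<lambda>t y. (\<sigma> t y)\<^sup>2 + (\<phi> t y)\<^sup>2", OF _ _ _ that])
    show "continuous_on ({0..} \<times> Omega) (\<lambda>(t, y). (\<sigma> t y)\<^sup>2 + (\<phi> t y)\<^sup>2)"
      using \<sigma> \<phi> unfolding case_prod_beta by (intro continuous_intros)
    show "(\<sigma> 0 y)\<^sup>2 + (\<phi> 0 y)\<^sup>2 < \<delta>\<^sup>2" if "y \<in> Omega" for y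
      using M(2,3)[OF that] M_small(1) by linarith
    fix T :: real assume T: "0 \<le> T" and le: "\<And>t y. t \<in> {0..T} \<Longrightarrow> y \<in> Omega \<Longrightarrow> (\<sigma> t y)\<^sup>2 + (\<phi> t y)\<^sup>2 \<le> \<delta>\<^sup>2"
    show "\<forall>y\<in>Omega. (\<sigma> T y)\<^sup>2 + (\<phi> T y)\<^sup>2 < \<delta>\<^sup>2"
    proof
      fix y assume y: "y \<in> Omega"
      have "(\<sigma> T y)\<^sup>2 + (\<phi> T y)\<^sup>2 + D T \<le> K8 * K7 * M * exp (- rate * T)"
        by (rule decay_while_small[OF smallI[OF le] T y M])
      also have "\<dots> \<le> K8 * K7 * M * 1"
        using constants_pos M0 T by (intro mult_left_mono) auto
      finally show "(\<sigma> T y)\<^sup>2 + (\<phi> T y)\<^sup>2 < \<delta>\<^sup>2" using M_small(2) norms_le_D(1)[of T] by linarith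
    qed
  qed
  then have "small \<delta> t" by (intro smallI) (auto intro: less_imp_le)
  from decay_while_small[OF this t y M] show ?thesis .
qed

end

lemma (in coefficients) exists_damping: "\<exists>\<delta> c. damped_coefficients \<rho> \<eta> lam G \<xi> \<nu> fs ts \<delta> c"
proof -
  obtain \<delta>1 c1 where 1: "0 < \<delta>1" "0 < c1"
    "\<And>x z. \<bar>z\<bar> \<le> \<delta>1 \<Longrightarrow> - (1 / G) * (fs + z) * x\<^sup>2 + (k * \<xi>) * ((fs + z)\<^sup>2 - fs\<^sup>2) * x * z - (k * \<nu>) * (fs + z)\<^sup>2 * z\<^sup>2 \<le> - c1 * (x\<^sup>2 + z\<^sup>2)"
    by (rule damping_form[of "1 / G" "k * \<xi>" "k * \<nu>" fs]) (use pos k_pos in auto)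
  obtain \<delta>2 c2 where 2: "0 < \<delta>2" "0 < c2"
    "\<And>x z. \<bar>z\<bar> \<le> \<delta>2 \<Longrightarrow> - (fs\<^sup>2 * \<xi> / lam / lam) * (fs + z) * x\<^sup>2 + (ts * \<xi> / lam) * ((fs + z)\<^sup>2 - fs\<^sup>2) * x * z - (ts * \<nu>) * (fs + z)\<^sup>2 * z\<^sup>2 \<le> - c2 * (x\<^sup>2 + z\<^sup>2)"
    by (rule damping_form[of "fs\<^sup>2 * \<xi> / lam / lam" "ts * \<xi> / lam" "ts * \<nu>" fs]) (use pos in auto)
  define \<delta> where "\<delta> = min (min \<delta>1 \<delta>2) (min fs ts)"
  define c where "c = min c1 c2"
  have weaken: "- c1 * (x\<^sup>2 + z\<^sup>2) \<le> - c * (x\<^sup>2 + z\<^sup>2)" "- c2 * (x\<^sup>2 + z\<^sup>2) \<le> - c * (x\<^sup>2 + z\<^sup>2)" for x z :: real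
    unfolding c_def by (intro mult_right_mono; simp)+
  have "damped_coefficients \<rho> \<eta> lam G \<xi> \<nu> fs ts \<delta> c"
  proof
    show "0 < \<delta>" "\<delta> \<le> fs" "\<delta> \<le> ts" "0 < c" using 1 2 pos by (auto simp: \<delta>_def c_def)
    fix x z assume "\<bar>z\<bar> \<le> \<delta>"
    then have z: "\<bar>z\<bar> \<le> \<delta>1" "\<bar>z\<bar> \<le> \<delta>2" by (auto simp: \<delta>_def)
    show "- (1 / G) * (fs + z) * x\<^sup>2 + (k * \<xi>) * ((fs + z)\<^sup>2 - fs\<^sup>2) * x * z - (k * \<nu>) * (fs + z)\<^sup>2 * z\<^sup>2 \<le> - c * (x\<^sup>2 + z\<^sup>2)"
      by (rule order_trans[OF 1(3)[OF z(1)] weaken(1)])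
    show "- (fs\<^sup>2 * \<xi> / lam / lam) * (fs + z) * x\<^sup>2 + (ts * \<xi> / lam) * ((fs + z)\<^sup>2 - fs\<^sup>2) * x * z - (ts * \<nu>) * (fs + z)\<^sup>2 * z\<^sup>2 \<le> - c * (x\<^sup>2 + z\<^sup>2)"
      by (rule order_trans[OF 2(3)[OF z(2)] weaken(2)])
  qed
  then show ?thesis by blast
qed

section \<open>Exponential convergence of global solutions\<close>

text \<open>
  For almost every time the momentum equation says that \<open>\<eta> p + \<sigma>\<close> has the weak derivative \<open>\<rho> \<partial>\<^sub>t u\<close>, so \<open>weak_deriv_duality\<close>
  turns the pairing of \<open>\<partial>\<^sub>t u\<close> with a primitive into an expression without second derivatives that is continuous in time.
  In the stress equation the constants \<open>G a\<close> and \<open>fs ts\<close> cancel. The regularity is used on \<open>[0, t + 1]\<close> because a time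
  horizon has to be positive.
\<close>
lemma global_solution_imp_perturbation:
  fixes \<rho> \<eta> lam G \<xi> \<nu> a fs ts :: real
  assumes co: "coefficients \<rho> \<eta> lam G \<xi> \<nu> fs ts" and eq: "fs * ts = G * a"
    and sol: "global_solution \<rho> \<eta> lam G \<xi> \<nu> a u0 \<tau>0 f0 u \<tau> f"
  shows "perturbation \<rho> \<eta> lam G \<xi> \<nu> fs ts (\<lambda>t y. wderiv (u t) y - a) (\<lambda>t y. \<tau> t y - ts) (\<lambda>t y. f t y - fs)"
    and "\<And>t y. 0 \<le> t \<Longrightarrow> y \<in> Omega \<Longrightarrow> u t y - a * y = integral {0..y} (\<lambda>y. wderiv (u t) y - a)"
    and "\<And>t. 0 \<le> t \<Longrightarrow> u t \<in> H1 \<and> \<tau> t \<in> H1 \<and> f t \<in> H1"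
proof -
  interpret coefficients \<rho> \<eta> lam G \<xi> \<nu> fs ts by (rule co)
  obtain ut \<tau>t ft where reg: "\<And>T. T > 0 \<Longrightarrow>
        in_C_time H1 H1_norm T u \<and> in_L2_time H2 H2_norm T u \<and>
        in_C_time H1 H1_norm T \<tau> \<and> in_C_time H1 H1_norm T f \<and>
        has_weak_time_deriv T u ut \<and> in_L2_time L2 L2_norm T ut \<and>
        has_weak_time_deriv T \<tau> \<tau>t \<and> in_C_time L2 L2_norm T \<tau>t \<and>
        has_weak_time_deriv T f ft \<and> in_C_time L2 L2_norm T ft \<and>
        (AE t in lebesgue_on {0..T}. AE y in lebesgue_on Omega.
           \<rho> * ut t y = \<eta> * wderiv (wderiv (u t)) y + wderiv (\<tau> t) y \<and>
           lam * \<tau>t t y = G * wderiv (u t) y - f t y * \<tau> t y \<and>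
           ft t y = (- 1 + \<xi> * \<bar>\<tau> t y\<bar>) * (f t y)\<^sup>2 - \<nu> * (f t y) ^ 3)"
    and bc: "\<And>t. 0 \<le> t \<Longrightarrow> u t 0 = 0 \<and> u t 1 = a"
    using sol unfolding global_solution_def by blast
  have uC: "T > 0 \<Longrightarrow> in_C_time H1 H1_norm T u" and \<tau>C: "T > 0 \<Longrightarrow> in_C_time H1 H1_norm T \<tau>"
    and fC: "T > 0 \<Longrightarrow> in_C_time H1 H1_norm T f" for T using reg by auto
  have H1: "u t \<in> H1" "\<tau> t \<in> H1" "f t \<in> H1" if "0 \<le> t" for t
    using in_C_time_half_line(1)[of H1 H1_norm u t] in_C_time_half_line(1)[of H1 H1_norm \<tau> t]
      in_C_time_half_line(1)[of H1 H1_norm f t] uC \<tau>C fC that by auto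
  then show "u t \<in> H1 \<and> \<tau> t \<in> H1 \<and> f t \<in> H1" if "0 \<le> t" for t using that by blast
  define p where "p t y = wderiv (u t) y - a" for t y
  define \<sigma> where "\<sigma> t y = \<tau> t y - ts" for t y
  define \<phi> where "\<phi> t y = f t y - fs" for t y
  have pL2: "L2_continuous p" unfolding p_def
    by (intro L2_continuous_diff L2_continuous_wderiv uC) (auto simp: L2_continuous_def L2_norm_def)
  have ju: "continuous_on ({0..} \<times> Omega) (\<lambda>(t, y). u t y)" and j\<tau>: "continuous_on ({0..} \<times> Omega) (\<lambda>(t, y). \<tau> t y)"
    and jf: "continuous_on ({0..} \<times> Omega) (\<lambda>(t, y). f t y)"
    by (intro jointly_continuous_if_in_C_time_H1 uC \<tau>C fC; assumption)+
  have j\<sigma>: "continuous_on ({0..} \<times> Omega) (\<lambda>(t, y). \<sigma> t y)"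
    using j\<tau> unfolding \<sigma>_def case_prod_beta by (intro continuous_on_diff continuous_on_const)
  have j\<phi>: "continuous_on ({0..} \<times> Omega) (\<lambda>(t, y). \<phi> t y)"
    using jf unfolding \<phi>_def case_prod_beta by (intro continuous_on_diff continuous_on_const)
  note L2c = L2_continuous_if_jointly_continuous
  have v_eq: "u t y - a * y = integral {0..y} (p t)" if t: "0 \<le> t" and y: "y \<in> Omega" for t y
  proof -
    have "(p t has_integral integral {0..y} (wderiv (u t)) - (y - 0) *\<^sub>R a) {0..y}"
      unfolding p_def using y H1(1)[OF t] has_integral_const_real[of a 0 y]
      by (intro has_integral_diff integrable_integral L2_imp_integrable_on H1_wderiv_L2) auto
    then show ?thesis
      using has_weak_deriv_imp_integral[OF H1_wderiv[OF H1(1)[OF t]] H1_continuous[OF H1(1)[OF t]] y] bc[OF t]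
      by (simp add: integral_unique mult.commute)
  qed
  then show "u t y - a * y = integral {0..y} (\<lambda>y. wderiv (u t) y - a)" if "0 \<le> t" "y \<in> Omega" for t y
    using that unfolding p_def[abs_def] by blast
  have inner_cont: "continuous_on {0..T} (\<lambda>t. L2_inner (U t) h)" if "L2_continuous U" "h \<in> L2" for U h T
  proof -
    have "L2_continuous (\<lambda>t. h)" using that by (simp add: L2_continuous_def L2_norm_def)
    note jc = L2_continuous_inner[OF that(1) this]
    show ?thesis
      by (rule continuous_on_compose2[OF jc, of _ "\<lambda>t. (t, t)", simplified]) (auto intro!: continuous_intros)
  qed
  have wL2: "L2_continuous (\<lambda>t y. \<eta> * p t y + \<sigma> t y)"
    by (intro L2_continuous_add L2_continuous_scale pL2 L2c j\<sigma>)
  have SL2: "L2_continuous (\<lambda>t y. (1 / lam) * (G * p t y - ((fs + \<phi> t y) * \<sigma> t y + ts * \<phi> t y)))"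
  proof (intro L2_continuous_scale L2_continuous_diff pL2 L2c)
    show "continuous_on ({0..} \<times> Omega) (\<lambda>(t, y). (fs + \<phi> t y) * \<sigma> t y + ts * \<phi> t y)"
      using j\<sigma> j\<phi> unfolding case_prod_beta by (intro continuous_intros)
  qed
  have QL2: "L2_continuous (\<lambda>t y. (- 1 + \<xi> * \<bar>ts + \<sigma> t y\<bar>) * (fs + \<phi> t y)\<^sup>2 - \<nu> * (fs + \<phi> t y) ^ 3)"
    using j\<sigma> j\<phi> unfolding case_prod_beta by (intro L2c, unfold case_prod_beta) (intro continuous_intros)
  have "perturbation \<rho> \<eta> lam G \<xi> \<nu> fs ts p \<sigma> \<phi>"
  proof
    show "L2_continuous p" by (rule pL2)
    show "integral Omega (p t) = 0" if "0 \<le> t" for t using v_eq[OF that, of 1] bc[OF that] by simp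
    show "continuous_on ({0..} \<times> Omega) (\<lambda>(t, y). \<sigma> t y)" "continuous_on ({0..} \<times> Omega) (\<lambda>(t, y). \<phi> t y)"
      by (rule j\<sigma> j\<phi>)+
  next
    fix s t :: real and \<psi> assume st: "0 \<le> s" "s \<le> t" and \<psi>: "\<psi> \<in> L2" "integral Omega \<psi> = 0"
    define \<Psi> where "\<Psi> y = integral {0..y} \<psi>" for y
    have \<Psi>: "\<Psi> \<in> L2" unfolding \<Psi>_def
      by (intro L2_continuous_function indefinite_integral_continuous_1 L2_imp_integrable_on \<psi>) auto
    have T: "0 < t + 1" "t \<le> t + 1" using st by auto
    have AE: "AE r in lebesgue_on {0..t + 1}. L2_inner (ut r) \<Psi> = - (1 / \<rho>) * L2_inner (\<lambda>y. \<eta> * p r y + \<sigma> r y) \<psi>"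
    proof -
      have "AE r in lebesgue_on {0..t + 1}. u r \<in> H2" "AE r in lebesgue_on {0..t + 1}. ut r \<in> L2"
        "AE r in lebesgue_on {0..t + 1}. AE y in lebesgue_on Omega. \<rho> * ut r y = \<eta> * wderiv (wderiv (u r)) y + wderiv (\<tau> r) y"
        using reg[OF T(1)] unfolding in_L2_time_def by (auto elim!: eventually_mono)
      moreover have "AE r in lebesgue_on {0..t + 1}. r \<in> {0..t + 1}" by (intro AE_I2) simp
      ultimately show ?thesis
      proof eventually_elim
        case (elim r)
        then have r: "0 \<le> r" by simp
        obtain g where "has_weak_deriv (wderiv (u r)) g" using elim(1) unfolding H2_def by blast
        note u_yy = has_weak_deriv_wderiv[OF this]
        have "has_weak_deriv (\<lambda>y. (\<eta> * wderiv (u r) y + \<tau> r y) - (\<eta> * a + ts)) (\<lambda>y. (\<eta> * wderiv (wderiv (u r)) y + wderiv (\<tau> r) y) - 0)"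
          by (intro has_weak_deriv_diff has_weak_deriv_linear has_weak_deriv_const H1_wderiv[OF H1(2)[OF r]] u_yy)
        moreover have "(\<lambda>y. (\<eta> * wderiv (u r) y + \<tau> r y) - (\<eta> * a + ts)) = (\<lambda>y. \<eta> * p r y + \<sigma> r y)"
          by (simp add: p_def \<sigma>_def algebra_simps)
        ultimately have W: "has_weak_deriv (\<lambda>y. \<eta> * p r y + \<sigma> r y) (\<lambda>y. \<eta> * wderiv (wderiv (u r)) y + wderiv (\<tau> r) y)"
          by simp
        have "\<rho> * L2_inner (ut r) \<Psi> = L2_inner (\<lambda>y. \<rho> * ut r y) \<Psi>" by (simp add: L2_inner_scale_left)
        also have "\<dots> = L2_inner (\<lambda>y. \<eta> * wderiv (wderiv (u r)) y + wderiv (\<tau> r) y) \<Psi>"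
          using W elim(2) by (intro L2_inner_AE_cong[OF L2_measurable L2_measurable \<Psi> elim(3)] L2_scale)
            (auto simp: has_weak_deriv_def)
        also have "\<dots> = - L2_inner (\<lambda>y. \<eta> * p r y + \<sigma> r y) \<psi>"
          unfolding \<Psi>_def by (rule weak_deriv_duality[OF W \<psi>])
        finally show ?case using pos by (simp add: field_simps)
      qed
    qed
    have "L2_inner (u t) \<Psi> - L2_inner (u s) \<Psi> = integral {s..t} (\<lambda>r. - (1 / \<rho>) * L2_inner (\<lambda>y. \<eta> * p r y + \<sigma> r y) \<psi>)"
      by (rule weak_time_deriv_imp_integral[OF T(1) _ \<Psi> inner_cont[OF L2c[OF ju] \<Psi>]
            continuous_on_mult[OF continuous_on_const inner_cont[OF wL2 \<psi>(1)]] AE st T(2)])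
         (use reg[OF T(1)] in blast)
    then have "\<rho> * (L2_inner (u t) \<Psi> - L2_inner (u s) \<Psi>) = - integral {s..t} (\<lambda>r. L2_inner (\<lambda>y. \<eta> * p r y + \<sigma> r y) \<psi>)"
      using pos by simp
    moreover have "L2_inner (\<lambda>y. integral {0..y} (p r)) \<Psi> = L2_inner (u r) \<Psi> - L2_inner (\<lambda>y. a * y) \<Psi>" if r: "0 \<le> r" for r
    proof -
      have "L2_inner (\<lambda>y. integral {0..y} (p r)) \<Psi> = L2_inner (\<lambda>y. u r y - a * y) \<Psi>"
        by (rule L2_inner_cong) (auto simp: v_eq[OF r])
      also have "\<dots> = L2_inner (u r) \<Psi> - L2_inner (\<lambda>y. a * y) \<Psi>"
        by (intro L2_inner_diff_left H1_L2 H1 r \<Psi> L2_continuous_function continuous_intros)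
      finally show ?thesis .
    qed
    ultimately show "\<rho> * (L2_inner (\<lambda>y. integral {0..y} (p t)) (\<lambda>y. integral {0..y} \<psi>)
         - L2_inner (\<lambda>y. integral {0..y} (p s)) (\<lambda>y. integral {0..y} \<psi>))
      = - integral {s..t} (\<lambda>r. L2_inner (\<lambda>y. \<eta> * p r y + \<sigma> r y) \<psi>)"
      using st unfolding \<Psi>_def[symmetric, abs_def] by simp
  next
    fix s t :: real and h assume st: "0 \<le> s" "s \<le> t" and h: "h \<in> L2"
    have T: "0 < t + 1" "t \<le> t + 1" using st by auto
    have mem: "r \<in> {0..t + 1} \<Longrightarrow> \<tau>t r \<in> L2 \<and> ft r \<in> L2" for r using reg[OF T(1)] by (auto simp: in_C_time_def)
    have ae_r: "AE r in lebesgue_on {0..t + 1}. r \<in> {0..t + 1}" by (intro AE_I2) simp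
    show "L2_inner (\<sigma> t) h - L2_inner (\<sigma> s) h
      = integral {s..t} (\<lambda>r. L2_inner (\<lambda>y. (1 / lam) * (G * p r y - ((fs + \<phi> r y) * \<sigma> r y + ts * \<phi> r y))) h)"
    proof -
      have "AE r in lebesgue_on {0..t + 1}. AE y in lebesgue_on Omega. lam * \<tau>t r y = G * wderiv (u r) y - f r y * \<tau> r y"
        using reg[OF T(1)] by (auto elim!: eventually_mono)
      with ae_r have AE: "AE r in lebesgue_on {0..t + 1}. L2_inner (\<tau>t r) h
          = L2_inner (\<lambda>y. (1 / lam) * (G * p r y - ((fs + \<phi> r y) * \<sigma> r y + ts * \<phi> r y))) h"
      proof eventually_elim
        case (elim r)
        then have r: "0 \<le> r" "\<tau>t r \<in> L2" using mem by auto
        have "AE y in lebesgue_on Omega. \<tau>t r y = (1 / lam) * (G * p r y - ((fs + \<phi> r y) * \<sigma> r y + ts * \<phi> r y))"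
          using elim(2)
        proof eventually_elim
          case (elim y)
          have "G * p r y - ((fs + \<phi> r y) * \<sigma> r y + ts * \<phi> r y) = G * wderiv (u r) y - f r y * \<tau> r y + (fs * ts - G * a)"
            by (simp add: p_def \<sigma>_def \<phi>_def algebra_simps)
          also have "\<dots> = lam * \<tau>t r y" using elim eq by simp
          finally show ?case using pos by (simp only:) simp
        qed
        then show ?case
          by (intro L2_inner_AE_cong[OF L2_measurable[OF r(2)] L2_measurable h] L2_continuousD[OF SL2 r(1)])
      qed
      have "L2_inner (\<tau> t) h - L2_inner (\<tau> s) h
        = integral {s..t} (\<lambda>r. L2_inner (\<lambda>y. (1 / lam) * (G * p r y - ((fs + \<phi> r y) * \<sigma> r y + ts * \<phi> r y))) h)"
        by (rule weak_time_deriv_imp_integral[OF T(1) _ h inner_cont[OF L2c[OF j\<tau>] h] inner_cont[OF SL2 h] AE st T(2)])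
           (use reg[OF T(1)] in blast)
      moreover have "L2_inner (\<sigma> r) h = L2_inner (\<tau> r) h - L2_inner (\<lambda>y. ts) h" if "0 \<le> r" for r
        unfolding \<sigma>_def[abs_def] by (intro L2_inner_diff_left H1_L2 H1 that L2_const h)
      ultimately show ?thesis using st by simp
    qed
    show "L2_inner (\<phi> t) h - L2_inner (\<phi> s) h
      = integral {s..t} (\<lambda>r. L2_inner (\<lambda>y. (- 1 + \<xi> * \<bar>ts + \<sigma> r y\<bar>) * (fs + \<phi> r y)\<^sup>2 - \<nu> * (fs + \<phi> r y) ^ 3) h)"
    proof -
      have "AE r in lebesgue_on {0..t + 1}. AE y in lebesgue_on Omega. ft r y = (- 1 + \<xi> * \<bar>\<tau> r y\<bar>) * (f r y)\<^sup>2 - \<nu> * (f r y) ^ 3"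
        using reg[OF T(1)] by (auto elim!: eventually_mono)
      with ae_r have AE: "AE r in lebesgue_on {0..t + 1}. L2_inner (ft r) h
          = L2_inner (\<lambda>y. (- 1 + \<xi> * \<bar>ts + \<sigma> r y\<bar>) * (fs + \<phi> r y)\<^sup>2 - \<nu> * (fs + \<phi> r y) ^ 3) h"
      proof eventually_elim
        case (elim r)
        then have r: "0 \<le> r" "ft r \<in> L2" using mem by auto
        have "AE y in lebesgue_on Omega. ft r y = (- 1 + \<xi> * \<bar>ts + \<sigma> r y\<bar>) * (fs + \<phi> r y)\<^sup>2 - \<nu> * (fs + \<phi> r y) ^ 3"
          using elim(2) by eventually_elim (simp add: \<sigma>_def \<phi>_def)
        then show ?case
          by (intro L2_inner_AE_cong[OF L2_measurable[OF r(2)] L2_measurable h] L2_continuousD[OF QL2 r(1)])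
      qed
      have "L2_inner (f t) h - L2_inner (f s) h
        = integral {s..t} (\<lambda>r. L2_inner (\<lambda>y. (- 1 + \<xi> * \<bar>ts + \<sigma> r y\<bar>) * (fs + \<phi> r y)\<^sup>2 - \<nu> * (fs + \<phi> r y) ^ 3) h)"
        by (rule weak_time_deriv_imp_integral[OF T(1) _ h inner_cont[OF L2c[OF jf] h] inner_cont[OF QL2 h] AE st T(2)])
           (use reg[OF T(1)] in blast)
      moreover have "L2_inner (\<phi> r) h = L2_inner (f r) h - L2_inner (\<lambda>y. fs) h" if "0 \<le> r" for r
        unfolding \<phi>_def[abs_def] by (intro L2_inner_diff_left H1_L2 H1 that L2_const h)
      ultimately show ?thesis using st by simp
    qed
  qed
  then show "perturbation \<rho> \<eta> lam G \<xi> \<nu> fs ts (\<lambda>t y. wderiv (u t) y - a) (\<lambda>t y. \<tau> t y - ts) (\<lambda>t y. f t y - fs)"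
    unfolding p_def[abs_def] \<sigma>_def[abs_def] \<phi>_def[abs_def] .
qed


theorem theorem4p1:
  fixes \<rho> \<eta> lam G \<xi> \<nu> a :: real
  assumes "\<rho> > 0" "\<eta> > 0" "lam > 0" "G > 0" "\<xi> > 0" "\<nu> > 0" "a > 0"
  shows "\<exists>C>0. \<exists>\<epsilon>0. 0 < \<epsilon>0 \<and> \<epsilon>0 < C \<and>
    (\<forall>\<epsilon>. 0 < \<epsilon> \<and> \<epsilon> \<le> \<epsilon>0 \<longrightarrow>
      (\<exists>\<kappa>. \<forall>u0 \<tau>0 f0.
        u0 \<in> H1 \<and> \<tau>0 \<in> H1 \<and> f0 \<in> H1 \<and>
        (\<forall>y\<in>Omega. 0 \<le> f0 y) \<and> u0 0 = 0 \<and> u0 1 = a \<and>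
        (H1_norm (\<lambda>y. u0 y - u_inf a y))\<^sup>2
          + (Linf_norm (\<lambda>y. \<tau>0 y - tau_inf G \<xi> \<nu> a y))\<^sup>2
          + (Linf_norm (\<lambda>y. f0 y - f_inf G \<xi> \<nu> a y))\<^sup>2 \<le> \<epsilon>\<^sup>2
        \<longrightarrow>
        (\<forall>y\<in>Omega. 0 < \<tau>0 y \<and> 0 < f0 y) \<and>
        (\<forall>u \<tau> f. global_solution \<rho> \<eta> lam G \<xi> \<nu> a u0 \<tau>0 f0 u \<tau> f \<longrightarrow>
          ((\<lambda>t. H1_norm (\<lambda>y. u t y - u_inf a y)) \<longlongrightarrow> 0) at_top \<and>
          ((\<lambda>t. Linf_norm (\<lambda>y. \<tau> t y - tau_inf G \<xi> \<nu> a y)) \<longlongrightarrow> 0) at_top \<and>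
          ((\<lambda>t. Linf_norm (\<lambda>y. f t y - f_inf G \<xi> \<nu> a y)) \<longlongrightarrow> 0) at_top \<and>
          (\<forall>\<^sub>F t in at_top.
             H1_norm (\<lambda>y. u t y - u_inf a y)
               + Linf_norm (\<lambda>y. \<tau> t y - tau_inf G \<xi> \<nu> a y)
               + Linf_norm (\<lambda>y. f t y - f_inf G \<xi> \<nu> a y)
             \<le> \<kappa> * exp (- (C - \<epsilon>) * t)))))"
proof -
  define s where "s = sqrt (1 + 4 * \<nu> * \<xi> * G * a)"
  define ts where "ts = (s + 1) / (2 * \<xi>)"
  define fs where "fs = (s - 1) / (2 * \<nu>)"
  have s: "1 < s" "s\<^sup>2 = 1 + 4 * \<nu> * \<xi> * G * a" unfolding s_def using assms by (auto intro: add_nonneg_nonneg)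
  have tau_inf: "tau_inf G \<xi> \<nu> a y = ts" and f_inf: "f_inf G \<xi> \<nu> a y = fs" for y
    by (simp_all add: tau_inf_def f_inf_def ts_def fs_def s_def)
  have pos: "0 < ts" "0 < fs" using s assms by (auto simp: ts_def fs_def)
  have bal: "\<xi> * ts - 1 = \<nu> * fs" using assms by (simp add: ts_def fs_def field_simps)
  have eq: "fs * ts = G * a"
  proof -
    have "fs * ts = (s\<^sup>2 - 1) / (4 * \<nu> * \<xi>)" by (simp add: fs_def ts_def power2_eq_square algebra_simps)
    then show ?thesis using assms by (simp add: s(2))
  qed
  have co: "coefficients \<rho> \<eta> lam G \<xi> \<nu> fs ts"
    by unfold_locales (use assms pos bal in auto)
  then obtain \<delta> c where da: "damped_coefficients \<rho> \<eta> lam G \<xi> \<nu> fs ts \<delta> c"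
    using coefficients.exists_damping by blast
  interpret damped_coefficients \<rho> \<eta> lam G \<xi> \<nu> fs ts \<delta> c by (rule da)
  define KK where "KK = K8 * K7"
  have KK: "0 < KK" using constants_pos by (simp add: KK_def)
  \<comment> \<open>\<open>rate\<close> belongs to squared quantities.\<close>
  define C where "C = rate / 2"
  have C: "0 < C" using constants_pos by (simp add: C_def)
  \<comment> \<open>The three bounds serve \<open>\<epsilon>0 < C\<close>, the positivity of the initial stress and fluidity, and the hypotheses of \<open>global_decay\<close> with \<open>M = \<epsilon>\<^sup>2\<close>.\<close>
  define \<epsilon>0 where "\<epsilon>0 = min (min (C / 2) (min ts fs / 2)) (\<delta> / sqrt (KK + 3))"
  have \<epsilon>0: "0 < \<epsilon>0" "\<epsilon>0 < C" "\<epsilon>0 < ts" "\<epsilon>0 < fs" "\<epsilon>0 \<le> \<delta> / sqrt (KK + 3)"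
    using C pos \<delta>(1) KK by (auto simp: \<epsilon>0_def)
  have main: "(\<forall>y\<in>Omega. 0 < \<tau>0 y \<and> 0 < f0 y) \<and>
        (\<forall>u \<tau> f. global_solution \<rho> \<eta> lam G \<xi> \<nu> a u0 \<tau>0 f0 u \<tau> f \<longrightarrow>
          (\<forall>t\<ge>0. H1_norm (\<lambda>y. u t y - u_inf a y) \<le> 2 * sqrt KK * \<epsilon> * exp (- C * t) \<and>
             Linf_norm (\<lambda>y. \<tau> t y - ts) \<le> sqrt KK * \<epsilon> * exp (- C * t) \<and>
             Linf_norm (\<lambda>y. f t y - fs) \<le> sqrt KK * \<epsilon> * exp (- C * t) \<and>
             0 \<le> Linf_norm (\<lambda>y. \<tau> t y - ts) \<and> 0 \<le> Linf_norm (\<lambda>y. f t y - fs)))"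
    if \<epsilon>: "0 < \<epsilon>" "\<epsilon> \<le> \<epsilon>0" and data: "u0 \<in> H1" "\<tau>0 \<in> H1" "f0 \<in> H1" and
      close: "(H1_norm (\<lambda>y. u0 y - u_inf a y))\<^sup>2 + (Linf_norm (\<lambda>y. \<tau>0 y - ts))\<^sup>2 + (Linf_norm (\<lambda>y. f0 y - fs))\<^sup>2 \<le> \<epsilon>\<^sup>2"
    for \<epsilon> u0 \<tau>0 f0
  proof (intro conjI allI impI)
    have ct: "continuous_on Omega (\<lambda>y. \<tau>0 y - ts)" and cf: "continuous_on Omega (\<lambda>y. f0 y - fs)"
      by (rule continuous_on_diff[OF H1_continuous[OF data(2)] continuous_on_const],
          rule continuous_on_diff[OF H1_continuous[OF data(3)] continuous_on_const])
    have parts: "(H1_norm (\<lambda>y. u0 y - u_inf a y))\<^sup>2 \<le> \<epsilon>\<^sup>2" "(Linf_norm (\<lambda>y. \<tau>0 y - ts))\<^sup>2 \<le> \<epsilon>\<^sup>2" "(Linf_norm (\<lambda>y. f0 y - fs))\<^sup>2 \<le> \<epsilon>\<^sup>2"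
      using close zero_le_power2[of "H1_norm (\<lambda>y. u0 y - u_inf a y)"] zero_le_power2[of "Linf_norm (\<lambda>y. \<tau>0 y - ts)"]
        zero_le_power2[of "Linf_norm (\<lambda>y. f0 y - fs)"] by linarith+
    have "Linf_norm (\<lambda>y. \<tau>0 y - ts) \<le> \<epsilon>" "Linf_norm (\<lambda>y. f0 y - fs) \<le> \<epsilon>"
      using parts(2,3) \<epsilon>(1) by (auto intro: power2_le_imp_le)
    then have init: "\<bar>\<tau>0 y - ts\<bar> \<le> \<epsilon>" "\<bar>f0 y - fs\<bar> \<le> \<epsilon>" if "y \<in> Omega" for y
      using continuous_le_Linf_norm[OF ct that] continuous_le_Linf_norm[OF cf that] by auto
    show "\<forall>y\<in>Omega. 0 < \<tau>0 y \<and> 0 < f0 y"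
    proof
      fix y assume "y \<in> Omega"
      then show "0 < \<tau>0 y \<and> 0 < f0 y" using init[of y] \<epsilon>(2) \<epsilon>0(3,4) by (auto simp: abs_le_iff)
    qed
    fix u \<tau> f t assume sol: "global_solution \<rho> \<eta> lam G \<xi> \<nu> a u0 \<tau>0 f0 u \<tau> f" and t: "(0::real) \<le> t"
    note ext = global_solution_imp_perturbation[OF co eq sol]
    define p where "p t y = wderiv (u t) y - a" for t y
    define \<sigma> where "\<sigma> t y = \<tau> t y - ts" for t y
    define \<phi> where "\<phi> t y = f t y - fs" for t y
    interpret damped_perturbation \<rho> \<eta> lam G \<xi> \<nu> fs ts \<delta> c p \<sigma> \<phi>
      unfolding damped_perturbation_def p_def[abs_def] \<sigma>_def[abs_def] \<phi>_def[abs_def] using da ext(1) by blast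
    have v_eq: "u t y - u_inf a y = integral {0..y} (p t)" if "0 \<le> t" "y \<in> Omega" for t y
      using ext(2)[OF that] by (simp add: u_inf_def p_def[abs_def])
    have weak: "has_weak_deriv (\<lambda>y. u t y - u_inf a y) (p t)" if t: "0 \<le> t" for t
      by (rule has_weak_derivI_integral(1)[OF pm[OF t]]) (use v_eq[OF t] in auto)
    have "has_weak_deriv (\<lambda>y. u0 y - u_inf a y) (p 0)"
      by (rule has_weak_derivI_integral(1)[OF pm[OF order_refl]])
         (use v_eq[OF order_refl] sol in \<open>auto simp: global_solution_def\<close>)
    from H1_norm_ge(2)[OF this] have "(L2_norm (p 0))\<^sup>2 \<le> (H1_norm (\<lambda>y. u0 y - u_inf a y))\<^sup>2"
      by (intro power_mono) auto
    then have M1: "L2_inner (p 0) (p 0) \<le> \<epsilon>\<^sup>2" using parts(1) unfolding L2_norm_square by linarith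
    have M2: "(\<sigma> 0 y)\<^sup>2 \<le> \<epsilon>\<^sup>2" and M3: "(\<phi> 0 y)\<^sup>2 \<le> \<epsilon>\<^sup>2" if y: "y \<in> Omega" for y
    proof -
      have "\<tau> 0 y = \<tau>0 y" "f 0 y = f0 y" using sol y unfolding global_solution_def by blast+
      then show "(\<sigma> 0 y)\<^sup>2 \<le> \<epsilon>\<^sup>2" "(\<phi> 0 y)\<^sup>2 \<le> \<epsilon>\<^sup>2"
        using init[OF y] power_mono[of "\<bar>\<tau>0 y - ts\<bar>" \<epsilon> 2] power_mono[of "\<bar>f0 y - fs\<bar>" \<epsilon> 2] by (auto simp: \<sigma>_def \<phi>_def)
    qed
    have "\<epsilon> \<le> \<delta> / sqrt (KK + 3)" using \<epsilon>(2) \<epsilon>0(5) by simp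
    then have "\<epsilon>\<^sup>2 \<le> (\<delta> / sqrt (KK + 3))\<^sup>2" using \<epsilon>(1) by (intro power_mono) auto
    then have "\<epsilon>\<^sup>2 * (KK + 3) \<le> \<delta>\<^sup>2" using KK by (simp add: power_divide field_simps)
    then have "KK * \<epsilon>\<^sup>2 + 3 * \<epsilon>\<^sup>2 \<le> \<delta>\<^sup>2" by (simp add: algebra_simps)
    moreover have "0 < \<epsilon>\<^sup>2" "0 \<le> KK * \<epsilon>\<^sup>2" using \<epsilon>(1) KK by auto
    ultimately have M_small: "2 * \<epsilon>\<^sup>2 < \<delta>\<^sup>2" "K8 * K7 * \<epsilon>\<^sup>2 < \<delta>\<^sup>2"
      unfolding KK_def[symmetric] by linarith+
    define X where "X = sqrt KK * \<epsilon> * exp (- C * t)"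
    have X: "0 \<le> X" using KK \<epsilon>(1) by (simp add: X_def)
    have X2: "X\<^sup>2 = K8 * K7 * \<epsilon>\<^sup>2 * exp (- rate * t)"
    proof -
      have "(exp (- C * t))\<^sup>2 = exp (- rate * t)" by (simp add: exp_double[symmetric] C_def)
      then show ?thesis using KK by (simp add: X_def power_mult_distrib KK_def)
    qed
    have decay: "(\<sigma> t y)\<^sup>2 + (\<phi> t y)\<^sup>2 + D t \<le> X\<^sup>2" if "y \<in> Omega" for y
      unfolding X2 by (rule global_decay[OF M1 M2 M3 M_small t that])
    have ptw: "\<bar>\<sigma> t y\<bar> \<le> X" "\<bar>\<phi> t y\<bar> \<le> X" if "y \<in> Omega" for y
    proof -
      have "\<bar>\<sigma> t y\<bar>\<^sup>2 \<le> X\<^sup>2" "\<bar>\<phi> t y\<bar>\<^sup>2 \<le> X\<^sup>2"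
        unfolding power2_abs using decay[OF that] norms_le_D(1)[of t] zero_le_power2[of "\<sigma> t y"] zero_le_power2[of "\<phi> t y"]
        by linarith+
      then show "\<bar>\<sigma> t y\<bar> \<le> X" "\<bar>\<phi> t y\<bar> \<le> X" using X by (auto intro: power2_le_imp_le)
    qed
    have DX: "D t \<le> X\<^sup>2"
    proof -
      have "(\<sigma> t 0)\<^sup>2 + (\<phi> t 0)\<^sup>2 + D t \<le> X\<^sup>2" by (rule decay) simp
      then show ?thesis using zero_le_power2[of "\<sigma> t 0"] zero_le_power2[of "\<phi> t 0"] by linarith
    qed
    have "L2_norm (\<lambda>y. u t y - u_inf a y) = L2_norm (v t)"
      unfolding L2_norm_def using v_eq[OF t] by (intro arg_cong[where f = sqrt] Bochner_Integration.integral_cong) (auto simp: v_def)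
    then have "(L2_norm (\<lambda>y. u t y - u_inf a y))\<^sup>2 \<le> (L2_norm (p t))\<^sup>2"
      using v_le_p[OF t] by (simp add: power_mono)
    moreover have "(H1_norm (\<lambda>y. u t y - u_inf a y))\<^sup>2 = (L2_norm (\<lambda>y. u t y - u_inf a y))\<^sup>2 + (L2_norm (p t))\<^sup>2"
      unfolding H1_norm_eq[OF weak[OF t]] by simp
    moreover have "(2 * X)\<^sup>2 = 4 * X\<^sup>2" by (simp add: power_mult_distrib)
    ultimately have "(H1_norm (\<lambda>y. u t y - u_inf a y))\<^sup>2 \<le> (2 * X)\<^sup>2"
      using norms_le_D(2)[of t] DX zero_le_power2[of X] by linarith
    then have "H1_norm (\<lambda>y. u t y - u_inf a y) \<le> 2 * X" by (rule power2_le_imp_le) (use X in simp)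
    then show "H1_norm (\<lambda>y. u t y - u_inf a y) \<le> 2 * sqrt KK * \<epsilon> * exp (- C * t)" by (simp add: X_def)
    have c\<sigma>: "continuous_on Omega (\<lambda>y. \<tau> t y - ts)" and c\<phi>: "continuous_on Omega (\<lambda>y. f t y - fs)"
      by (rule continuous_on_diff[OF H1_continuous[OF conjunct1[OF conjunct2[OF ext(3)[OF t]]]] continuous_on_const],
          rule continuous_on_diff[OF H1_continuous[OF conjunct2[OF conjunct2[OF ext(3)[OF t]]]] continuous_on_const])
    show "Linf_norm (\<lambda>y. \<tau> t y - ts) \<le> sqrt KK * \<epsilon> * exp (- C * t)"
      using ptw(1) unfolding \<sigma>_def X_def by (intro Linf_norm_le[OF c\<sigma>])
    show "Linf_norm (\<lambda>y. f t y - fs) \<le> sqrt KK * \<epsilon> * exp (- C * t)"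
      using ptw(2) unfolding \<phi>_def X_def by (intro Linf_norm_le[OF c\<phi>])
    show "0 \<le> Linf_norm (\<lambda>y. \<tau> t y - ts)" "0 \<le> Linf_norm (\<lambda>y. f t y - fs)"
      by (intro Linf_norm_nonneg c\<sigma> c\<phi>)+
  qed
  have exp_lim: "((\<lambda>t. k * exp (- C * t)) \<longlongrightarrow> 0) at_top" for k :: real
  proof -
    have "filterlim (\<lambda>t. C * t) at_top at_top"
      by (rule filterlim_tendsto_pos_mult_at_top[OF tendsto_const C filterlim_ident])
    then have "((\<lambda>t. exp (- (C * t))) \<longlongrightarrow> 0) at_top"
      by (intro filterlim_compose[OF exp_at_bot] filterlim_uminus_at_bot_at_top[THEN filterlim_compose])
    from tendsto_mult_right_zero[OF this, of k] show ?thesis by simp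
  qed
  show ?thesis
  proof (rule exI[of _ C], intro conjI C, rule exI[of _ \<epsilon>0], intro conjI \<epsilon>0(1,2) allI impI)
    fix \<epsilon> :: real assume \<epsilon>: "0 < \<epsilon> \<and> \<epsilon> \<le> \<epsilon>0"
    show "\<exists>\<kappa>. \<forall>u0 \<tau>0 f0.
        u0 \<in> H1 \<and> \<tau>0 \<in> H1 \<and> f0 \<in> H1 \<and>
        (\<forall>y\<in>Omega. 0 \<le> f0 y) \<and> u0 0 = 0 \<and> u0 1 = a \<and>
        (H1_norm (\<lambda>y. u0 y - u_inf a y))\<^sup>2
          + (Linf_norm (\<lambda>y. \<tau>0 y - tau_inf G \<xi> \<nu> a y))\<^sup>2
          + (Linf_norm (\<lambda>y. f0 y - f_inf G \<xi> \<nu> a y))\<^sup>2 \<le> \<epsilon>\<^sup>2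
        \<longrightarrow>
        (\<forall>y\<in>Omega. 0 < \<tau>0 y \<and> 0 < f0 y) \<and>
        (\<forall>u \<tau> f. global_solution \<rho> \<eta> lam G \<xi> \<nu> a u0 \<tau>0 f0 u \<tau> f \<longrightarrow>
          ((\<lambda>t. H1_norm (\<lambda>y. u t y - u_inf a y)) \<longlongrightarrow> 0) at_top \<and>
          ((\<lambda>t. Linf_norm (\<lambda>y. \<tau> t y - tau_inf G \<xi> \<nu> a y)) \<longlongrightarrow> 0) at_top \<and>
          ((\<lambda>t. Linf_norm (\<lambda>y. f t y - f_inf G \<xi> \<nu> a y)) \<longlongrightarrow> 0) at_top \<and>
          (\<forall>\<^sub>F t in at_top.
             H1_norm (\<lambda>y. u t y - u_inf a y)
               + Linf_norm (\<lambda>y. \<tau> t y - tau_inf G \<xi> \<nu> a y)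
               + Linf_norm (\<lambda>y. f t y - f_inf G \<xi> \<nu> a y)
             \<le> \<kappa> * exp (- (C - \<epsilon>) * t)))"
      unfolding tau_inf f_inf
    proof (intro exI[of _ "4 * sqrt KK * \<epsilon>"] allI impI, elim conjE)
      fix u0 \<tau>0 f0
      assume data: "u0 \<in> H1" "\<tau>0 \<in> H1" "f0 \<in> H1" and
        close: "(H1_norm (\<lambda>y. u0 y - u_inf a y))\<^sup>2 + (Linf_norm (\<lambda>y. \<tau>0 y - ts))\<^sup>2 + (Linf_norm (\<lambda>y. f0 y - fs))\<^sup>2 \<le> \<epsilon>\<^sup>2"
      note m = main[OF conjunct1[OF \<epsilon>] conjunct2[OF \<epsilon>] data close]
      show "(\<forall>y\<in>Omega. 0 < \<tau>0 y \<and> 0 < f0 y) \<and>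
        (\<forall>u \<tau> f. global_solution \<rho> \<eta> lam G \<xi> \<nu> a u0 \<tau>0 f0 u \<tau> f \<longrightarrow>
          ((\<lambda>t. H1_norm (\<lambda>y. u t y - u_inf a y)) \<longlongrightarrow> 0) at_top \<and>
          ((\<lambda>t. Linf_norm (\<lambda>y. \<tau> t y - ts)) \<longlongrightarrow> 0) at_top \<and>
          ((\<lambda>t. Linf_norm (\<lambda>y. f t y - fs)) \<longlongrightarrow> 0) at_top \<and>
          (\<forall>\<^sub>F t in at_top.
             H1_norm (\<lambda>y. u t y - u_inf a y) + Linf_norm (\<lambda>y. \<tau> t y - ts) + Linf_norm (\<lambda>y. f t y - fs)
             \<le> 4 * sqrt KK * \<epsilon> * exp (- (C - \<epsilon>) * t)))"
      proof (intro conjI allI impI)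
        show "\<forall>y\<in>Omega. 0 < \<tau>0 y \<and> 0 < f0 y" using m by blast
        fix u \<tau> f assume "global_solution \<rho> \<eta> lam G \<xi> \<nu> a u0 \<tau>0 f0 u \<tau> f"
        with m have bounds: "H1_norm (\<lambda>y. u t y - u_inf a y) \<le> 2 * sqrt KK * \<epsilon> * exp (- C * t)"
             "Linf_norm (\<lambda>y. \<tau> t y - ts) \<le> sqrt KK * \<epsilon> * exp (- C * t)"
             "Linf_norm (\<lambda>y. f t y - fs) \<le> sqrt KK * \<epsilon> * exp (- C * t)"
             "0 \<le> Linf_norm (\<lambda>y. \<tau> t y - ts)" "0 \<le> Linf_norm (\<lambda>y. f t y - fs)" if "0 \<le> t" for t
          using that by blast+
        have lim: "(F \<longlongrightarrow> 0) at_top" if "\<And>t. 0 \<le> t \<Longrightarrow> 0 \<le> F t \<and> F t \<le> k * exp (- C * t)" for F :: "real \<Rightarrow> real" and k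
        proof (rule Lim_null_comparison[OF _ exp_lim])
          show "\<forall>\<^sub>F t in at_top. norm (F t) \<le> k * exp (- C * t)"
            using eventually_ge_at_top[of 0] by eventually_elim (use that in auto)
        qed
        show "((\<lambda>t. H1_norm (\<lambda>y. u t y - u_inf a y)) \<longlongrightarrow> 0) at_top"
          by (rule lim, rule conjI, rule H1_norm_nonneg, erule bounds(1))
        show "((\<lambda>t. Linf_norm (\<lambda>y. \<tau> t y - ts)) \<longlongrightarrow> 0) at_top"
          by (rule lim, rule conjI, erule bounds(4), erule bounds(2))
        show "((\<lambda>t. Linf_norm (\<lambda>y. f t y - fs)) \<longlongrightarrow> 0) at_top"
          by (rule lim, rule conjI, erule bounds(5), erule bounds(3))
        show "\<forall>\<^sub>F t in at_top. H1_norm (\<lambda>y. u t y - u_inf a y) + Linf_norm (\<lambda>y. \<tau> t y - ts) + Linf_norm (\<lambda>y. f t y - fs)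
             \<le> 4 * sqrt KK * \<epsilon> * exp (- (C - \<epsilon>) * t)"
          using eventually_ge_at_top[of 0]
        proof eventually_elim
          case (elim t)
          have "H1_norm (\<lambda>y. u t y - u_inf a y) + Linf_norm (\<lambda>y. \<tau> t y - ts) + Linf_norm (\<lambda>y. f t y - fs)
              \<le> 4 * sqrt KK * \<epsilon> * exp (- C * t)"
            using bounds(1-3)[OF elim] by linarith
          also have "\<dots> \<le> 4 * sqrt KK * \<epsilon> * exp (- (C - \<epsilon>) * t)"
            using KK \<epsilon> elim by (intro mult_left_mono) (auto simp: algebra_simps)
          finally show ?case .
        qed
      qed
    qed
  qed
qed

end
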